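(* Let $g\in K[[X]][Y]$ be an irreducible Weierstrass polynomial of degree $m$ in $Y$, let $\Delta=\{\delta_1,\dots,\delta_m\}$ be the set of singular parts of the Puiseux expansions of $g$, and let $d$ be an integer with $1\le d\le m-1$. Then the algorithm $\mathtt{IntegralBasisElement}(\Delta,d)$ described in the context terminates and returns a polynomial $p_d\in K[X][Y]$, monic of degree $d$ in $Y$, such that $\upsilon_g(p_d)$ is the maximal valuation $\upsilon_g(q)$ among all $q\in K[X][Y]$ monic of degree $d$ in $Y$.
   Context: $K$ is a field of characteristic zero and $K\subset L$ is a field extension with $L$ algebraically closed. $L\{\{X\}\}=\bigcup_{k\ge1}L((X^{1/k}))$ is the (algebraically closed) field of Puiseux series over $L$. For $\gamma\in L\{\{X\}\}\setminus\{0\}$, $\upsilon(\gamma)$ is the smallest exponent appearing in a term of $\gamma$; $\upsilon(0)=\infty$. A Weierstrass polynomial is a polynomial in $K[[X]][Y]$, monic in $Y$, whose non-leading coefficients vanish at $X=0$. The Puiseux expansions of $g$ are its roots $\gamma_1,\dots,\gamma_m\in L\{\{X\}\}$; for $q\in L\{\{X\}\}[Y]$, $\upsilon_g(q)=\min_i\upsilon(q(X,\gamma_i))$. If $\gamma=a_1X^{t_1}+a_2X^{t_2}+\dots$ is a Puiseux expansion of $g$ with $0\le t_1<t_2<\dots$ and no $a_i$ zero, its regularity index is the least exponent $t_k$ such that no other Puiseux expansion of $g$ has the same initial part $a_1X^{t_1}+\dots+a_kX^{t_k}$; this initial part is the singular part of $\gamma$. For a Puiseux series $\gamma$ and $t\in\mathbb{Q}_{\ge0}$,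 $\overline{\gamma}^{(t)}$ (resp. $\overline{\gamma}^{<t}$) is the sum of the terms of $\gamma$ with exponent $\le t$ (resp. $<t$). Algorithm $\mathtt{IntegralBasisElement}(\Delta,d)$, for a set $\Delta=\{\delta_1,\dots,\delta_m\}$ of $m$ pairwise distinct finite Puiseux series and $1\le d\le m-1$: 1. Let $t$ be the maximal extended characteristic exponent, i.e. the least $t\in\mathbb{Q}_{\ge0}$ such that the truncations $\overline{\delta}_1^{(t)},\dots,\overline{\delta}_m^{(t)}$ are pairwise different. 2. Let $\rho_1,\dots,\rho_{\overline m}$ be the pairwise different elements of $\{\overline{\delta}_1^{<t},\dots,\overline{\delta}_m^{<t}\}$. 3. Set $u=\lfloor d/\overline m\rfloor$, $\overline d=d-u\overline m$, $q=1$, $p=1$. 4. If $\overline d>0$, set $q=\mathtt{IntegralBasisElement}(\{\rho_1,\dots,\rho_{\overline m}\},\overline d)$. 5. If $u>0$, set $p=\prod_{i=1}^{\overline m}(Y-\rho_i(X))$. 6. Return $p_d=p^uq$. *)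

theory Defs
  imports
    "HOL-Computational_Algebra.Computational_Algebra"
    "HOL-Library.Extended"
begin

unbundle fps_syntax

section \<open>Puiseux series\<close>

text \<open>
  A Puiseux series is represented by its coefficient function on rational exponents.
  \<open>ramified k F\<close> is the coefficient function of \<open>F(X\<^bsup>1/k\<^esup>)\<close> for a formal Laurent series \<open>F\<close>,
  so the type below is the union of the fields \<open>L((X\<^bsup>1/k\<^esup>))\<close> over all \<open>k \<ge> 1\<close>.
\<close>

definition ramified :: "nat \<Rightarrow> 'a::zero fls \<Rightarrow> rat \<Rightarrow> 'a" where
  "ramified k F r = (if of_nat k * r \<in> \<int> then fls_nth F \<lfloor>of_nat k * r\<rfloor> else 0)"

definition puiseux_funs :: "(rat \<Rightarrow> 'a::zero) set" where
  "puiseux_funs = {ramified k F | k F. k > 0}"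

lemma ramified_in_puiseux_funs: "k > 0 \<Longrightarrow> ramified k F \<in> puiseux_funs"
  by (auto simp: puiseux_funs_def)

lemma puiseux_funsE:
  assumes "f \<in> puiseux_funs"
  obtains k F where "k > 0" "f = ramified k F"
  using assms by (auto simp: puiseux_funs_def)

typedef (overloaded) 'a puiseux = "puiseux_funs :: (rat \<Rightarrow> 'a::zero) set"
  morphisms puiseux_nth Abs_puiseux
  using ramified_in_puiseux_funs[OF zero_less_one] by blast

setup_lifting type_definition_puiseux

lemma puiseux_eqI: "(\<And>r. puiseux_nth f r = puiseux_nth g r) \<Longrightarrow> f = g"
  by (metis ext puiseux_nth_inject)

lemma ramified_mult:
  assumes "k > 0" "n > 0"
  shows "ramified k F = ramified (k * n) (fls_compose_power F n)"
proof
  fix r :: rat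
  show "ramified k F r = ramified (k * n) (fls_compose_power F n) r"
  proof (cases "of_nat k * r \<in> \<int>")
    case True
    then obtain i where i: "of_nat k * r = of_int i" by (elim Ints_cases)
    have "of_nat (k * n) * r = (of_int (int n * i) :: rat)"
      using i by (simp add: algebra_simps)
    then show ?thesis
      using i assms by (simp add: ramified_def fls_nth_compose_power del: of_nat_mult of_int_mult)
  next
    case False
    show ?thesis
    proof (cases "of_nat (k * n) * r \<in> \<int>")
      case True
      then obtain j where j: "of_nat (k * n) * r = of_int j" by (elim Ints_cases)
      have "\<not> int n dvd j"
      proof
        assume "int n dvd j"
        then obtain l where "j = int n * l" by (elim dvdE)
        with j have "of_nat n * (of_nat k * r) = (of_nat n * of_int l :: rat)"
          by (simp add: algebra_simps)
        then have "of_nat k * r = of_int l"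
          using assms by simp
        with False show False by auto
      qed
      then show ?thesis
        using False j assms by (simp add: ramified_def fls_nth_compose_power del: of_nat_mult)
    qed (use False in \<open>simp add: ramified_def\<close>)
  qed
qed

lemma ramified_common:
  assumes "f \<in> puiseux_funs" "g \<in> puiseux_funs"
  obtains k F G where "k > 0" "f = ramified k F" "g = ramified k G"
proof -
  obtain k F where f: "k > 0" "f = ramified k F" using assms(1) by (rule puiseux_funsE)
  obtain l G where g: "l > 0" "g = ramified l G" using assms(2) by (rule puiseux_funsE)
  show ?thesis
  proof (rule that)
    show "k * l > 0" using f g by simp
    show "f = ramified (k * l) (fls_compose_power F l)"
      using ramified_mult[OF f(1) g(1)] f(2) by simp
    show "g = ramified (k * l) (fls_compose_power G k)"
      using ramified_mult[OF g(1) f(1)] g(2) by (simp add: mult.commute)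
  qed
qed

lemma puiseux_ramified3:
  fixes f g h :: "'a::zero puiseux"
  obtains k F G H where "k > 0" "puiseux_nth f = ramified k F" "puiseux_nth g = ramified k G"
    "puiseux_nth h = ramified k H"
proof -
  obtain k F G where f: "k > 0" "puiseux_nth f = ramified k F" "puiseux_nth g = ramified k G"
    using puiseux_nth[of f] puiseux_nth[of g] by (rule ramified_common)
  obtain l H where h: "l > 0" "puiseux_nth h = ramified l H" using puiseux_nth[of h] by (rule puiseux_funsE)
  show ?thesis
  proof (rule that)
    show "k * l > 0" using f h by simp
    show "puiseux_nth f = ramified (k * l) (fls_compose_power F l)"
      using ramified_mult[OF f(1) h(1)] f(2) by simp
    show "puiseux_nth g = ramified (k * l) (fls_compose_power G l)"
      using ramified_mult[OF f(1) h(1)] f(3) by simp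
    show "puiseux_nth h = ramified (k * l) (fls_compose_power H k)"
      using ramified_mult[OF h(1) f(1)] h(2) by (simp add: mult.commute)
  qed
qed

text \<open>
  The convolution of two coefficient functions. For Puiseux series the index set of the sum
  is finite.
\<close>

definition convolution :: "(rat \<Rightarrow> 'a::semiring_0) \<Rightarrow> (rat \<Rightarrow> 'a) \<Rightarrow> rat \<Rightarrow> 'a" where
  "convolution f g r = (\<Sum>s | f s \<noteq> 0 \<and> g (r - s) \<noteq> 0. f s * g (r - s))"

lemma convolution_ramified:
  fixes F G :: "'a::comm_ring_1 fls"
  assumes k: "k > 0"
  shows "convolution (ramified k F) (ramified k G) = ramified k (F * G)"
proof
  fix r :: rat
  let ?S = "{s. ramified k F s \<noteq> 0 \<and> ramified k G (r - s) \<noteq> 0}"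
  show "convolution (ramified k F) (ramified k G) r = ramified k (F * G) r"
  proof (cases "of_nat k * r \<in> \<int>")
    case False
    have "?S = {}"
    proof (rule ccontr)
      assume "?S \<noteq> {}"
      then obtain s where s: "of_nat k * s \<in> \<int>" "of_nat k * (r - s) \<in> \<int>"
        by (auto simp: ramified_def split: if_splits)
      then have "of_nat k * s + of_nat k * (r - s) \<in> \<int>" by (rule Ints_add)
      with False show False by (simp add: algebra_simps)
    qed
    then show ?thesis using False by (simp only: convolution_def) (simp add: ramified_def)
  next
    case True
    then obtain n where n: "of_nat k * r = of_int n" by (elim Ints_cases)
    let ?h = "\<lambda>i::int. of_int i / of_nat k :: rat"
    let ?I = "{fls_subdegree F..n - fls_subdegree G}"
    have inj: "inj_on ?h ?I" using k by (auto simp: inj_on_def)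
    have F: "ramified k F (?h i) = F $$ i" for i
      using k by (simp add: ramified_def)
    have G: "ramified k G (r - ?h i) = G $$ (n - i)" for i
    proof -
      have "of_nat k * (r - ?h i) = of_int (n - i)"
        using k n by (simp add: right_diff_distrib)
      then show ?thesis by (simp add: ramified_def del: of_int_diff)
    qed
    have sub: "?S \<subseteq> ?h ` ?I"
    proof
      fix s assume s: "s \<in> ?S"
      then have "of_nat k * s \<in> \<int>" by (auto simp: ramified_def split: if_splits)
      then obtain i where "of_nat k * s = of_int i" by (elim Ints_cases)
      then have i: "s = ?h i" using k by (simp add: field_simps)
      with s F G have "F $$ i \<noteq> 0" "G $$ (n - i) \<noteq> 0" by auto
      then have "fls_subdegree F \<le> i" "fls_subdegree G \<le> n - i"
        by (auto intro: fls_subdegree_leI)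
      with i show "s \<in> ?h ` ?I" by auto
    qed
    have "convolution (ramified k F) (ramified k G) r
        = (\<Sum>s\<in>?h ` ?I. ramified k F s * ramified k G (r - s))"
      unfolding convolution_def by (rule sum.mono_neutral_left) (use sub in auto)
    also have "\<dots> = (\<Sum>i\<in>?I. F $$ i * G $$ (n - i))"
      by (subst sum.reindex[OF inj]) (simp add: F G)
    also have "\<dots> = ramified k (F * G) r"
      using n by (simp add: ramified_def fls_times_nth(2))
    finally show ?thesis .
  qed
qed

instantiation puiseux :: (comm_ring_1) comm_ring_1
begin

lift_definition zero_puiseux :: "'a puiseux" is "\<lambda>_. 0"
proof -
  have "(\<lambda>_. 0 :: 'a) = ramified 1 0"
    by (simp add: ramified_def fun_eq_iff)
  then show "(\<lambda>_. 0 :: 'a) \<in> puiseux_funs"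
    by (simp add: ramified_in_puiseux_funs)
qed

lemma ramified_one:
  assumes "k > 0"
  shows "ramified k 1 = (\<lambda>r. if r = 0 then 1 else 0 :: 'a)"
proof
  fix r :: rat
  show "ramified k 1 r = (if r = 0 then 1 else 0 :: 'a)"
    using assms by (cases "of_nat k * r \<in> \<int>") (auto simp: ramified_def elim!: Ints_cases)
qed

lift_definition one_puiseux :: "'a puiseux" is "\<lambda>r. if r = 0 then 1 else 0"
  using ramified_in_puiseux_funs[of 1 "1 :: 'a fls"] by (simp add: ramified_one)

lift_definition plus_puiseux :: "'a puiseux \<Rightarrow> 'a puiseux \<Rightarrow> 'a puiseux" is "\<lambda>f g r. f r + g r"
proof -
  fix f g :: "rat \<Rightarrow> 'a"
  assume "f \<in> puiseux_funs" "g \<in> puiseux_funs"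
  then obtain k F G where *: "k > 0" "f = ramified k F" "g = ramified k G"
    by (rule ramified_common)
  then have "(\<lambda>r. f r + g r) = ramified k (F + G)"
    by (auto simp: ramified_def fun_eq_iff)
  with * show "(\<lambda>r. f r + g r) \<in> puiseux_funs" by (simp add: ramified_in_puiseux_funs)
qed

lift_definition uminus_puiseux :: "'a puiseux \<Rightarrow> 'a puiseux" is "\<lambda>f r. - f r"
proof -
  fix f :: "rat \<Rightarrow> 'a"
  assume "f \<in> puiseux_funs"
  then obtain k F where *: "k > 0" "f = ramified k F" by (rule puiseux_funsE)
  then have "(\<lambda>r. - f r) = ramified k (- F)"
    by (auto simp: ramified_def fun_eq_iff)
  with * show "(\<lambda>r. - f r) \<in> puiseux_funs" by (simp add: ramified_in_puiseux_funs)
qed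

definition minus_puiseux :: "'a puiseux \<Rightarrow> 'a puiseux \<Rightarrow> 'a puiseux" where
  "minus_puiseux f g = f + (- g)"

lift_definition times_puiseux :: "'a puiseux \<Rightarrow> 'a puiseux \<Rightarrow> 'a puiseux" is convolution
proof -
  fix f g :: "rat \<Rightarrow> 'a"
  assume "f \<in> puiseux_funs" "g \<in> puiseux_funs"
  then obtain k F G where *: "k > 0" "f = ramified k F" "g = ramified k G"
    by (rule ramified_common)
  then have "convolution f g = ramified k (F * G)"
    by (simp add: convolution_ramified)
  with * show "convolution f g \<in> puiseux_funs" by (simp add: ramified_in_puiseux_funs)
qed

lemma puiseux_nth_one_ramified: "k > 0 \<Longrightarrow> puiseux_nth (1 :: 'a puiseux) = ramified k 1"
  by (simp add: one_puiseux.rep_eq ramified_one)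

lemma puiseux_nth_add_ramified:
  assumes "puiseux_nth f = ramified k F" "puiseux_nth g = ramified k G"
  shows "puiseux_nth (f + g :: 'a puiseux) = ramified k (F + G)"
  using assms by (simp add: plus_puiseux.rep_eq ramified_def fun_eq_iff)

lemma puiseux_nth_mult_ramified:
  assumes "k > 0" "puiseux_nth f = ramified k F" "puiseux_nth g = ramified k G"
  shows "puiseux_nth (f * g :: 'a puiseux) = ramified k (F * G)"
  using assms by (simp add: times_puiseux.rep_eq convolution_ramified)

instance
proof
  fix a b c :: "'a puiseux"
  show "a + b + c = a + (b + c)" by transfer (simp add: add.assoc)
  show "a + b = b + a" by transfer (simp add: add.commute)
  show "0 + a = a" by transfer simp
  show "- a + a = 0" by transfer simp
  show "a - b = a + - b" by (simp add: minus_puiseux_def)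
  show "(0::'a puiseux) \<noteq> 1" by transfer (auto simp: fun_eq_iff)
  obtain k F G H where k: "k > 0" and *: "puiseux_nth a = ramified k F"
    "puiseux_nth b = ramified k G" "puiseux_nth c = ramified k H"
    by (rule puiseux_ramified3)
  note mult = puiseux_nth_mult_ramified[OF k] and add = puiseux_nth_add_ramified
  show "a * b * c = a * (b * c)"
    by (simp add: mult[OF mult[OF *(1,2)] *(3)] mult[OF *(1) mult[OF *(2,3)]] mult.assoc
        flip: puiseux_nth_inject)
  show "a * b = b * a"
    by (simp add: mult[OF *(1,2)] mult[OF *(2,1)] mult.commute flip: puiseux_nth_inject)
  show "1 * a = a"
    by (simp add: mult[OF puiseux_nth_one_ramified[OF k] *(1)] *(1) flip: puiseux_nth_inject)
  show "(a + b) * c = a * c + b * c"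
    by (simp add: mult[OF add[OF *(1,2)] *(3)] add[OF mult[OF *(1,3)] mult[OF *(2,3)]]
        distrib_right flip: puiseux_nth_inject)
qed

end

lemma puiseux_nth_0 [simp]: "puiseux_nth 0 r = 0"
  by transfer simp

lemma puiseux_nth_1: "puiseux_nth 1 r = (if r = 0 then 1 else 0)"
  by transfer simp

lemma puiseux_nth_add [simp]: "puiseux_nth (f + g) r = puiseux_nth f r + puiseux_nth g r"
  by transfer simp

lemma puiseux_nth_uminus [simp]: "puiseux_nth (- f) r = - puiseux_nth f r"
  by transfer simp

lemma puiseux_nth_diff [simp]: "puiseux_nth (f - g) r = puiseux_nth f r - puiseux_nth g r"
  using puiseux_nth_add[of f "- g" r] by (simp del: puiseux_nth_add)

lemma puiseux_inverse_exists:
  fixes f :: "'a::field puiseux"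
  assumes "f \<noteq> 0"
  shows "\<exists>g. g * f = 1"
proof -
  obtain k F where f: "k > 0" "puiseux_nth f = ramified k F" using puiseux_nth[of f] by (rule puiseux_funsE)
  have "F \<noteq> 0"
  proof
    assume "F = 0"
    with f have "f = 0" by (intro puiseux_eqI) (simp add: ramified_def)
    with assms show False by simp
  qed
  have "puiseux_nth (Abs_puiseux (ramified k (inverse F))) = ramified k (inverse F)"
    using f by (intro Abs_puiseux_inverse ramified_in_puiseux_funs)
  from puiseux_nth_mult_ramified[OF f(1) this f(2)] \<open>F \<noteq> 0\<close>
  show ?thesis
    by (metis f(1) left_inverse puiseux_nth_inject puiseux_nth_one_ramified)
qed

instantiation puiseux :: (field) field
begin

definition inverse_puiseux :: "'a puiseux \<Rightarrow> 'a puiseux" where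
  "inverse_puiseux f = (if f = 0 then 0 else (SOME g. g * f = 1))"

definition divide_puiseux :: "'a puiseux \<Rightarrow> 'a puiseux \<Rightarrow> 'a puiseux" where
  "divide_puiseux f g = f * inverse g"

instance
proof
  fix a b :: "'a puiseux"
  show "a \<noteq> 0 \<Longrightarrow> inverse a * a = 1"
    by (simp add: inverse_puiseux_def someI_ex[OF puiseux_inverse_exists])
qed (simp_all add: inverse_puiseux_def divide_puiseux_def)

end

lift_definition puiseux_of_fps :: "'a::zero fps \<Rightarrow> 'a puiseux" is
  "\<lambda>f. ramified 1 (fps_to_fls f)"
  by (simp add: ramified_in_puiseux_funs)

text \<open>The order function \<open>\<upsilon>\<close>; the value \<open>Pinf\<close> of type \<^typ>\<open>rat extended\<close> is \<open>\<infinity>\<close>.\<close>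

definition puiseux_val :: "'a::comm_ring_1 puiseux \<Rightarrow> rat extended" where
  "puiseux_val f = (if f = 0 then Pinf else Fin (LEAST r. puiseux_nth f r \<noteq> 0))"

lemma ramified_restrict:
  fixes P :: "rat \<Rightarrow> bool" and f :: "rat \<Rightarrow> 'a::zero"
  assumes "f \<in> puiseux_funs"
  shows "(\<lambda>r. if P r then f r else 0) \<in> puiseux_funs"
proof -
  from assms obtain k F where k: "k > 0" and f: "f = ramified k F" by (rule puiseux_funsE)
  let ?c = "\<lambda>n. if P (of_int n / of_nat k) then F $$ n else 0"
  have "Abs_fls ?c $$ n = ?c n" for n
    by (rule nth_Abs_fls_lower_bound[of "fls_subdegree F"]) simp
  note c = this
  have "(\<lambda>r. if P r then f r else 0) = ramified k (Abs_fls ?c)"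
  proof
    fix r :: rat
    show "(if P r then f r else 0) = ramified k (Abs_fls ?c) r"
    proof (cases "of_nat k * r \<in> \<int>")
      case True
      then obtain n where n: "of_nat k * r = of_int n" by (elim Ints_cases)
      have r: "r = of_int n / of_nat k" using k by (simp add: eq_divide_eq mult.commute flip: n)
      show ?thesis unfolding f ramified_def n c by (simp add: r)
    qed (simp add: f ramified_def)
  qed
  with k show ?thesis by (simp add: ramified_in_puiseux_funs)
qed

lift_definition trunc_le :: "rat \<Rightarrow> 'a::zero puiseux \<Rightarrow> 'a puiseux" is
  "\<lambda>t f r. if r \<le> t then f r else 0"
  by (rule ramified_restrict)

lift_definition trunc_less :: "rat \<Rightarrow> 'a::zero puiseux \<Rightarrow> 'a puiseux" is
  "\<lambda>t f r. if r < t then f r else 0"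
  by (rule ramified_restrict)


section \<open>The field extension and the embeddings into \<open>L{{X}}[Y]\<close>\<close>

text \<open>
  The extension \<open>K \<subset> L\<close> is given by an embedding \<open>\<iota>\<close> of fields. Polynomials in \<open>K[[X]][Y]\<close>
  and \<open>K[X][Y]\<close> have types \<open>'k fps poly\<close> and \<open>'k poly poly\<close>, with \<open>Y\<close> as the outer variable.
\<close>

definition field_embedding :: "('k::field \<Rightarrow> 'l::field) \<Rightarrow> bool" where
  "field_embedding \<iota> \<longleftrightarrow>
     \<iota> 1 = 1 \<and> (\<forall>x y. \<iota> (x + y) = \<iota> x + \<iota> y) \<and> (\<forall>x y. \<iota> (x * y) = \<iota> x * \<iota> y)"

definition fps_poly_embed :: "('k::field \<Rightarrow> 'l::field) \<Rightarrow> 'k fps poly \<Rightarrow> 'l puiseux poly" where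
  "fps_poly_embed \<iota> g = map_poly (\<lambda>c. puiseux_of_fps (Abs_fps (\<lambda>n. \<iota> (fps_nth c n)))) g"

definition poly_poly_embed :: "('k::field \<Rightarrow> 'l::field) \<Rightarrow> 'k poly poly \<Rightarrow> 'l puiseux poly" where
  "poly_poly_embed \<iota> q = fps_poly_embed \<iota> (map_poly fps_of_poly q)"

definition monic_of_degree :: "'a::comm_semiring_1 poly \<Rightarrow> nat \<Rightarrow> bool" where
  "monic_of_degree p d \<longleftrightarrow> lead_coeff p = 1 \<and> degree p = d"

definition weierstrass_poly :: "'k::field fps poly \<Rightarrow> bool" where
  "weierstrass_poly g \<longleftrightarrow> lead_coeff g = 1 \<and> (\<forall>i<degree g. fps_nth (coeff g i) 0 = 0)"

definition puiseux_expansions :: "('k::field \<Rightarrow> 'l::field) \<Rightarrow> 'k fps poly \<Rightarrow> 'l puiseux set" where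
  "puiseux_expansions \<iota> g = {\<gamma>. poly (fps_poly_embed \<iota> g) \<gamma> = 0}"

definition val_at ::
    "('k::field \<Rightarrow> 'l::field) \<Rightarrow> 'k fps poly \<Rightarrow> 'l puiseux poly \<Rightarrow> rat extended" where
  "val_at \<iota> g q = Min ((\<lambda>\<gamma>. puiseux_val (poly q \<gamma>)) ` puiseux_expansions \<iota> g)"

text \<open>
  In the next two definitions, \<open>\<Gamma>\<close> is the set of all Puiseux expansions of a polynomial
  and \<open>\<gamma> \<in> \<Gamma>\<close>. The exponents of \<open>\<gamma>\<close> are the elements of its support.
\<close>

definition regularity_index :: "'a::zero puiseux set \<Rightarrow> 'a puiseux \<Rightarrow> rat" where
  "regularity_index \<Gamma> \<gamma> =
     (LEAST t. puiseux_nth \<gamma> t \<noteq> 0 \<and> (\<forall>\<gamma>'\<in>\<Gamma>. \<gamma>' \<noteq> \<gamma> \<longrightarrow> trunc_le t \<gamma>' \<noteq> trunc_le t \<gamma>))"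

definition singular_part :: "'a::zero puiseux set \<Rightarrow> 'a puiseux \<Rightarrow> 'a puiseux" where
  "singular_part \<Gamma> \<gamma> = trunc_le (regularity_index \<Gamma> \<gamma>) \<gamma>"


section \<open>The algorithm\<close>

definition max_extended_char_exponent :: "'a::zero puiseux set \<Rightarrow> rat" where
  "max_extended_char_exponent \<Delta> = (LEAST t. t \<ge> 0 \<and> inj_on (trunc_le t) \<Delta>)"

text \<open>
  The algorithm is defined as a partial function. Its termination on the input \<open>(\<Delta>, d)\<close> is the
  statement \<open>IntegralBasisElement_dom (\<Delta>, d)\<close>: the chain of recursive calls
  issued from \<open>(\<Delta>, d)\<close> is finite. A recursive call is made only if \<open>d' > 0\<close>.
\<close>

function (domintros) IntegralBasisElement ::
    "'a::field puiseux set \<Rightarrow> nat \<Rightarrow> 'a puiseux poly" where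
  "IntegralBasisElement \<Delta> d =
     (let t = max_extended_char_exponent \<Delta>;
          R = trunc_less t ` \<Delta>;
          m' = card R;
          u = d div m';
          d' = d - u * m';
          q = (if d' > 0 then IntegralBasisElement R d' else 1);
          p = (if u > 0 then \<Prod>\<rho>\<in>R. [:- \<rho>, 1:] else 1)
      in p ^ u * q)"
  by pat_completeness auto

end

theory Submission
  imports "HOL-Algebra.Algebraic_Closure_Type" Defs
begin

text \<open>
  Let \<open>\<Gamma>\<close> be the set of Puiseux expansions of \<open>g\<close>, viewed as a finite ultrametric space whose tree of
  balls is the tree of truncations. The theorem rests on two facts. Since \<open>g\<close> is irreducible, this tree is
  homogeneous: all expansions look alike. And the values of a monic polynomial of degree \<open>d\<close> on \<open>\<Gamma>\<close> are
  bounded in terms of the mutual distances of any \<open>d + 1\<close> points of \<open>\<Gamma>\<close>.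

  For homogeneity, \<open>puiseux_splitting\<close>, which follows from \<open>hensel_lifting\<close>, splits \<open>g(X\<^sup>k, Y)\<close> over the
  Laurent series with coefficients in the algebraic closure of \<open>K\<close>. The homomorphisms
  \<open>\<Sum>\<^sub>n a\<^sub>n X\<^sup>n \<mapsto> \<Sum>\<^sub>n \<sigma>(a\<^sub>n) \<zeta>\<^sup>n X\<^bsup>n/k\<^esup>\<close>, where \<open>\<sigma>\<close> embeds the algebraic closure into \<open>L\<close> over \<open>K\<close> and
  \<open>\<zeta>\<^sup>k = 1\<close>, preserve truncations and orders, and each maps the roots onto \<open>\<Gamma>\<close>. A series on which they all
  agree has integral exponents and coefficients in \<open>K\<close> (\<open>conj_fixed\<close>). Therefore a set of roots that is
  described in terms of truncations and orders gives a factor of \<open>g\<close> over \<open>K[[X]]\<close>, and it is empty or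
  contains all roots (\<open>conj_invariant_submultiset\<close>). It follows that the roots are simple, that all
  expansions have the same support, that the nodes of one level of the tree have equally many
  descendants, and that the polynomial \<open>\<Prod>(Y - \<rho>)\<close> over the nodes \<open>\<rho>\<close> of a level has the same order at all
  expansions. The same descent shows that this polynomial lies in \<open>K[X][Y]\<close>. The result of the algorithm
  is a product of such polynomials.

  For the bound, let \<open>q\<close> be monic of degree \<open>d\<close> and let \<open>S \<subseteq> \<Gamma>\<close> have \<open>d + 1\<close> elements. The divided difference
  \<open>\<Sum>\<^bsub>x\<in>S\<^esub> q(x) / \<Prod>\<^bsub>y\<in>S-{x}\<^esub> (x - y)\<close> equals \<open>1\<close>, so some \<open>x \<in> S\<close> satisfies \<open>\<upsilon>(q(x)) \<le> \<Sum>\<^bsub>y\<in>S-{x}\<^esub> \<upsilon>(x - y)\<close>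
  (\<open>monic_value_bound\<close>). To prove optimality it suffices to find a set \<open>S\<close> for which all these sums are at
  most the common order of the values of \<open>p\<^sub>d\<close>. Such a set has to be spread evenly over the tree, and it is
  constructed by the same recursion as \<open>p\<^sub>d\<close> (\<open>spread_extension\<close>, \<open>algorithm_optimal\<close>): a factor \<open>p\<^sup>u\<close>
  corresponds to taking \<open>u\<close> points from every node, and the remaining factor to the set found for the
  remainder of the division.
\<close>

section \<open>Ring homomorphisms and polynomials\<close>

locale comm_ring_map =
  fixes h :: "'a::comm_ring_1 \<Rightarrow> 'b::comm_ring_1"
  assumes one: "h 1 = 1"
    and add: "h (x + y) = h x + h y"
    and mult: "h (x * y) = h x * h y"
begin

lemma zero: "h 0 = 0"
  using add[of 0 0] by simp

lemma uminus: "h (- x) = - h x"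
  using add[of x "- x"] by (simp add: zero eq_neg_iff_add_eq_0 add.commute)

lemma diff: "h (x - y) = h x - h y"
  using add[of x "- y"] by (simp add: uminus)

lemma sum: "h (\<Sum>x\<in>A. f x) = (\<Sum>x\<in>A. h (f x))"
  by (induction A rule: infinite_finite_induct) (simp_all add: zero add)

lemma of_nat: "h (of_nat n) = of_nat n"
  by (induction n) (simp_all add: zero one add)

lemma coeff_map: "coeff (map_poly h p) i = h (coeff p i)"
  by (rule coeff_map_poly) (rule zero)

lemma map_poly_add: "map_poly h (p + q) = map_poly h p + map_poly h q"
  by (rule poly_eqI) (simp add: coeff_map add)

lemma map_poly_mult: "map_poly h (p * q) = map_poly h p * map_poly h q"
  by (rule poly_eqI) (simp add: coeff_map coeff_mult sum mult)

lemma map_poly_prod: "map_poly h (\<Prod>x\<in>A. f x) = (\<Prod>x\<in>A. map_poly h (f x))"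
  by (induction A rule: infinite_finite_induct) (simp_all add: map_poly_mult one)

lemma map_poly_prod_mset: "map_poly h (\<Prod>x\<in>#A. f x) = (\<Prod>x\<in>#A. map_poly h (f x))"
  by (induction A) (simp_all add: map_poly_mult one)

lemma map_poly_linear: "map_poly h [:- x, 1:] = [:- h x, 1:]"
  by (simp add: map_poly_pCons zero one uminus)

lemma poly_map: "poly (map_poly h p) (h x) = h (poly p x)"
  by (induction p) (simp_all add: map_poly_pCons zero add mult)

lemma map_poly_pcompose: "map_poly h (pcompose p q) = pcompose (map_poly h p) (map_poly h q)"
  by (induction p) (simp_all add: map_poly_pCons zero pcompose_pCons map_poly_add map_poly_mult)

lemma map_poly_monic:
  assumes "lead_coeff p = 1"
  shows "degree (map_poly h p) = degree p" "lead_coeff (map_poly h p) = 1"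
proof -
  have "coeff (map_poly h p) (degree p) = 1"
    using assms by (simp add: coeff_map one)
  moreover have "degree (map_poly h p) \<le> degree p"
    by (rule degree_le) (simp add: coeff_map coeff_eq_0 zero)
  ultimately show "degree (map_poly h p) = degree p"
    by (metis le_antisym le_degree zero_neq_one)
  with \<open>coeff (map_poly h p) (degree p) = 1\<close> show "lead_coeff (map_poly h p) = 1"
    by simp
qed

end

lemma comm_ring_map_comp:
  "comm_ring_map f \<Longrightarrow> comm_ring_map g \<Longrightarrow> comm_ring_map (\<lambda>x. g (f x))"
  by (simp add: comm_ring_map_def)

lemma comm_ring_map_inj:
  fixes h :: "'a::field \<Rightarrow> 'b::comm_ring_1"
  assumes "comm_ring_map h"
  shows "inj h"
proof (rule injI, rule ccontr)
  interpret comm_ring_map h by fact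
  fix x y assume *: "h x = h y" "x \<noteq> y"
  then have "h ((x - y) * inverse (x - y)) = 0"
    unfolding mult diff by simp
  with * show False by (simp add: one)
qed

lemma fls_compose_power_hom:
  assumes "k > 0"
  shows "comm_ring_map (\<lambda>F :: 'a::idom fls. fls_compose_power F k)"
  using assms by unfold_locales auto

lemma fps_to_fls_hom: "comm_ring_map (fps_to_fls :: 'a::comm_ring_1 fps \<Rightarrow> _)"
  by unfold_locales (auto simp: fls_times_fps_to_fls)

lemma fls_compose_power_compose:
  assumes "k > 0" "l > 0"
  shows "fls_compose_power (fls_compose_power F k) l = fls_compose_power F (k * l)"
proof (rule fls_eqI)
  fix n
  show "fls_compose_power (fls_compose_power F k) l $$ n = fls_compose_power F (k * l) $$ n"
    using assms by (auto simp: fls_nth_compose_power zdiv_zmult2_eq mult.commute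
        elim!: dvdE dest: dvd_mult_left)
qed

lemma poly_eq_sum_le:
  fixes p :: "'a::comm_ring_1 poly"
  shows "degree p \<le> n \<Longrightarrow> poly p x = (\<Sum>i\<le>n. coeff p i * x ^ i)"
  unfolding poly_altdef by (rule sum.mono_neutral_left) (auto simp: coeff_eq_0)

section \<open>Hensel's lemma\<close>

text \<open>
  Over an algebraically closed field every factorization into coprime factors can be arranged to
  have a power of a linear polynomial as one factor. For this case the Bezout identity follows
  from the case of exponent one by multiplying such identities, without the Euclidean algorithm.
\<close>

lemma linear_power_bezout:
  fixes q :: "'a::field poly"
  assumes "poly q c \<noteq> 0"
  shows "\<exists>u v. u * [:- c, 1:] ^ e + v * q = 1"
proof (induction e)
  case 0
  show ?case by (rule exI[of _ 1], rule exI[of _ 0]) simp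
next
  case (Suc e)
  then obtain u v where uv: "u * [:- c, 1:] ^ e + v * q = 1" by blast
  have "poly (q - [:poly q c:]) c = 0" by simp
  then obtain k where k: "q - [:poly q c:] = [:- c, 1:] * k"
    unfolding poly_eq_0_iff_dvd by (elim dvdE)
  define b where "b = [:inverse (poly q c):]"
  have "b * [:poly q c:] = 1" using assms by (simp add: b_def one_pCons)
  then have 1: "b * q - b * [:- c, 1:] * k = 1"
    using arg_cong[OF k, of "(*) b"] by (simp add: algebra_simps)
  have ring: "(u * P + v * q) * (b * q - b * l * k)
      = (- (u * b * k)) * (l * P) + (u * P * b + v * (b * q - b * l * k)) * q" for P l
    by (simp add: algebra_simps)
  have "1 = (u * [:- c, 1:] ^ e + v * q) * (b * q - b * [:- c, 1:] * k)"
    unfolding uv 1 by simp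
  then show ?case unfolding ring power_Suc by metis
qed

text \<open>
  Bezout solutions may be reduced modulo \<open>g\<close>, and the bound on \<open>r\<close> then forces the bound on the
  cofactor. The bounds are stated through vanishing coefficients, since the degree does not
  distinguish the zero polynomial from the other constants.
\<close>

lemma bezout_low_degree:
  fixes g h r u v :: "'a::field poly"
  assumes "u * g + v * h = 1" and "g \<noteq> 0" and "h \<noteq> 0"
    and r: "\<And>k. k \<ge> degree g + degree h \<Longrightarrow> coeff r k = 0"
  shows "\<exists>a b. a * h + g * b = r \<and> (\<forall>k\<ge>degree g. coeff a k = 0) \<and> (\<forall>k\<ge>degree h. coeff b k = 0)"
proof -
  define a where "a = (v * r) mod g"
  define b where "b = u * r + (v * r) div g * h"
  have "a = v * r - g * ((v * r) div g)"
    by (simp only: a_def minus_mult_div_eq_mod)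
  then have "a * h + g * b = (v * r - g * ((v * r) div g)) * h + g * (u * r + (v * r) div g * h)"
    by (simp only: b_def)
  also have "\<dots> = (u * g + v * h) * r"
    by (simp add: algebra_simps)
  finally have eq: "a * h + g * b = r" using assms by simp
  have a: "coeff a k = 0" if "k \<ge> degree g" for k
    using degree_mod_less[OF \<open>g \<noteq> 0\<close>, of "v * r"] that
    by (auto simp: a_def intro: coeff_eq_0)
  have b: "coeff b k = 0" if "k \<ge> degree h" for k
  proof (cases "b = 0")
    case False
    have "degree b < degree h"
    proof (rule ccontr)
      assume ge: "\<not> degree b < degree h"
      have "coeff (a * h) (degree g + degree b) = 0"
      proof (cases "a = 0")
        case False
        then have "degree a < degree g"
          using a[of "degree a"] leading_coeff_0_iff not_le by blast
        then have "degree (a * h) < degree g + degree b"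
          using ge degree_mult_le[of a h] by linarith
        then show ?thesis by (rule coeff_eq_0)
      qed simp
      moreover have "coeff r (degree g + degree b) = 0"
        using ge by (intro r) simp
      ultimately have "coeff (g * b) (degree g + degree b) = 0"
        using arg_cong[OF eq, of "\<lambda>p. coeff p (degree g + degree b)"] by simp
      then show False
        using \<open>b \<noteq> 0\<close> \<open>g \<noteq> 0\<close> by (simp add: coeff_mult_degree_sum)
    qed
    with that show ?thesis by (intro coeff_eq_0) simp
  qed simp
  from eq a b show ?thesis by blast
qed

lemma coeff_sum_monom:
  "coeff (\<Sum>k\<le>n. monom (c k) k) i = (if i \<le> n then c i else 0)"
  by (simp add: coeff_sum)

text \<open>
  Write \<open>f = \<Sum>\<^sub>i f\<^sub>i X\<^sup>i\<close> with polynomials \<open>f\<^sub>i\<close> in \<open>Y\<close>. The equation \<open>f = G H\<close> means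
  \<open>g\<^sub>i h\<^sub>0 + g\<^sub>0 h\<^sub>i = f\<^sub>i - \<Sum>\<^sub>0\<^sub><\<^sub>j\<^sub><\<^sub>i g\<^sub>j h\<^sub>i\<^sub>-\<^sub>j\<close> for all \<open>i > 0\<close>, and Bezout solves these equations one after the other.
  As \<open>f\<close> is monic, the right-hand sides have degree below \<open>deg g\<^sub>0 + deg h\<^sub>0\<close>, so the solutions can be
  kept of low degree and the lifted factor stays monic of degree \<open>deg g\<^sub>0\<close>.
\<close>

theorem hensel_lifting:
  fixes f :: "'a::field fps poly"
  assumes f: "lead_coeff f = 1"
    and f0: "map_poly (\<lambda>c. fps_nth c 0) f = g0 * h0"
    and g0: "lead_coeff g0 = 1" and h0: "lead_coeff h0 = 1"
    and bez: "u * g0 + v * h0 = 1"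
  shows "\<exists>G H. f = G * H \<and> lead_coeff G = 1 \<and> degree G = degree g0"
proof -
  define F where "F i = map_poly (\<lambda>c. fps_nth c i) f" for i
  have cF: "coeff (F i) k = fps_nth (coeff f k) i" for i k
    by (simp add: F_def coeff_map_poly)
  have nz: "g0 \<noteq> 0" "h0 \<noteq> 0" using g0 h0 by auto
  have "degree (F 0) = degree f"
  proof (rule antisym)
    show "degree (F 0) \<le> degree f" by (rule degree_le) (simp add: cF coeff_eq_0)
    show "degree f \<le> degree (F 0)" by (rule le_degree) (simp add: cF f)
  qed
  then have deg_f: "degree f = degree g0 + degree h0"
    using nz by (simp add: F_def f0 degree_mult_eq)
  define P where "P S i r \<longleftrightarrow> (if i = 0 then r = (g0, h0) else
      fst r * h0 + g0 * snd r = F i - (\<Sum>j\<in>{0<..<i}. fst (S j) * snd (S (i - j))) \<and>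
      (\<forall>k\<ge>degree g0. coeff (fst r) k = 0) \<and> (\<forall>k\<ge>degree h0. coeff (snd r) k = 0))"
    for S :: "nat \<Rightarrow> 'a poly \<times> 'a poly" and i r
  \<comment> \<open>The equation for index \<open>i\<close> refers to all smaller indices, hence well-founded choice.\<close>
  have "\<exists>S. \<forall>i. P S i (S i)"
  proof (rule dependent_wf_choice[of less_than])
    fix S S' :: "nat \<Rightarrow> 'a poly \<times> 'a poly" and i r
    assume "\<And>z. (z, i) \<in> less_than \<Longrightarrow> S z = S' z"
    then have "(\<Sum>j\<in>{0<..<i}. fst (S j) * snd (S (i - j))) = (\<Sum>j\<in>{0<..<i}. fst (S' j) * snd (S' (i - j)))"
      by (intro sum.cong) auto
    then show "P S i r = P S' i r" by (simp add: P_def)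
  next
    fix i and S :: "nat \<Rightarrow> 'a poly \<times> 'a poly"
    assume IH: "\<And>j. (j, i) \<in> less_than \<Longrightarrow> P S j (S j)"
    show "\<exists>r. P S i r"
    proof (cases "i = 0")
      case False
      have "\<exists>a b. a * h0 + g0 * b = F i - (\<Sum>j\<in>{0<..<i}. fst (S j) * snd (S (i - j))) \<and>
          (\<forall>k\<ge>degree g0. coeff a k = 0) \<and> (\<forall>k\<ge>degree h0. coeff b k = 0)"
      proof (rule bezout_low_degree[OF bez nz])
        fix k assume k: "k \<ge> degree g0 + degree h0"
        have "coeff (F i) k = 0"
          using k f False deg_f
          by (cases "k = degree f") (auto simp: cF coeff_eq_0)
        moreover have "coeff (fst (S j) * snd (S (i - j))) k = 0" if j: "j \<in> {0<..<i}" for j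
        proof -
          have 1: "\<forall>k\<ge>degree g0. coeff (fst (S j)) k = 0" "\<forall>k\<ge>degree h0. coeff (snd (S (i - j))) k = 0"
            using IH[of j] IH[of "i - j"] j by (auto simp: P_def)
          have "coeff (fst (S j)) l * coeff (snd (S (i - j))) (k - l) = 0" if "l \<le> k" for l
            using 1 k that by (cases "l \<ge> degree g0") auto
          then show ?thesis unfolding coeff_mult by (intro sum.neutral) simp
        qed
        ultimately show "coeff (F i - (\<Sum>j\<in>{0<..<i}. fst (S j) * snd (S (i - j)))) k = 0"
          by (simp add: coeff_sum)
      qed
      then show ?thesis using False by (auto simp: P_def)
    qed (simp add: P_def)
  qed simp
  then obtain S where S: "P S i (S i)" for i by blast
  have S0: "S 0 = (g0, h0)" using S[of 0] by (simp add: P_def)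
  have low: "coeff (fst (S i)) k = 0" if "i > 0" "k \<ge> degree g0" for i k
    using S[of i] that by (simp add: P_def)
  have low': "coeff (snd (S i)) k = 0" if "i > 0" "k \<ge> degree h0" for i k
    using S[of i] that by (simp add: P_def)
  have conv: "(\<Sum>j=0..i. fst (S j) * snd (S (i - j))) = F i" for i
  proof (cases "i = 0")
    case True
    then show ?thesis by (simp add: S0 F_def f0)
  next
    case False
    then have "{0..i} = insert 0 (insert i {0<..<i})" by auto
    then have "(\<Sum>j=0..i. fst (S j) * snd (S (i - j))) =
        g0 * snd (S i) + (fst (S i) * h0 + (\<Sum>j\<in>{0<..<i}. fst (S j) * snd (S (i - j))))"
      using False by (simp add: S0)
    also have "\<dots> = F i" using S[of i] False by (simp add: P_def algebra_simps)
    finally show ?thesis .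
  qed
  define G where "G = (\<Sum>k\<le>degree g0. monom (Abs_fps (\<lambda>i. coeff (fst (S i)) k)) k)"
  define H where "H = (\<Sum>k\<le>degree h0. monom (Abs_fps (\<lambda>i. coeff (snd (S i)) k)) k)"
  have cG: "fps_nth (coeff G k) i = coeff (fst (S i)) k" for k i
    using low[of i k] by (cases "i = 0") (auto simp: G_def coeff_sum_monom S0 coeff_eq_0)
  have cH: "fps_nth (coeff H k) i = coeff (snd (S i)) k" for k i
    using low'[of i k] by (cases "i = 0") (auto simp: H_def coeff_sum_monom S0 coeff_eq_0)
  have "f = G * H"
  proof (rule poly_eqI, rule fps_ext)
    fix k i
    have "fps_nth (coeff (G * H) k) i =
        (\<Sum>a\<le>k. \<Sum>j=0..i. coeff (fst (S j)) a * coeff (snd (S (i - j))) (k - a))"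
      by (simp add: coeff_mult fps_sum_nth fps_mult_nth cG cH)
    also have "\<dots> = coeff (\<Sum>j=0..i. fst (S j) * snd (S (i - j))) k"
      unfolding coeff_sum coeff_mult by (rule sum.swap)
    also have "\<dots> = fps_nth (coeff f k) i"
      by (simp only: conv cF)
    finally show "fps_nth (coeff f k) i = fps_nth (coeff (G * H) k) i" by simp
  qed
  have lG: "coeff G (degree g0) = 1"
    by (rule fps_ext) (use low g0 in \<open>auto simp: cG S0\<close>)
  moreover have "degree G \<le> degree g0"
    by (rule degree_le) (auto simp: G_def coeff_sum_monom)
  ultimately have "degree G = degree g0"
    by (metis le_antisym le_degree zero_neq_one)
  with lG \<open>f = G * H\<close> show ?thesis by metis
qed

section \<open>Puiseux's theorem\<close>

lemma choose_pred: "n > 0 \<Longrightarrow> n choose (n - Suc 0) = n"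
  by (subst binomial_symmetric) auto

text \<open>
  The shift that removes the subleading coefficient. Once this coefficient vanishes, the polynomial
  is a pure power of a linear polynomial only if it is a power of the variable; this is where
  characteristic zero enters the proof of Puiseux's theorem.
\<close>

lemma coeff_tschirnhaus:
  fixes p :: "'a::field_char_0 poly"
  assumes p: "lead_coeff p = 1" and n: "degree p > 0"
  defines "r \<equiv> [:- (coeff p (degree p - 1) / of_nat (degree p)), 1:]"
  shows "coeff (pcompose p r) (degree p - 1) = 0" "lead_coeff (pcompose p r) = 1"
    "degree (pcompose p r) = degree p"
proof -
  define n where "n = degree p"
  define a where "a = coeff p (n - 1)"
  define s where "s = - (a / of_nat n)"
  have r: "r = [:s, 1:]" by (simp add: r_def s_def a_def n_def)
  show deg: "degree (pcompose p r) = degree p"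
    by (simp add: r degree_pcompose)
  show "lead_coeff (pcompose p r) = 1"
    using p by (subst lead_coeff_comp) (simp_all add: r)
  have "n > 0" using n by (simp add: n_def)
  have "coeff (pcompose p r) (n - 1) = (\<Sum>i\<le>n. coeff p i * coeff (r ^ i) (n - 1))"
    unfolding pcompose_altdef poly_altdef by (simp add: n_def coeff_sum degree_map_poly coeff_map_poly)
  \<comment> \<open>The other powers of \<open>r\<close> have degree below \<open>n - 1\<close>.\<close>
  also have "\<dots> = (\<Sum>i\<in>{n - 1, n}. coeff p i * coeff (r ^ i) (n - 1))"
  proof (rule sum.mono_neutral_right)
    show "\<forall>i\<in>{..n} - {n - 1, n}. coeff p i * coeff (r ^ i) (n - 1) = 0"
    proof
      fix i assume "i \<in> {..n} - {n - 1, n}"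
      then have "degree (r ^ i) < n - 1"
        using degree_linear_power[of s i] by (auto simp: r)
      then show "coeff p i * coeff (r ^ i) (n - 1) = 0" by (simp add: coeff_eq_0)
    qed
  qed auto
  also have "\<dots> = a + coeff (r ^ n) (n - 1)"
    using \<open>n > 0\<close> p by (simp add: r coeff_linear_power a_def n_def)
  also have "coeff (r ^ n) (n - 1) = of_nat n * s"
    using \<open>n > 0\<close> by (simp add: r coeff_linear_poly_power choose_pred)
  also have "a + of_nat n * s = 0" using \<open>n > 0\<close> by (simp add: s_def)
  finally show "coeff (pcompose p r) (degree p - 1) = 0" by (simp add: n_def)
qed

text \<open>
  The reduction modulo \<open>X\<close> is not a power of the variable, by \<open>i0\<close>, and has no subleading
  coefficient, so it is not a power of a linear polynomial at all. Splitting off the full power of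
  one of its linear factors gives a proper coprime factorization to which Hensel's lemma applies.
\<close>

lemma fps_root_coprime_factor:
  fixes q :: "'a::{alg_closed_field, field_char_0} fps poly"
  assumes q: "lead_coeff q = 1" and top: "coeff q (degree q - 1) = 0"
    and i0: "i0 < degree q" "fps_nth (coeff q i0) 0 \<noteq> 0"
  obtains G H where "q = G * H" "lead_coeff G = 1" "0 < degree G" "degree G < degree q"
proof -
  define n where "n = degree q"
  interpret c0: comm_ring_map "\<lambda>c::'a fps. fps_nth c 0"
    by unfold_locales auto
  define q0 where "q0 = map_poly (\<lambda>c. fps_nth c 0) q"
  have deg: "degree q0 = n" and lc: "lead_coeff q0 = 1"
    using c0.map_poly_monic[OF q] by (simp_all add: q0_def n_def)
  have "n > 0" using i0 by (simp add: n_def)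
  then obtain c where c: "poly q0 c = 0"
    using alg_closed_imp_poly_has_root[of q0] deg by auto
  define e where "e = order c q0"
  have "q0 \<noteq> 0" using lc by auto
  then have "e > 0" using c by (simp add: e_def order_gt_0_iff)
  obtain h0 where h0: "q0 = [:- c, 1:] ^ e * h0"
    using order_1[of c q0] unfolding e_def by (elim dvdE)
  have "h0 \<noteq> 0" using h0 \<open>q0 \<noteq> 0\<close> by auto
  have "poly h0 c \<noteq> 0"
  proof
    assume "poly h0 c = 0"
    then have "[:- c, 1:] dvd h0" by (simp add: poly_eq_0_iff_dvd)
    then have "[:- c, 1:] ^ Suc e dvd q0"
      unfolding h0 power_Suc2 by (intro mult_dvd_mono) auto
    then show False using order_2[OF \<open>q0 \<noteq> 0\<close>, of c] by (simp add: e_def)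
  qed
  have lh: "lead_coeff h0 = 1"
    using lc unfolding h0 lead_coeff_mult by (simp add: lead_coeff_power)
  have dn: "n = e + degree h0"
    using deg \<open>h0 \<noteq> 0\<close> by (simp add: h0 degree_mult_eq degree_linear_power)
  have "e \<noteq> n"
  proof
    assume "e = n"
    then have "degree h0 = 0" using dn by simp
    with lh have "h0 = 1" by (auto simp: one_pCons elim!: degree_eq_zeroE)
    then have q0: "q0 = [:- c, 1:] ^ n" using h0 \<open>e = n\<close> by simp
    have "coeff q0 (n - 1) = of_nat n * (- c)"
      using \<open>n > 0\<close> by (simp add: q0 coeff_linear_poly_power choose_pred)
    moreover have "coeff q0 (n - 1) = 0"
      using top by (simp add: q0_def c0.coeff_map n_def)
    ultimately have "c = 0" using \<open>n > 0\<close> by simp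
    then have "q0 = monom 1 n" by (simp add: q0 monom_altdef)
    then have "coeff q0 i0 = 0" using i0 by (simp add: n_def)
    with i0 show False by (simp add: q0_def c0.coeff_map)
  qed
  obtain u v where "u * [:- c, 1:] ^ e + v * h0 = 1"
    using linear_power_bezout[OF \<open>poly h0 c \<noteq> 0\<close>] by blast
  moreover have "lead_coeff ([:- c, 1:] ^ e) = 1" by (simp add: lead_coeff_power)
  ultimately obtain G H where "q = G * H" "lead_coeff G = 1" "degree G = degree ([:- c, 1:] ^ e)"
    using hensel_lifting[OF q h0[unfolded q0_def] _ lh] by blast
  then show ?thesis
    using that[of G H] \<open>e > 0\<close> dn \<open>e \<noteq> n\<close> by (simp add: degree_linear_power n_def)
qed

text \<open>
  The Newton polygon argument: with \<open>c / b\<close> the smallest slope \<open>v(q\<^sub>i) / (n - i)\<close>, the substitution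
  \<open>X \<mapsto> X\<^sup>b\<close>, \<open>Y \<mapsto> X\<^sup>c Y\<close> followed by division by \<open>X\<^sup>n\<^sup>c\<close> produces a polynomial \<open>Q\<close> with power series
  coefficients, and the coefficient that attains the slope becomes a unit.
\<close>

lemma newton_rescaling:
  fixes q :: "'a::field fls poly"
  assumes q: "lead_coeff q = 1" and "\<exists>i<degree q. coeff q i \<noteq> 0"
  obtains b :: nat and c :: int and Q :: "'a fps poly" and i0
  where "b > 0" "lead_coeff Q = 1" "degree Q = degree q"
    "i0 < degree q" "fps_nth (coeff Q i0) 0 \<noteq> 0"
    "\<And>i. coeff q i = 0 \<Longrightarrow> coeff Q i = 0"
    "\<And>i. i \<le> degree q \<Longrightarrow> fls_compose_power (coeff q i) b =
        fps_to_fls (coeff Q i) * fls_X_intpow (int (degree q - i) * c)"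
proof -
  define n where "n = degree q"
  \<comment> \<open>The index \<open>n\<close> itself is left out: its coefficient \<open>1\<close> is unaffected by the rescaling.\<close>
  define I where "I = {i. i < n \<and> coeff q i \<noteq> 0}"
  define slope where "slope i = of_int (fls_subdegree (coeff q i)) / (of_nat (n - i) :: rat)" for i
  have "finite I" "I \<noteq> {}" using assms by (auto simp: I_def n_def)
  then obtain i0 where i0: "i0 \<in> I" and min: "\<forall>i\<in>I. slope i0 \<le> slope i"
    using ex_min_if_finite[of "slope ` I"] by (fastforce simp: not_less)
  define b where "b = n - i0"
  define c where "c = fls_subdegree (coeff q i0)"
  have "b > 0" using i0 by (auto simp: b_def I_def)
  have below: "int (n - i) * c \<le> int b * fls_subdegree (coeff q i)" if "i \<in> I" for i
  proof -
    have "slope i0 \<le> slope i" "n - i > 0" using min that by (auto simp: I_def)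
    then have "of_int c * of_nat (n - i) \<le> (of_int (fls_subdegree (coeff q i)) * of_nat b :: rat)"
      using \<open>b > 0\<close> by (simp add: slope_def c_def b_def divide_le_eq le_divide_eq mult.commute split: if_splits)
    then have "(of_int (c * int (n - i)) :: rat) \<le> of_int (fls_subdegree (coeff q i) * int b)" by simp
    then show ?thesis unfolding of_int_le_iff by (simp add: mult.commute)
  qed
  define A where "A i = fls_shift (int (n - i) * c) (fls_compose_power (coeff q i) b)" for i
  have A_nth: "A i $$ j = 0" if "i \<le> n" "j < 0" for i j
  proof (cases "i = n")
    case True
    then show ?thesis using q that \<open>b > 0\<close> by (simp add: A_def n_def)
  next
    case False
    show ?thesis
    proof (cases "coeff q i = 0")
      case nz: False
      then have i: "i \<in> I" using False that by (auto simp: I_def)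
      have "coeff q i $$ ((j + int (n - i) * c) div int b) = 0"
      proof (rule fls_eq0_below_subdegree)
        let ?x = "j + int (n - i) * c"
        have "int b * (?x div int b) \<le> ?x" using \<open>b > 0\<close> by (metis minus_mod_eq_mult_div diff_le_eq le_add_same_cancel1 of_nat_0_less_iff pos_mod_sign)
        also have "?x < int b * fls_subdegree (coeff q i)"
          using below[OF i] that by linarith
        finally show "?x div int b < fls_subdegree (coeff q i)"
          using \<open>b > 0\<close> by (simp add: mult_less_cancel_left_pos)
      qed
      then show ?thesis using \<open>b > 0\<close> by (simp add: A_def fls_nth_compose_power)
    qed (simp add: A_def)
  qed
  have reg: "fps_to_fls (fls_regpart (A i)) = A i" if "i \<le> n" for i
    by (rule fls_eqI) (use A_nth[OF that] in auto)
  define Q where "Q = (\<Sum>i\<le>n. monom (fls_regpart (A i)) i)"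
  have cQ: "coeff Q i = (if i \<le> n then fls_regpart (A i) else 0)" for i
    by (simp add: Q_def coeff_sum_monom)
  have An: "A n = 1" using q \<open>b > 0\<close> by (simp add: A_def n_def)
  have "degree Q \<le> n" by (rule degree_le) (simp add: cQ)
  moreover have Qn: "coeff Q n = 1" by (simp add: cQ An)
  ultimately have dQ: "degree Q = n" by (metis le_antisym le_degree zero_neq_one)
  show ?thesis
  proof (rule that)
    show "b > 0" by fact
    show "lead_coeff Q = 1" "degree Q = degree q" using Qn dQ by (simp_all add: n_def)
    show "i0 < degree q" using i0 by (simp add: I_def n_def)
    have "fps_nth (coeff Q i0) 0 = A i0 $$ 0" using i0 by (simp add: cQ I_def)
    also have "\<dots> = coeff q i0 $$ c"
      using \<open>b > 0\<close> by (simp add: A_def fls_nth_compose_power b_def)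
    also have "\<dots> \<noteq> 0" using i0 by (simp add: c_def I_def)
    finally show "fps_nth (coeff Q i0) 0 \<noteq> 0" .
    show "coeff Q i = 0" if "coeff q i = 0" for i
      using that by (simp add: cQ A_def)
    show "fls_compose_power (coeff q i) b =
        fps_to_fls (coeff Q i) * fls_X_intpow (int (degree q - i) * c)" if "i \<le> degree q" for i
    proof -
      have "i \<le> n" using that by (simp add: n_def)
      then have "fps_to_fls (coeff Q i) = A i" by (simp add: cQ reg)
      then show ?thesis
        by (simp add: A_def n_def fls_shifted_times_simps fls_X_intpow_times_conv_shift)
    qed
  qed
qed

text \<open>
  Induction on the degree. After the shift and the rescaling, either zero is a root or Hensel's
  lemma gives a factor of smaller degree. Each step may enlarge the ramification, so the root is a
  series in \<open>X\<^bsup>1/k\<^esup>\<close> for some \<open>k\<close>; in terms of Laurent series it is a root after \<open>X \<mapsto> X\<^sup>k\<close>.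
\<close>

lemma puiseux_root_monic:
  fixes p :: "'a::{alg_closed_field, field_char_0} fls poly"
  assumes "degree p > 0" "lead_coeff p = 1"
  shows "\<exists>k>0. \<exists>f. poly (map_poly (\<lambda>c. fls_compose_power c k) p) f = 0"
  using assms
proof (induction "degree p" arbitrary: p rule: less_induct)
  case less
  define n where "n = degree p"
  define r where "r = [:- (coeff p (n - 1) / of_nat n), 1:]"
  define q where "q = pcompose p r"
  have q: "coeff q (n - 1) = 0" "lead_coeff q = 1" "degree q = n"
    using coeff_tschirnhaus[OF less.prems(2,1)] by (simp_all add: q_def r_def n_def)
  have "\<exists>k>0. \<exists>f. poly (map_poly (\<lambda>c. fls_compose_power c k) q) f = 0"
  proof (cases "\<exists>i<degree q. coeff q i \<noteq> 0")
    case False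
    then have "coeff q 0 = 0" using less.prems(1) q(3) by (simp add: n_def)
    then have "poly (map_poly (\<lambda>c. fls_compose_power c 1) q) 0 = 0"
      by (simp add: poly_0_coeff_0 coeff_map_poly)
    then show ?thesis by (intro exI[of _ 1]) auto
  next
    case True
    then obtain b c Q i0 where bQ: "b > 0" "lead_coeff Q = 1" "degree Q = degree q"
      "i0 < degree q" "fps_nth (coeff Q i0) 0 \<noteq> 0"
      "\<And>i. coeff q i = 0 \<Longrightarrow> coeff Q i = 0"
      and coeff: "\<And>i. i \<le> degree q \<Longrightarrow> fls_compose_power (coeff q i) b =
        fps_to_fls (coeff Q i) * fls_X_intpow (int (degree q - i) * c)"
      using newton_rescaling[OF q(2)] by metis
    have "coeff Q (degree Q - 1) = 0" using q bQ by metis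
    then obtain G H where GH: "Q = G * H" "lead_coeff G = 1" "0 < degree G" "degree G < degree Q"
      using fps_root_coprime_factor[OF bQ(2)] bQ(3-5) by metis
    interpret emb: comm_ring_map "fps_to_fls :: 'a fps \<Rightarrow> 'a fls" by (rule fps_to_fls_hom)
    let ?G = "map_poly fps_to_fls G"
    have "degree ?G = degree G" "lead_coeff ?G = 1"
      using emb.map_poly_monic[OF GH(2)] by simp_all
    then obtain k f where k: "k > 0" and f: "poly (map_poly (\<lambda>c. fls_compose_power c k) ?G) f = 0"
      using less.hyps[of ?G] GH(3,4) bQ(3) q(3) by (auto simp: n_def)
    interpret ck: comm_ring_map "\<lambda>c::'a fls. fls_compose_power c k"
      by (rule fls_compose_power_hom) fact
    have "poly (map_poly (\<lambda>c. fls_compose_power c k) (map_poly fps_to_fls Q)) f = 0"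
      using f by (simp add: GH(1) emb.map_poly_mult ck.map_poly_mult)
    moreover have "degree (map_poly (\<lambda>c. fls_compose_power c k) (map_poly fps_to_fls Q)) = n"
      using emb.map_poly_monic[OF bQ(2)] ck.map_poly_monic[of "map_poly fps_to_fls Q"] bQ(3) q(3) by simp
    ultimately have Qf: "(\<Sum>i\<le>n. fls_compose_power (fps_to_fls (coeff Q i)) k * f ^ i) = 0"
      by (simp add: poly_altdef ck.coeff_map emb.coeff_map)
    have ring: "(x * s) * (t * y) = e * (x * y)" if "s * t = e" for x s t y e :: "'a fls"
      using that by (auto simp: mult_ac)
    \<comment> \<open>A root \<open>f\<close> of the rescaled polynomial gives the root \<open>X\<^sup>c f\<close> of the original one; the factor \<open>k\<close> is due to the additional ramification.\<close>
    define w where "w = fls_X_intpow (int k * c) * f"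
    have "poly (map_poly (\<lambda>c. fls_compose_power c (b * k)) q) w
        = (\<Sum>i\<le>n. fls_compose_power (coeff q i) (b * k) * w ^ i)"
    proof -
      have "degree (map_poly (\<lambda>c. fls_compose_power c (b * k)) q) \<le> n"
        by (rule degree_le) (simp add: coeff_map_poly q(3) coeff_eq_0)
      then show ?thesis by (simp add: poly_eq_sum_le coeff_map_poly)
    qed
    also have "\<dots> = (\<Sum>i\<le>n. fls_X_intpow (int k * (int n * c)) *
        (fls_compose_power (fps_to_fls (coeff Q i)) k * f ^ i))"
    proof (rule sum.cong[OF refl])
      fix i assume i: "i \<in> {..n}"
      have "fls_compose_power (coeff q i) (b * k) =
          fls_compose_power (fls_compose_power (coeff q i) b) k"
        using \<open>b > 0\<close> k by (simp add: fls_compose_power_compose)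
      also have "\<dots> = fls_compose_power (fps_to_fls (coeff Q i)) k *
          fls_X_intpow (int k * (int (n - i) * c))"
        using i q(3) k by (simp add: coeff ck.mult del: fls_compose_power_shift)
      finally have 1: "fls_compose_power (coeff q i) (b * k) = \<dots>" .
      have "fls_X_intpow (int k * (int (n - i) * c)) * fls_X_intpow (int k * c) ^ i
          = (fls_X_intpow (int k * (int n * c)) :: 'a fls)"
      proof -
        have "fls_X_intpow (int k * c) ^ i = (fls_X_intpow (int i * (int k * c)) :: 'a fls)"
          by (simp only: fls_X_intpow_power)
        moreover have "int k * (int (n - i) * c) + int i * (int k * c) = int k * (int n * c)"
          using i by (simp add: of_nat_diff algebra_simps)
        ultimately show ?thesis by (simp only: fls_X_intpow_times_fls_X_intpow)
      qed
      then show "fls_compose_power (coeff q i) (b * k) * w ^ i = fls_X_intpow (int k * (int n * c)) *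
        (fls_compose_power (fps_to_fls (coeff Q i)) k * f ^ i)"
        unfolding 1 w_def power_mult_distrib by (rule ring)
    qed
    also have "\<dots> = 0" by (simp only: Qf mult_zero_right flip: sum_distrib_left)
    finally show ?thesis using \<open>b > 0\<close> k by (intro exI[of _ "b * k"]) auto
  qed
  then obtain k f where k: "k > 0" and f: "poly (map_poly (\<lambda>c. fls_compose_power c k) q) f = 0"
    by blast
  interpret ck: comm_ring_map "\<lambda>c::'a fls. fls_compose_power c k"
    by (rule fls_compose_power_hom) fact
  have "poly (map_poly (\<lambda>c. fls_compose_power c k) p) (poly (map_poly (\<lambda>c. fls_compose_power c k) r) f) = 0"
    using f by (simp add: q_def ck.map_poly_pcompose poly_pcompose)
  with k show ?case by blast
qed

theorem puiseux_splitting: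
  fixes p :: "'a::{alg_closed_field, field_char_0} fls poly"
  assumes "lead_coeff p = 1"
  shows "\<exists>k>0. \<exists>A. map_poly (\<lambda>c. fls_compose_power c k) p = (\<Prod>f\<in>#A. [:- f, 1:])"
  using assms
proof (induction "degree p" arbitrary: p)
  case 0
  then have "p = 1" by (auto simp: one_pCons elim!: degree_eq_zeroE)
  then show ?case by (intro exI[of _ 1] conjI exI[of _ "{#}"]) auto
next
  case (Suc n)
  then obtain k f where k: "k > 0" and f: "poly (map_poly (\<lambda>c. fls_compose_power c k) p) f = 0"
    using puiseux_root_monic[of p] by auto
  interpret ck: comm_ring_map "\<lambda>c::'a fls. fls_compose_power c k"
    by (rule fls_compose_power_hom) fact
  let ?p = "map_poly (\<lambda>c. fls_compose_power c k) p"
  obtain q where q: "?p = [:- f, 1:] * q"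
    using f unfolding poly_eq_0_iff_dvd by (elim dvdE)
  have p: "degree ?p = Suc n" "lead_coeff ?p = 1"
    using ck.map_poly_monic[OF Suc.prems] Suc.hyps(2) by simp_all
  have "q \<noteq> 0" using p q by auto
  have lq: "lead_coeff q = 1"
    using p(2) unfolding q lead_coeff_mult by simp
  have "degree ([:- f, 1:] * q) = degree [:- f, 1:] + degree q"
    using \<open>q \<noteq> 0\<close> by (intro degree_mult_eq) auto
  then have "n = degree q" using p(1) unfolding q by simp
  then obtain l A where l: "l > 0" and A: "map_poly (\<lambda>c. fls_compose_power c l) q = (\<Prod>f\<in>#A. [:- f, 1:])"
    using Suc.hyps(1)[OF _ lq] by blast
  interpret cl: comm_ring_map "\<lambda>c::'a fls. fls_compose_power c l"
    by (rule fls_compose_power_hom) fact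
  have "map_poly (\<lambda>c. fls_compose_power c (k * l)) p = map_poly (\<lambda>c. fls_compose_power c l) ?p"
    using k l by (intro poly_eqI) (simp add: coeff_map_poly fls_compose_power_compose)
  also have "\<dots> = (\<Prod>f\<in>#add_mset (fls_compose_power f l) A. [:- f, 1:])"
    by (simp only: q cl.map_poly_mult A cl.map_poly_linear image_mset_add_mset prod_mset.add_mset)
  finally show ?case using k l
    by (intro exI[of _ "k * l"] conjI exI[of _ "add_mset (fls_compose_power f l) A"]) simp_all
qed

section \<open>Extending embeddings to an algebraic closure\<close>

text \<open>
  A homomorphism from a subring of the first field to the second field, represented by its graph.
  Graphs are ordered by inclusion and closed under unions of chains, as Zorn's lemma requires, and
  no types for subrings are needed. For a graph closed under differences, single-valuedness is
  the condition at zero.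
\<close>

definition hom_graph :: "('a::field \<times> 'b::field) set \<Rightarrow> bool" where
  "hom_graph H \<longleftrightarrow> (1, 1) \<in> H \<and> (\<forall>y. (0, y) \<in> H \<longrightarrow> y = 0) \<and>
     (\<forall>x y x' y'. (x, y) \<in> H \<longrightarrow> (x', y') \<in> H \<longrightarrow> (x - x', y - y') \<in> H \<and> (x * x', y * y') \<in> H)"

text \<open>
  Polynomials with coefficients in the domain of the homomorphism, each paired with its image.
\<close>

definition graph_polys :: "('a::field \<times> 'b::field) set \<Rightarrow> ('a poly \<times> 'b poly) set" where
  "graph_polys H = {(p, q). \<forall>i. (coeff p i, coeff q i) \<in> H}"

text \<open>
  The minimal polynomial of \<open>a\<close> over the domain of the homomorphism, together with its image.
\<close>

definition minimal_pair ::
    "('a::field \<times> 'b::field) set \<Rightarrow> 'a \<Rightarrow> 'a poly \<Rightarrow> 'b poly \<Rightarrow> bool" where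
  "minimal_pair H a \<mu> \<nu> \<longleftrightarrow> (\<mu>, \<nu>) \<in> graph_polys H \<and> lead_coeff \<mu> = 1 \<and> poly \<mu> a = 0 \<and>
     (\<forall>p q. (p, q) \<in> graph_polys H \<longrightarrow> p \<noteq> 0 \<longrightarrow> poly p a = 0 \<longrightarrow> degree \<mu> \<le> degree p)"

lemma monic_root_degree:
  fixes p :: "'a::comm_ring_1 poly"
  assumes "lead_coeff p = 1" "poly p a = 0"
  shows "degree p > 0"
proof (rule ccontr)
  assume "\<not> ?thesis"
  then obtain c where "p = [:c:]" by (auto elim: degree_eq_zeroE)
  with assms show False by simp
qed

context
  fixes H :: "('a::field \<times> 'b::field) set"
  assumes H: "hom_graph H"
begin

lemma graph_one: "(1, 1) \<in> H"
  and graph_zero_unique: "(0, y) \<in> H \<Longrightarrow> y = 0"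
  and graph_diff: "(x, y) \<in> H \<Longrightarrow> (x', y') \<in> H \<Longrightarrow> (x - x', y - y') \<in> H"
  and graph_mult: "(x, y) \<in> H \<Longrightarrow> (x', y') \<in> H \<Longrightarrow> (x * x', y * y') \<in> H"
  using H by (simp_all add: hom_graph_def)

lemma graph_zero: "(0, 0) \<in> H"
  using graph_diff[OF graph_one graph_one] by simp

lemma graph_add: "(x, y) \<in> H \<Longrightarrow> (x', y') \<in> H \<Longrightarrow> (x + x', y + y') \<in> H"
  using graph_diff[of x y "0 - x'" "0 - y'"] graph_diff[OF graph_zero, of x' y'] by simp

lemma graph_unique: "(x, y) \<in> H \<Longrightarrow> (x, y') \<in> H \<Longrightarrow> y = y'"
  using graph_diff[of x y x y'] graph_zero_unique[of "y - y'"] by simp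

lemma graph_sum:
  "(\<And>i. i \<in> A \<Longrightarrow> (f i, g i) \<in> H) \<Longrightarrow> (sum f A, sum g A) \<in> H"
  by (induction A rule: infinite_finite_induct) (simp_all add: graph_zero graph_add)

lemma graph_polys_coeff: "(p, q) \<in> graph_polys H \<Longrightarrow> (coeff p i, coeff q i) \<in> H"
  by (simp add: graph_polys_def)

lemma graph_polys_diff:
  "(p, q) \<in> graph_polys H \<Longrightarrow> (p', q') \<in> graph_polys H \<Longrightarrow> (p - p', q - q') \<in> graph_polys H"
  by (simp add: graph_polys_def graph_diff)

lemma graph_polys_mult:
  "(p, q) \<in> graph_polys H \<Longrightarrow> (p', q') \<in> graph_polys H \<Longrightarrow> (p * p', q * q') \<in> graph_polys H"
  by (simp add: graph_polys_def coeff_mult graph_sum graph_mult)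

lemma graph_polys_monom: "(c, c') \<in> H \<Longrightarrow> (monom c k, monom c' k) \<in> graph_polys H"
  by (simp add: graph_polys_def graph_zero)

text \<open>
  Division with remainder by the monic polynomial \<open>\<mu>\<close> can be carried out on both components of a pair
  at once. Hence a relation satisfied by \<open>a\<close> is a multiple of \<open>\<mu>\<close>, and its image vanishes at \<open>b\<close>.
\<close>

lemma graph_polys_root:
  assumes min: "minimal_pair H a \<mu> \<nu>" and b: "poly \<nu> b = 0"
  shows "(p, q) \<in> graph_polys H \<Longrightarrow> poly p a = 0 \<Longrightarrow> poly q b = 0"
proof (induction "if p = 0 then 0 else Suc (degree p)" arbitrary: p q rule: less_induct)
  case less
  have mu: "(\<mu>, \<nu>) \<in> graph_polys H" "lead_coeff \<mu> = 1" "poly \<mu> a = 0"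
    using min by (simp_all add: minimal_pair_def)
  show ?case
  proof (cases "p = 0")
    case True
    have "q = 0"
      by (rule poly_eqI) (use graph_polys_coeff[OF less.prems(1)] graph_zero_unique True in auto)
    then show ?thesis by simp
  next
    case False
    then have le: "degree \<mu> \<le> degree p" using min less.prems unfolding minimal_pair_def by blast
    let ?k = "degree p - degree \<mu>"
    let ?p = "p - monom (lead_coeff p) ?k * \<mu>"
    let ?q = "q - monom (coeff q (degree p)) ?k * \<nu>"
    have PP: "(?p, ?q) \<in> graph_polys H"
      by (intro graph_polys_diff graph_polys_mult graph_polys_monom less.prems mu graph_polys_coeff)
    have dp: "degree (monom (lead_coeff p) ?k * \<mu>) = degree p"
      using False mu(2) le by (subst degree_mult_eq) (auto simp: degree_monom_eq)
    have "coeff (monom (lead_coeff p) ?k * \<mu>) (degree p) = lead_coeff p"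
      using le mu(2) by (simp add: coeff_monom_mult)
    then have "coeff ?p (degree p) = 0" by simp
    moreover have "degree ?p \<le> degree p" using dp by (intro degree_diff_le) auto
    ultimately have "?p = 0 \<or> degree ?p < degree p"
      by (metis leading_coeff_0_iff le_neq_implies_less)
    moreover have "poly ?p a = 0" using less.prems(2) mu(3) by simp
    ultimately have "poly ?q b = 0"
      using False by (intro less.hyps[OF _ PP]) auto
    then show ?thesis using b by simp
  qed
qed

text \<open>
  Sending \<open>a\<close> to a root \<open>b\<close> of the image of its minimal polynomial is well-defined on all polynomial
  expressions in \<open>a\<close>. The freedom in the choice of \<open>b\<close> is used later to separate elements.
\<close>

lemma hom_graph_adjoin:
  assumes min: "minimal_pair H a \<mu> \<nu>" and b: "poly \<nu> b = 0"
  obtains H' where "hom_graph H'" "H \<subseteq> H'" "(a, b) \<in> H'"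
proof
  let ?H = "{(poly p a, poly q b) | p q. (p, q) \<in> graph_polys H}"
  have const: "(x, y) \<in> H \<Longrightarrow> (x, y) \<in> ?H" for x y
    using graph_polys_monom[of x y 0] by (auto simp: poly_monom intro!: exI[of _ "monom x 0"] exI[of _ "monom y 0"])
  then show "H \<subseteq> ?H" by auto
  show "(a, b) \<in> ?H"
    using graph_polys_monom[OF graph_one, of 1]
    by (auto simp: poly_monom intro!: exI[of _ "monom 1 1"])
  show "hom_graph ?H"
    unfolding hom_graph_def
  proof (intro conjI allI impI)
    show "(1, 1) \<in> ?H" using const graph_one by blast
    show "y = 0" if "(0, y) \<in> ?H" for y
      using that graph_polys_root[OF min b] by auto
    fix x y x' y' assume "(x, y) \<in> ?H" "(x', y') \<in> ?H"
    then obtain p q p' q' where pq: "(p, q) \<in> graph_polys H" "(p', q') \<in> graph_polys H"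
      and eq: "x = poly p a" "y = poly q b" "x' = poly p' a" "y' = poly q' b" by auto
    show "(x - x', y - y') \<in> ?H"
      using graph_polys_diff[OF pq] by (auto simp: eq intro!: exI[of _ "p - p'"] exI[of _ "q - q'"])
    show "(x * x', y * y') \<in> ?H"
      using graph_polys_mult[OF pq] by (auto simp: eq intro!: exI[of _ "p * p'"] exI[of _ "q * q'"])
  qed
qed

end

lemma comm_ring_map_to_ac: "comm_ring_map (to_ac :: 'a::field \<Rightarrow> _)"
  by unfold_locales auto

lemma comm_ring_map_embedding: "field_embedding \<iota> \<Longrightarrow> comm_ring_map \<iota>"
  by unfold_locales (auto simp: field_embedding_def)

context
  fixes \<iota> :: "'k::field \<Rightarrow> 'l::alg_closed_field"
  assumes emb: "comm_ring_map \<iota>"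
begin

interpretation \<iota>: comm_ring_map \<iota> by (rule emb)
interpretation ac: comm_ring_map "to_ac :: 'k \<Rightarrow> _" by (rule comm_ring_map_to_ac)

definition base_graph :: "('k alg_closure \<times> 'l) set" where
  "base_graph = range (\<lambda>x. (to_ac x, \<iota> x))"

lemma hom_graph_base: "hom_graph base_graph"
proof -
  have "(to_ac x, \<iota> x) \<in> base_graph" for x by (simp add: base_graph_def)
  from this[of 1] this[of "_ - _"] this[of "_ * _"] show ?thesis
    by (auto simp: hom_graph_def base_graph_def \<iota>.one \<iota>.zero \<iota>.diff \<iota>.mult)
qed

lemma graph_polys_map:
  "base_graph \<subseteq> H \<Longrightarrow> (map_poly to_ac p, map_poly \<iota> p) \<in> graph_polys H"
  by (auto simp: graph_polys_def base_graph_def \<iota>.coeff_map ac.coeff_map)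

text \<open>
  A ring between a field and an algebraic extension of it is a field: if \<open>c + x r(x) = 0\<close> with
  \<open>c \<noteq> 0\<close>, then \<open>- r(x) / c\<close> is the inverse of \<open>x\<close>. This lets minimal polynomials be made monic.
\<close>

lemma graph_inverse:
  assumes H: "hom_graph H" and base: "base_graph \<subseteq> H"
    and xy: "(x, y) \<in> H" and "x \<noteq> 0"
  shows "\<exists>z. (inverse x, z) \<in> H"
proof -
  have const: "(to_ac c, \<iota> c) \<in> H" for c using base by (auto simp: base_graph_def)
  have ev: "(poly (map_poly to_ac p) x, poly (map_poly \<iota> p) y) \<in> H" for p
    by (induction p) (auto simp: map_poly_pCons \<iota>.zero graph_zero[OF H] const
        intro!: graph_add[OF H] graph_mult[OF H] xy)
  obtain p where "p \<noteq> 0" "poly (map_poly to_ac p) x = 0"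
    by (rule alg_closure_algebraic)
  then have "\<exists>c r. c \<noteq> 0 \<and> poly (map_poly to_ac (pCons c r)) x = 0"
  proof (induction p)
    case (pCons c r)
    then show ?case
      using \<open>x \<noteq> 0\<close> by (cases "c = 0") (auto simp: map_poly_pCons)
  qed simp
  then obtain c r where c: "c \<noteq> 0" and "poly (map_poly to_ac (pCons c r)) x = 0" by blast
  then have "x * poly (map_poly to_ac r) x = - to_ac c"
    by (simp add: map_poly_pCons add_eq_0_iff)
  then have "inverse x = to_ac (- inverse c) * poly (map_poly to_ac r) x"
    using \<open>x \<noteq> 0\<close> c by (simp add: field_simps)
  then show ?thesis
    using graph_mult[OF H const[of "- inverse c"] ev[of r]] by auto
qed

lemma minimal_graph_poly:
  assumes H: "hom_graph H" and base: "base_graph \<subseteq> H"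
  shows "\<exists>\<mu> \<nu>. minimal_pair H a \<mu> \<nu>"
proof -
  define P where "P = {pq \<in> graph_polys H. fst pq \<noteq> 0 \<and> poly (fst pq) a = 0}"
  obtain p0 where "p0 \<noteq> 0" "poly (map_poly to_ac p0) a = 0"
    by (rule alg_closure_algebraic)
  then have "(map_poly to_ac p0, map_poly \<iota> p0) \<in> P"
    using graph_polys_map[OF base, of p0] by (auto simp: P_def map_poly_eq_0_iff)
  then have "\<exists>pq. pq \<in> P \<and> (\<forall>pq'. pq' \<in> P \<longrightarrow> degree (fst pq) \<le> degree (fst pq'))"
    by (rule ex_has_least_nat)
  then obtain p q where pq: "(p, q) \<in> P" and min: "\<And>p' q'. (p', q') \<in> P \<Longrightarrow> degree p \<le> degree p'"
    by fastforce
  have pq': "(p, q) \<in> graph_polys H" "p \<noteq> 0" "poly p a = 0" using pq by (auto simp: P_def)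
  obtain z where "(inverse (lead_coeff p), z) \<in> H"
    using graph_inverse[OF H base graph_polys_coeff[OF H pq'(1), of "degree p"]] pq'(2) by auto
  then have "(monom (inverse (lead_coeff p)) 0 * p, monom z 0 * q) \<in> graph_polys H"
    by (intro graph_polys_mult graph_polys_monom H pq')
  moreover have "monom (inverse (lead_coeff p)) 0 * p = smult (inverse (lead_coeff p)) p"
    by (simp add: monom_0)
  ultimately have "(smult (inverse (lead_coeff p)) p, monom z 0 * q) \<in> graph_polys H" by simp
  moreover have "lead_coeff (smult (inverse (lead_coeff p)) p) = 1"
    using pq'(2) by simp
  moreover have "poly (smult (inverse (lead_coeff p)) p) a = 0"
    using pq'(3) by simp
  moreover have "degree (smult (inverse (lead_coeff p)) p) \<le> degree p'"
    if "(p', q') \<in> graph_polys H" "p' \<noteq> 0" "poly p' a = 0" for p' q'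
    using min[of p' q'] that by (simp add: P_def)
  ultimately show ?thesis unfolding minimal_pair_def by blast
qed

text \<open>
  A maximal graph has the whole algebraic closure as its domain, since otherwise a further element
  could be adjoined, its image being a root that exists because the target is algebraically closed.
\<close>

lemma extend_hom_graph:
  assumes H0: "hom_graph H0" and base: "base_graph \<subseteq> H0"
  shows "\<exists>\<sigma>. comm_ring_map \<sigma> \<and> (\<forall>x y. (x, y) \<in> H0 \<longrightarrow> \<sigma> x = y)"
proof -
  define S where "S = {H. hom_graph H \<and> H0 \<subseteq> H}"
  have "\<exists>M\<in>S. \<forall>N\<in>S. M \<subseteq> N \<longrightarrow> N = M"
  proof (rule subset_Zorn_nonempty)
    show "S \<noteq> {}" using H0 by (auto simp: S_def)
    fix C assume C: "C \<noteq> {}" "subset.chain S C"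
    have sub: "hom_graph H" "H0 \<subseteq> H" if "H \<in> C" for H
      using C(2) that by (auto simp: subset.chain_def S_def)
    have two: "\<exists>H\<in>C. u \<in> H \<and> v \<in> H" if "u \<in> \<Union>C" "v \<in> \<Union>C" for u v
    proof -
      obtain H1 H2 where *: "H1 \<in> C" "u \<in> H1" "H2 \<in> C" "v \<in> H2" using \<open>u \<in> \<Union>C\<close> \<open>v \<in> \<Union>C\<close> by blast
      then have "H1 \<subseteq> H2 \<or> H2 \<subseteq> H1" using C(2) by (simp add: subset_chain_def)
      with * show ?thesis by blast
    qed
    have "hom_graph (\<Union>C)"
      unfolding hom_graph_def
    proof (intro conjI allI impI)
      show "(1, 1) \<in> \<Union>C" using C(1) graph_one[OF sub(1)] by auto
      show "y = 0" if "(0, y) \<in> \<Union>C" for y using that graph_zero_unique[OF sub(1)] by auto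
      fix x y x' y' assume "(x, y) \<in> \<Union>C" "(x', y') \<in> \<Union>C"
      then obtain H where *: "H \<in> C" "(x, y) \<in> H" "(x', y') \<in> H" using two by meson
      have "hom_graph H" by (rule sub) fact
      then have "(x - x', y - y') \<in> H" "(x * x', y * y') \<in> H"
        using *(2,3) by (auto intro: graph_diff graph_mult)
      then show "(x - x', y - y') \<in> \<Union>C" "(x * x', y * y') \<in> \<Union>C"
        using *(1) by auto
    qed
    then show "\<Union>C \<in> S" using C(1) sub by (auto simp: S_def)
  qed
  then obtain M where M: "hom_graph M" "H0 \<subseteq> M" and max: "\<And>N. hom_graph N \<Longrightarrow> M \<subseteq> N \<Longrightarrow> N = M"
    by (auto simp: S_def)
  have baseM: "base_graph \<subseteq> M" using base M by blast
  have total: "\<exists>b. (a, b) \<in> M" for a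
  proof -
    obtain \<mu> \<nu> where min: "minimal_pair M a \<mu> \<nu>"
      using minimal_graph_poly[OF M(1) baseM] by blast
    then have mu: "(\<mu>, \<nu>) \<in> graph_polys M" "lead_coeff \<mu> = 1" "poly \<mu> a = 0"
      by (simp_all add: minimal_pair_def)
    have "degree \<mu> \<noteq> 0"
      using monic_root_degree[OF mu(2,3)] by simp
    have "coeff \<nu> (degree \<mu>) = 1"
      using graph_polys_coeff[OF M(1) mu(1), of "degree \<mu>"] mu(2)
        graph_unique[OF M(1) _ graph_one[OF M(1)], of "coeff \<nu> (degree \<mu>)"] by simp
    then have "degree \<nu> > 0" using \<open>degree \<mu> \<noteq> 0\<close> le_degree[of \<nu> "degree \<mu>"] by auto
    then obtain b where "poly \<nu> b = 0" using alg_closed_imp_poly_has_root by blast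
    then obtain H' where "hom_graph H'" "M \<subseteq> H'" "(a, b) \<in> H'"
      by (rule hom_graph_adjoin[OF M(1) min])
    then show ?thesis using max by blast
  qed
  define \<sigma> where "\<sigma> a = (THE b. (a, b) \<in> M)" for a
  have eqI: "\<sigma> a = b" if "(a, b) \<in> M" for a b
    unfolding \<sigma>_def using that by (rule the_equality) (use that graph_unique[OF M(1)] in blast)
  have \<sigma>: "(a, \<sigma> a) \<in> M" for a using total[of a] eqI by auto
  have "comm_ring_map \<sigma>"
    by unfold_locales (auto intro!: eqI graph_one[OF M(1)] graph_add[OF M(1)] graph_mult[OF M(1)] \<sigma>)
  moreover have "\<sigma> x = y" if "(x, y) \<in> H0" for x y using that M(2) eqI by blast
  ultimately show ?thesis by blast
qed

definition over_base :: "('k alg_closure \<Rightarrow> 'l) \<Rightarrow> bool" where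
  "over_base \<sigma> \<longleftrightarrow> comm_ring_map \<sigma> \<and> (\<forall>x. \<sigma> (to_ac x) = \<iota> x)"

lemma over_base_exists: "\<exists>\<sigma>. over_base \<sigma>"
  using extend_hom_graph[OF hom_graph_base subset_refl]
  by (metis over_base_def base_graph_def rangeI)

text \<open>
  The base field is the common fixed field of the embeddings. If the image of the minimal polynomial
  of \<open>c\<close> had only one root \<open>b\<close>, it would be \<open>(Y - b)\<^sup>n\<close>; its subleading coefficient \<open>- n b\<close> lies in the
  image of the base field, hence so does \<open>b\<close>, and the minimal polynomial would have a root in the
  base field.
\<close>

lemma over_base_separates:
  assumes c: "c \<notin> range to_ac" and char: "\<And>n. n > 0 \<Longrightarrow> of_nat n \<noteq> (0 :: 'l)"
  shows "\<exists>\<sigma>1 \<sigma>2. over_base \<sigma>1 \<and> over_base \<sigma>2 \<and> \<sigma>1 c \<noteq> \<sigma>2 c"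
proof -
  obtain \<mu> \<nu> where min: "minimal_pair base_graph c \<mu> \<nu>"
    using minimal_graph_poly[OF hom_graph_base subset_refl] by blast
  then have mu: "(\<mu>, \<nu>) \<in> graph_polys base_graph" "lead_coeff \<mu> = 1" "poly \<mu> c = 0"
    by (simp_all add: minimal_pair_def)
  have ext: "\<exists>\<sigma>. over_base \<sigma> \<and> \<sigma> c = b" if root: "poly \<nu> b = 0" for b
  proof -
    obtain H' where H': "hom_graph H'" "base_graph \<subseteq> H'" "(c, b) \<in> H'"
      by (rule hom_graph_adjoin[OF hom_graph_base min root])
    obtain \<sigma> where "comm_ring_map \<sigma>" "\<forall>x y. (x, y) \<in> H' \<longrightarrow> \<sigma> x = y"
      using extend_hom_graph[OF H'(1,2)] by blast
    moreover have "(to_ac x, \<iota> x) \<in> H'" for x using H'(2) by (auto simp: base_graph_def)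
    ultimately show ?thesis using H'(3) unfolding over_base_def by (intro exI[of _ \<sigma>]) blast
  qed
  define \<mu>0 where "\<mu>0 = map_poly of_ac \<mu>"
  have co: "to_ac (coeff \<mu>0 i) = coeff \<mu> i" "\<iota> (coeff \<mu>0 i) = coeff \<nu> i" for i
    using mu(1) by (auto simp: \<mu>0_def coeff_map_poly graph_polys_def base_graph_def)
      (metis (mono_tags, lifting) Pair_inject imageE of_ac_to_ac)+
  have eqs: "\<mu> = map_poly to_ac \<mu>0" "\<nu> = map_poly \<iota> \<mu>0"
    by (simp_all add: poly_eq_iff ac.coeff_map \<iota>.coeff_map co)
  have deg: "degree \<mu>0 = degree \<mu>" unfolding eqs by (rule sym, rule degree_map_poly) simp
  have lc0: "lead_coeff \<mu>0 = 1" using mu(2) co(1)[of "degree \<mu>0"] by (simp add: deg)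
  have "\<mu>0 \<noteq> 0" using lc0 by auto
  have degnu: "degree \<nu> = degree \<mu>" "lead_coeff \<nu> = 1"
    using \<iota>.map_poly_monic[OF lc0] deg by (simp_all add: eqs(2))
  define n where "n = degree \<mu>"
  have "n > 0" using monic_root_degree[OF mu(2,3)] by (simp add: n_def)
  obtain b where b: "poly \<nu> b = 0"
    using alg_closed_imp_poly_has_root[of \<nu>] \<open>n > 0\<close> degnu by (auto simp: n_def)
  have "\<exists>b'. poly \<nu> b' = 0 \<and> b' \<noteq> b"
  proof (rule ccontr)
    assume all: "\<not> ?thesis"
    have "\<nu> \<noteq> 0" using degnu(2) by auto
    then obtain A where A: "size A = n" "\<nu> = (\<Prod>x\<in>#A. [:- x, 1:])"
      using alg_closed_imp_factorization[of \<nu>] degnu \<open>n > 0\<close> by (auto simp: n_def)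
    have "x = b" if "x \<in># A" for x
    proof -
      have "poly \<nu> x = 0" unfolding A(2) poly_prod_mset using that
        by (auto simp: prod_mset_zero_iff)
      then show ?thesis using all by blast
    qed
    then have "A = replicate_mset n b" using A(1) set_mset_subset_singletonD[of A b] by auto
    then have nu: "\<nu> = [:- b, 1:] ^ n" using A(2) by simp
    have "coeff \<nu> (n - 1) = - (of_nat n * b)"
      using \<open>n > 0\<close> by (simp add: nu coeff_linear_poly_power choose_pred)
    then have "of_nat n * b = \<iota> (- coeff \<mu>0 (n - 1))"
      by (simp add: co \<iota>.uminus)
    moreover have nz: "of_nat n \<noteq> (0 :: 'l)" by (rule char) fact
    then have nzk: "of_nat n \<noteq> (0 :: 'k)" using \<iota>.of_nat[of n] \<iota>.zero by metis
    ultimately have "of_nat n * b = of_nat n * \<iota> (- coeff \<mu>0 (n - 1) / of_nat n)"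
      by (simp add: \<iota>.of_nat[symmetric] \<iota>.mult[symmetric])
    then obtain t where t: "b = \<iota> t" using nz by auto
    have "\<iota> (poly \<mu>0 t) = 0" using b by (simp add: eqs(2) t \<iota>.poly_map)
    then have "poly \<mu>0 t = 0"
      using comm_ring_map_inj[OF emb] by (metis \<iota>.zero injD)
    then obtain \<mu>1 where \<mu>1: "\<mu>0 = [:- t, 1:] * \<mu>1" unfolding poly_eq_0_iff_dvd by (elim dvdE)
    have "\<mu>1 \<noteq> 0" using \<mu>1 \<open>\<mu>0 \<noteq> 0\<close> by auto
    have "poly (map_poly to_ac \<mu>1) c = 0"
      using mu(3) c by (auto simp: eqs(1) \<mu>1 ac.map_poly_mult ac.map_poly_linear simp del: mult_pCons_left)
    then have "degree \<mu> \<le> degree (map_poly to_ac \<mu>1)"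
      using min graph_polys_map[OF subset_refl, of \<mu>1] \<open>\<mu>1 \<noteq> 0\<close>
      by (auto simp: map_poly_eq_0_iff minimal_pair_def)
    also have "\<dots> = degree \<mu>1" by (rule degree_map_poly) simp
    also have "degree \<mu>0 = Suc (degree \<mu>1)"
      using \<open>\<mu>1 \<noteq> 0\<close> unfolding \<mu>1 by (subst degree_mult_eq) auto
    then have "degree \<mu>1 < degree \<mu>" using deg by simp
    finally show False by simp
  qed
  then show ?thesis using ext b by metis
qed

end

section \<open>Orders of Puiseux series\<close>

text \<open>
  \<open>vge x a\<close> says \<open>\<upsilon>(x) \<ge> a\<close>. It also covers \<open>x = 0\<close>, where the order \<open>pord\<close> has no meaningful value.
\<close>

definition vge :: "'a::comm_ring_1 puiseux \<Rightarrow> rat \<Rightarrow> bool" where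
  "vge x a \<longleftrightarrow> (\<forall>r<a. puiseux_nth x r = 0)"

definition pord :: "'a::comm_ring_1 puiseux \<Rightarrow> rat" where
  "pord x = (LEAST r. puiseux_nth x r \<noteq> 0)"

lemma vgeD: "vge x a \<Longrightarrow> r < a \<Longrightarrow> puiseux_nth x r = 0"
  by (simp add: vge_def)

lemma vge_0 [simp]: "vge 0 a"
  by (simp add: vge_def)

lemma vge_1: "vge 1 0"
  by (simp add: vge_def puiseux_nth_1)

lemma vge_add: "vge x a \<Longrightarrow> vge y a \<Longrightarrow> vge (x + y) a"
  by (simp add: vge_def)

lemma vge_uminus: "vge x a \<Longrightarrow> vge (- x) a"
  by (simp add: vge_def)

lemma vge_diff: "vge x a \<Longrightarrow> vge y a \<Longrightarrow> vge (x - y) a"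
  by (simp add: vge_def)

lemma vge_mono: "vge x a \<Longrightarrow> b \<le> a \<Longrightarrow> vge x b"
  by (auto simp: vge_def)

lemma puiseux_nth_sum: "puiseux_nth (sum f A) r = (\<Sum>i\<in>A. puiseux_nth (f i) r)"
  by (induction A rule: infinite_finite_induct) simp_all

lemma puiseux_nth_mult:
  "puiseux_nth (x * y) r =
     (\<Sum>s | puiseux_nth x s \<noteq> 0 \<and> puiseux_nth y (r - s) \<noteq> 0. puiseux_nth x s * puiseux_nth y (r - s))"
  by (simp add: times_puiseux.rep_eq convolution_def)

lemma vge_mult:
  assumes "vge x a" "vge y b"
  shows "vge (x * y) (a + b)"
  unfolding vge_def
proof (intro allI impI)
  fix r assume r: "r < a + b"
  have "puiseux_nth x s = 0 \<or> puiseux_nth y (r - s) = 0" for s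
    using assms r by (cases "s < a") (auto simp: vge_def)
  then have "{s. puiseux_nth x s \<noteq> 0 \<and> puiseux_nth y (r - s) \<noteq> 0} = {}" by auto
  then show "puiseux_nth (x * y) r = 0" by (simp only: puiseux_nth_mult sum.empty)
qed

lemma puiseux_nth_mult_lead:
  assumes "vge x a" "vge y b"
  shows "puiseux_nth (x * y) (a + b) = puiseux_nth x a * puiseux_nth y b"
proof -
  let ?S = "{s. puiseux_nth x s \<noteq> 0 \<and> puiseux_nth y (a + b - s) \<noteq> 0}"
  have "s = a" if "s \<in> ?S" for s
  proof -
    have "\<not> s < a" "\<not> a + b - s < b" using that assms by (auto simp: vge_def)
    then show ?thesis by simp
  qed
  then have "?S \<subseteq> {a}" by auto
  then have "puiseux_nth (x * y) (a + b) = (\<Sum>s\<in>{a}. puiseux_nth x s * puiseux_nth y (a + b - s))"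
    unfolding puiseux_nth_mult by (rule sum.mono_neutral_left[rotated]) auto
  then show ?thesis by simp
qed

lemma vge_power: "vge x a \<Longrightarrow> vge (x ^ n) (of_nat n * a)"
proof (induction n)
  case (Suc n)
  then show ?case using vge_mult[of x a "x ^ n" "of_nat n * a"] by (simp add: algebra_simps)
qed (simp add: vge_1)

lemma puiseux_nth_power_lead:
  "vge x a \<Longrightarrow> puiseux_nth (x ^ n) (of_nat n * a) = puiseux_nth x a ^ n"
proof (induction n)
  case (Suc n)
  then show ?case
    using puiseux_nth_mult_lead[of x a "x ^ n" "of_nat n * a"] vge_power[of x a n]
    by (simp add: algebra_simps)
qed (simp add: puiseux_nth_1)

lemma puiseux_lead_exists:
  fixes x :: "'a::comm_ring_1 puiseux"
  assumes "x \<noteq> 0"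
  shows "\<exists>v. puiseux_nth x v \<noteq> 0 \<and> vge x v"
proof -
  obtain k F where k: "k > 0" and F: "puiseux_nth x = ramified k F"
    using puiseux_nth[of x] by (rule puiseux_funsE)
  have "F \<noteq> 0"
  proof
    assume "F = 0"
    then have "x = 0" by (intro puiseux_eqI) (simp add: F ramified_def)
    with assms show False by simp
  qed
  define v where "v = of_int (fls_subdegree F) / (of_nat k :: rat)"
  have "of_nat k * v = of_int (fls_subdegree F)" using k by (simp add: v_def)
  then have "puiseux_nth x v = F $$ fls_subdegree F" by (simp add: F ramified_def)
  then have "puiseux_nth x v \<noteq> 0" using \<open>F \<noteq> 0\<close> by simp
  moreover have "vge x v"
    unfolding vge_def
  proof (intro allI impI)
    fix r assume "r < v"
    then have "of_nat k * r < of_int (fls_subdegree F)"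
      using k by (simp add: v_def less_divide_eq mult.commute)
    then have "\<lfloor>of_nat k * r\<rfloor> < fls_subdegree F" by (simp add: floor_less_iff)
    then show "puiseux_nth x r = 0" by (simp add: F ramified_def)
  qed
  ultimately show ?thesis by blast
qed

lemma pord_eqI: "puiseux_nth x v \<noteq> 0 \<Longrightarrow> vge x v \<Longrightarrow> pord x = v"
  unfolding pord_def by (rule Least_equality) (auto simp: vge_def not_less[symmetric])

lemma
  assumes "x \<noteq> 0"
  shows puiseux_nth_pord: "puiseux_nth x (pord x) \<noteq> 0" and vge_pord: "vge x (pord x)"
  using puiseux_lead_exists[OF assms] pord_eqI by metis+

lemma pord_ge_iff: "x \<noteq> 0 \<Longrightarrow> a \<le> pord x \<longleftrightarrow> vge x a"
  using puiseux_nth_pord[of x] vge_mono[OF vge_pord, of x a]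
  by (auto simp: vge_def not_less[symmetric])

lemma puiseux_val_pord: "puiseux_val x = (if x = 0 then Pinf else Fin (pord x))"
  by (simp add: puiseux_val_def pord_def)

lemma pord_mult:
  fixes x y :: "'a::field puiseux"
  assumes "x \<noteq> 0" "y \<noteq> 0"
  shows "pord (x * y) = pord x + pord y"
  using assms by (intro pord_eqI)
    (simp_all add: puiseux_nth_mult_lead vge_mult vge_pord puiseux_nth_pord)

lemma pord_1: "pord (1 :: 'a::field puiseux) = 0"
  by (rule pord_eqI) (simp_all add: puiseux_nth_1 vge_1)

lemma pord_power:
  fixes x :: "'a::field puiseux"
  shows "x \<noteq> 0 \<Longrightarrow> pord (x ^ n) = of_nat n * pord x"
  by (induction n) (simp_all add: pord_1 pord_mult algebra_simps)

lemma pord_prod: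
  fixes f :: "'b \<Rightarrow> 'a::field puiseux"
  assumes "\<And>i. i \<in> A \<Longrightarrow> f i \<noteq> 0"
  shows "pord (prod f A) = (\<Sum>i\<in>A. pord (f i))"
  using assms by (induction A rule: infinite_finite_induct) (simp_all add: pord_1 pord_mult)

lemma puiseux_nth_trunc_less: "puiseux_nth (trunc_less t x) r = (if r < t then puiseux_nth x r else 0)"
  by (simp add: trunc_less.rep_eq)

lemma puiseux_nth_trunc_le: "puiseux_nth (trunc_le t x) r = (if r \<le> t then puiseux_nth x r else 0)"
  by (simp add: trunc_le.rep_eq)

lemma puiseux_eq_iff: "x = y \<longleftrightarrow> (\<forall>r. puiseux_nth x r = puiseux_nth y r)"
  using puiseux_eqI by blast

lemma trunc_less_eq_iff: "trunc_less t x = trunc_less t y \<longleftrightarrow> vge (x - y) t"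
  by (auto simp: puiseux_eq_iff puiseux_nth_trunc_less vge_def)

lemma trunc_le_eq_iff: "trunc_le t x = trunc_le t y \<longleftrightarrow> (\<forall>r\<le>t. puiseux_nth x r = puiseux_nth y r)"
  by (auto simp: puiseux_eq_iff puiseux_nth_trunc_le)

text \<open>
  Any property of ring elements that is stable under ring operations passes from the roots to the
  coefficients. It is applied to integrality and to finiteness of the support.
\<close>

lemma coeff_prod_linear_closed:
  fixes A :: "'a::comm_ring_1 multiset"
  assumes zero: "C 0" and one: "C 1" and add: "\<And>x y. C x \<Longrightarrow> C y \<Longrightarrow> C (x + y)"
    and mult: "\<And>x y. C x \<Longrightarrow> C y \<Longrightarrow> C (x * y)" and roots: "\<And>x. x \<in># A \<Longrightarrow> C (- x)"
  shows "C (coeff (\<Prod>x\<in>#A. [:- x, 1:]) i)"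
  using roots
proof (induction A arbitrary: i)
  case empty
  show ?case by (simp add: zero one coeff_1)
next
  case (add x A)
  let ?P = "\<Prod>x\<in>#A. [:- x, 1:]"
  have sum: "C (\<Sum>j\<in>J. h j)" if "\<And>j. j \<in> J \<Longrightarrow> C (h j)" for h and J :: "nat set"
    using that by (induction J rule: infinite_finite_induct) (simp_all add: zero assms(3))
  have "C (coeff [:- x, 1:] j)" for j
    using add.prems[of x] by (auto simp: coeff_pCons zero one split: nat.splits)
  then have "C (coeff ([:- x, 1:] * ?P) i)"
    unfolding coeff_mult using add.prems by (intro sum mult add.IH) auto
  then show ?case by (simp only: image_mset_add_mset prod_mset.add_mset)
qed

text \<open>
  If \<open>\<upsilon>(x) = v\<close> were negative, the term \<open>x\<^sup>n\<close> would be the only one that contributes to the exponent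
  \<open>n v\<close> in the value of the monic polynomial at \<open>x\<close>.
\<close>

lemma root_integral:
  fixes p :: "'a::field puiseux poly"
  assumes p: "lead_coeff p = 1" "\<And>i. vge (coeff p i) 0" and x: "poly p x = 0"
  shows "vge x 0"
proof (cases "x = 0")
  case False
  define v where "v = pord x"
  have v: "vge x v" "puiseux_nth x v \<noteq> 0"
    using vge_pord puiseux_nth_pord False by (simp_all add: v_def)
  show ?thesis
  proof (rule ccontr)
    assume "\<not> vge x 0"
    then have "v < 0" using vge_mono[OF v(1)] not_less by blast
    define n where "n = degree p"
    have "puiseux_nth (coeff p i * x ^ i) (of_nat n * v) = 0" if "i < n" for i
    proof (rule vgeD[OF vge_mult[OF p(2) vge_power[OF v(1)]]])
      show "of_nat n * v < 0 + of_nat i * v" using that \<open>v < 0\<close> by simp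
    qed
    then have "puiseux_nth (\<Sum>i<n. coeff p i * x ^ i) (of_nat n * v) = 0"
      by (simp add: puiseux_nth_sum)
    moreover have "poly p x = (\<Sum>i<n. coeff p i * x ^ i) + x ^ n"
      using p(1) by (simp add: poly_altdef n_def flip: lessThan_Suc_atMost)
    ultimately have "puiseux_nth (poly p x) (of_nat n * v) = puiseux_nth x v ^ n"
      by (simp add: puiseux_nth_power_lead v(1))
    then show False using x v(2) by simp
  qed
qed simp

section \<open>Conjugate expansions\<close>

text \<open>
  Let \<open>d\<close> be the greatest common divisor of \<open>k\<close> and \<open>n\<close>, and \<open>k = d e\<close>. If \<open>e > 1\<close>, a root \<open>y\<close> of
  \<open>1 + y + \<dots> + y\<^bsup>e-1\<^esup>\<close> is different from \<open>1\<close>, because \<open>e \<noteq> 0\<close> in the field. A \<open>d\<close>-th root of \<open>y\<close> is then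
  a \<open>k\<close>-th root of unity whose \<open>d\<close>-th power, and hence whose \<open>n\<close>-th power, is not \<open>1\<close>.
\<close>

lemma root_of_unity_exponent:
  fixes n :: int
  assumes k: "k > 0" and char: "\<And>n. n > 0 \<Longrightarrow> of_nat n \<noteq> (0 :: 'l::alg_closed_field)"
    and triv: "\<And>\<zeta>::'l. \<zeta> ^ k = 1 \<Longrightarrow> \<zeta> powi n = 1"
  shows "int k dvd n"
proof (rule ccontr)
  assume ndvd: "\<not> int k dvd n"
  define d where "d = nat (gcd (int k) n)"
  have d: "int d = gcd (int k) n" by (simp add: d_def)
  have "int d dvd int k" by (simp add: d)
  then have "d dvd k" by simp
  then obtain e where e: "k = d * e" by (elim dvdE)
  have "d > 0" using k e by (auto intro!: Nat.gr0I)
  have "e \<noteq> 1"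
  proof
    assume "e = 1"
    then have "int k = gcd (int k) n" using d e by simp
    then show False using ndvd by (metis gcd_dvd2)
  qed
  moreover have "e > 0" using k e by (auto intro!: Nat.gr0I)
  ultimately have "e > 1" by simp
  have "\<exists>y::'l. (\<Sum>i\<le>e - 1. 1 * y ^ i) = 0"
    by (rule alg_closed) (use \<open>e > 1\<close> in auto)
  then obtain y :: 'l where y: "(\<Sum>i<e. y ^ i) = 0"
    using \<open>e > 1\<close> by (auto simp flip: lessThan_Suc_atMost)
  have "y ^ e - 1 = (y - 1) * (\<Sum>i<e. y ^ i)"
    by (rule power_diff_1_eq)
  then have ye: "y ^ e = 1" using y by simp
  have "y \<noteq> 1" using y char[OF \<open>e > 0\<close>] by auto
  obtain \<zeta> :: 'l where \<zeta>: "\<zeta> ^ d = y" using nth_root_exists[OF \<open>d > 0\<close>] by blast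
  have k1: "\<zeta> ^ k = 1" by (simp add: e power_mult \<zeta> ye)
  then have n1: "\<zeta> powi n = 1" by (rule triv)
  have "\<zeta> \<noteq> 0" using k1 k by (auto simp: power_0_left)
  obtain a b where "a * int k + b * n = gcd (int k) n" using bezout_int by blast
  then have "\<zeta> powi (int d) = \<zeta> powi (int k * a + n * b)" by (simp add: d mult.commute)
  also have "\<dots> = (\<zeta> powi int k) powi a * (\<zeta> powi n) powi b"
    using \<open>\<zeta> \<noteq> 0\<close> by (simp add: power_int_add power_int_mult)
  also have "\<dots> = 1" by (simp add: k1 n1)
  finally show False using \<zeta> \<open>y \<noteq> 1\<close> by simp
qed

definition fls_twist :: "('a::zero \<Rightarrow> 'l::field) \<Rightarrow> 'l \<Rightarrow> 'a fls \<Rightarrow> 'l fls" where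
  "fls_twist \<sigma> \<zeta> F = Abs_fls (\<lambda>n. \<sigma> (F $$ n) * \<zeta> powi n)"

text \<open>
  The homomorphism \<open>\<Sum>\<^sub>n a\<^sub>n X\<^sup>n \<mapsto> \<Sum>\<^sub>n \<sigma>(a\<^sub>n) \<zeta>\<^sup>n X\<^bsup>n/k\<^esup>\<close>. Starting from Laurent series in \<open>X\<^bsup>1/k\<^esup>\<close>
  avoids the choice of a compatible system of roots of unity of all orders.
\<close>

definition conjugation :: "nat \<Rightarrow> ('a::zero \<Rightarrow> 'l::field) \<Rightarrow> 'l \<Rightarrow> 'a fls \<Rightarrow> 'l puiseux" where
  "conjugation k \<sigma> \<zeta> F = Abs_puiseux (ramified k (fls_twist \<sigma> \<zeta> F))"

lemma fls_nth_twist: "\<sigma> 0 = 0 \<Longrightarrow> fls_twist \<sigma> \<zeta> F $$ n = \<sigma> (F $$ n) * \<zeta> powi n"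
  unfolding fls_twist_def by (rule nth_Abs_fls_lower_bound[of "fls_subdegree F"]) simp

lemma puiseux_nth_conjugation:
  assumes "k > 0" "\<sigma> 0 = 0"
  shows "puiseux_nth (conjugation k \<sigma> \<zeta> F) r =
    (if of_nat k * r \<in> \<int> then \<sigma> (F $$ \<lfloor>of_nat k * r\<rfloor>) * \<zeta> powi \<lfloor>of_nat k * r\<rfloor> else 0)"
  using assms
  by (simp add: conjugation_def Abs_puiseux_inverse ramified_in_puiseux_funs ramified_def fls_nth_twist)

lemma comm_ring_map_twist:
  fixes \<sigma> :: "'a::field \<Rightarrow> 'l::field"
  assumes \<sigma>: "comm_ring_map \<sigma>" and "\<zeta> \<noteq> 0"
  shows "comm_ring_map (fls_twist \<sigma> \<zeta>)"
proof -
  interpret \<sigma>: comm_ring_map \<sigma> by fact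
  have inj: "\<sigma> x = 0 \<longleftrightarrow> x = 0" for x
    using comm_ring_map_inj[OF \<sigma>] by (metis \<sigma>.zero injD)
  have nth: "fls_twist \<sigma> \<zeta> F $$ n = \<sigma> (F $$ n) * \<zeta> powi n" for F n
    by (rule fls_nth_twist) (rule \<sigma>.zero)
  have sd: "fls_subdegree (fls_twist \<sigma> \<zeta> F) = fls_subdegree F" for F
  proof (cases "F = 0")
    case True
    then have "fls_twist \<sigma> \<zeta> F = 0" by (intro fls_eqI) (simp add: nth \<sigma>.zero)
    with True show ?thesis by simp
  next
    case False
    then show ?thesis
      using \<open>\<zeta> \<noteq> 0\<close> by (intro fls_subdegree_eqI) (simp_all add: nth inj)
  qed
  show ?thesis
  proof
    show "fls_twist \<sigma> \<zeta> 1 = 1" by (rule fls_eqI) (simp add: nth \<sigma>.one \<sigma>.zero)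
    fix F G
    show "fls_twist \<sigma> \<zeta> (F + G) = fls_twist \<sigma> \<zeta> F + fls_twist \<sigma> \<zeta> G"
      by (rule fls_eqI) (simp add: nth \<sigma>.add distrib_right)
    show "fls_twist \<sigma> \<zeta> (F * G) = fls_twist \<sigma> \<zeta> F * fls_twist \<sigma> \<zeta> G"
    proof (rule fls_eqI)
      fix n
      have "\<sigma> x * \<sigma> y * \<zeta> powi n = (\<sigma> x * \<zeta> powi i) * (\<sigma> y * \<zeta> powi (n - i))" for x y i
        using power_int_add[of \<zeta> i "n - i"] \<open>\<zeta> \<noteq> 0\<close> by (simp add: mult_ac)
      then show "fls_twist \<sigma> \<zeta> (F * G) $$ n = (fls_twist \<sigma> \<zeta> F * fls_twist \<sigma> \<zeta> G) $$ n"
        unfolding nth fls_times_nth(2) sd \<sigma>.sum \<sigma>.mult sum_distrib_right by (rule sum.cong[OF refl])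
    qed
  qed
qed

lemma comm_ring_map_conjugation:
  fixes \<sigma> :: "'a::field \<Rightarrow> 'l::field"
  assumes \<sigma>: "comm_ring_map \<sigma>" and "\<zeta> \<noteq> 0" and k: "k > 0"
  shows "comm_ring_map (conjugation k \<sigma> \<zeta>)"
proof -
  interpret t: comm_ring_map "fls_twist \<sigma> \<zeta>" by (rule comm_ring_map_twist[OF assms(1,2)])
  have nth: "puiseux_nth (conjugation k \<sigma> \<zeta> F) = ramified k (fls_twist \<sigma> \<zeta> F)" for F
    unfolding conjugation_def by (rule Abs_puiseux_inverse) (rule ramified_in_puiseux_funs[OF k])
  show ?thesis
    by unfold_locales
      (simp_all add: nth t.one t.add t.mult puiseux_nth_one_ramified[OF k] puiseux_nth_add_ramified[OF nth nth]
        puiseux_nth_mult_ramified[OF k nth nth] flip: puiseux_nth_inject)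
qed

lemma order_linear_factor: "order x [:- y, 1 :: 'a::idom:] = (if x = y then 1 else 0)"
  using order_power_n_n[of y 1] by (auto simp: order_0I)

lemma order_prod_linear_mset:
  fixes A :: "'a::idom multiset"
  shows "order x (\<Prod>y\<in>#A. [:- y, 1:]) = count A x"
proof (induction A)
  case (add y A)
  have "(\<Prod>y\<in>#A. [:- y, 1:]) \<noteq> 0" by (auto simp: prod_mset_zero_iff)
  then have "[:- y, 1:] * (\<Prod>y\<in>#A. [:- y, 1:]) \<noteq> 0" by (intro no_zero_divisors) auto
  then have "order x ([:- y, 1:] * (\<Prod>y\<in>#A. [:- y, 1:])) = order x [:- y, 1:] + count A x"
    by (metis order_mult add.IH)
  then show ?case by (simp only: image_mset_add_mset prod_mset.add_mset order_linear_factor) simp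
qed (simp add: order_1_eq_0)

lemma degree_prod_linear_mset:
  fixes A :: "'a::idom multiset"
  shows "degree (\<Prod>y\<in>#A. [:- y, 1:]) = size A"
proof (induction A)
  case (add y A)
  have "(\<Prod>y\<in>#A. [:- y, 1:]) \<noteq> 0" by (auto simp: prod_mset_zero_iff)
  then have "degree ([:- y, 1:] * (\<Prod>y\<in>#A. [:- y, 1:])) = Suc (size A)"
    by (subst degree_mult_eq) (auto simp: add.IH)
  then show ?case by (simp only: image_mset_add_mset prod_mset.add_mset size_add_mset)
qed simp

definition embed_fps :: "('k::field \<Rightarrow> 'l::field) \<Rightarrow> 'k fps \<Rightarrow> 'l puiseux" where
  "embed_fps \<iota> c = puiseux_of_fps (Abs_fps (\<lambda>n. \<iota> (fps_nth c n)))"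

lemma puiseux_nth_embed_fps:
  "puiseux_nth (embed_fps \<iota> c) r = (if r \<in> \<int> \<and> r \<ge> 0 then \<iota> (fps_nth c (nat \<lfloor>r\<rfloor>)) else 0)"
  by (simp add: embed_fps_def puiseux_of_fps.rep_eq ramified_def)

lemma comm_ring_map_embed_fps:
  assumes \<iota>: "comm_ring_map \<iota>"
  shows "comm_ring_map (embed_fps \<iota>)"
proof -
  interpret \<iota>: comm_ring_map \<iota> by fact
  have nth: "puiseux_nth (puiseux_of_fps f) = ramified 1 (fps_to_fls f)" for f :: "'b fps"
    by (simp add: puiseux_of_fps.rep_eq)
  have 1: "comm_ring_map (\<lambda>c. Abs_fps (\<lambda>n. \<iota> (fps_nth c n)))"
    by unfold_locales (auto simp: fps_eq_iff \<iota>.zero \<iota>.one \<iota>.add \<iota>.mult \<iota>.sum fps_mult_nth)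
  have 2: "comm_ring_map (puiseux_of_fps :: 'b fps \<Rightarrow> _)"
    by unfold_locales
      (simp_all add: nth puiseux_nth_one_ramified[of 1] puiseux_nth_add_ramified[OF nth nth]
        puiseux_nth_mult_ramified[OF _ nth nth] fls_times_fps_to_fls flip: puiseux_nth_inject)
  show ?thesis unfolding embed_fps_def using comm_ring_map_comp[OF 1 2] by simp
qed

lemma inj_embed_fps:
  assumes "comm_ring_map \<iota>"
  shows "inj (embed_fps \<iota>)"
proof (rule injI, rule fps_ext)
  fix c d n assume eq: "embed_fps \<iota> c = embed_fps \<iota> d"
  have "\<iota> (fps_nth c n) = \<iota> (fps_nth d n)"
    using arg_cong[OF eq, of "\<lambda>x. puiseux_nth x (of_nat n)"] by (simp add: puiseux_nth_embed_fps)
  then show "fps_nth c n = fps_nth d n" using comm_ring_map_inj[OF assms] by (simp add: inj_eq)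
qed

lemma vge_embed_fps: "vge (embed_fps \<iota> c) 0"
  by (simp add: vge_def puiseux_nth_embed_fps)

lemma fps_poly_embed_map: "fps_poly_embed \<iota> = map_poly (embed_fps \<iota>)"
proof -
  have "embed_fps \<iota> = (\<lambda>c. puiseux_of_fps (Abs_fps (\<lambda>n. \<iota> (fps_nth c n))))"
    by (rule ext) (rule embed_fps_def)
  then show ?thesis by (intro ext) (simp only: fps_poly_embed_def)
qed

lemma inj_map_poly:
  assumes "comm_ring_map h" "inj h"
  shows "inj (map_poly h)"
proof (rule injI, rule poly_eqI)
  interpret comm_ring_map h by fact
  fix p q i assume "map_poly h p = map_poly h q"
  then have "h (coeff p i) = h (coeff q i)" by (metis coeff_map)
  then show "coeff p i = coeff q i" using assms(2) by (simp add: inj_eq)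
qed

text \<open>
  The roots of \<open>g\<close> as Laurent series in \<open>X\<^bsup>1/k\<^esup>\<close> over the algebraic closure of the base field. All
  expansions over \<open>L\<close> are images of these roots, so their coefficients are algebraic over the base
  field even if \<open>L\<close> is not.
\<close>

locale puiseux_conjugates =
  fixes \<iota> :: "'k::field_char_0 \<Rightarrow> 'l::alg_closed_field"
    and g :: "'k fps poly" and k :: nat and A :: "'k alg_closure fls multiset"
  assumes emb: "comm_ring_map \<iota>" and monic: "lead_coeff g = 1" and irred: "irreducible g"
    and k: "k > 0"
    and split: "map_poly (\<lambda>c. fls_compose_power (fps_to_fls (Abs_fps (\<lambda>n. to_ac (fps_nth c n)))) k) g
      = (\<Prod>f\<in>#A. [:- f, 1:])"
begin

sublocale \<iota>: comm_ring_map \<iota> by (rule emb)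
sublocale emb: comm_ring_map "embed_fps \<iota>" by (rule comm_ring_map_embed_fps) (rule emb)

definition conjs :: "('k alg_closure fls \<Rightarrow> 'l puiseux) set" where
  "conjs = {conjugation k \<sigma> \<zeta> | \<sigma> \<zeta>. over_base \<iota> \<sigma> \<and> \<zeta> ^ k = 1}"

abbreviation \<Gamma> :: "'l puiseux set" where
  "\<Gamma> \<equiv> puiseux_expansions \<iota> g"

lemma char: "n > 0 \<Longrightarrow> of_nat n \<noteq> (0 :: 'l)"
  using comm_ring_map_inj[OF emb] \<iota>.of_nat[of n] \<iota>.zero
  by (metis injD of_nat_eq_0_iff less_irrefl)

lemma conjsE:
  assumes "\<tau> \<in> conjs"
  obtains \<sigma> \<zeta> where "over_base \<iota> \<sigma>" "\<zeta> ^ k = 1" "\<zeta> \<noteq> 0" "comm_ring_map \<sigma>" "\<tau> = conjugation k \<sigma> \<zeta>"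
    "\<forall>F r. puiseux_nth (\<tau> F) r =
      (if of_nat k * r \<in> \<int> then \<sigma> (F $$ \<lfloor>of_nat k * r\<rfloor>) * \<zeta> powi \<lfloor>of_nat k * r\<rfloor> else 0)"
proof -
  obtain \<sigma> \<zeta> where *: "over_base \<iota> \<sigma>" "\<zeta> ^ k = 1" "\<tau> = conjugation k \<sigma> \<zeta>"
    using assms by (auto simp: conjs_def)
  have hom: "comm_ring_map \<sigma>" using * over_base_def[OF emb] by blast
  show ?thesis
  proof (rule that[OF *(1,2) _ hom *(3)])
    show "\<zeta> \<noteq> 0" using *(2) k by (auto simp: power_0_left)
  qed (use * k comm_ring_map.zero[OF hom] in \<open>simp add: puiseux_nth_conjugation\<close>)
qed

lemma conjs_nonempty: "conjs \<noteq> {}"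
proof -
  obtain \<sigma> where "over_base \<iota> \<sigma>" using over_base_exists[OF emb] by blast
  then have "conjugation k \<sigma> 1 \<in> conjs" unfolding conjs_def by force
  then show ?thesis by blast
qed

lemma conjs_hom: "\<tau> \<in> conjs \<Longrightarrow> comm_ring_map \<tau>"
  using comm_ring_map_conjugation k by (metis conjsE)

lemma conjs_inj: "\<tau> \<in> conjs \<Longrightarrow> inj \<tau>"
  by (rule comm_ring_map_inj[OF conjs_hom])

lemma puiseux_nth_conj_eq_0_iff:
  assumes "\<tau> \<in> conjs"
  shows "puiseux_nth (\<tau> F) r = 0 \<longleftrightarrow> of_nat k * r \<notin> \<int> \<or> F $$ \<lfloor>of_nat k * r\<rfloor> = 0"
proof -
  obtain \<sigma> \<zeta> where *: "\<zeta> \<noteq> 0" "comm_ring_map \<sigma>" "puiseux_nth (\<tau> F) r =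
      (if of_nat k * r \<in> \<int> then \<sigma> (F $$ \<lfloor>of_nat k * r\<rfloor>) * \<zeta> powi \<lfloor>of_nat k * r\<rfloor> else 0)"
    using conjsE[OF assms] by metis
  have "\<sigma> x = 0 \<longleftrightarrow> x = 0" for x
    using comm_ring_map_inj[OF *(2)] comm_ring_map.zero[OF *(2)] by (metis injD)
  then show ?thesis using * by simp
qed

text \<open>
  On series over the base field all conjugations agree, since \<open>\<zeta>\<^sup>k = 1\<close> and \<open>\<sigma>\<close> extends \<open>\<iota>\<close>.
\<close>

lemma conj_compose_power:
  assumes "\<tau> \<in> conjs"
  shows "\<tau> (fls_compose_power (fps_to_fls (Abs_fps (\<lambda>n. to_ac (fps_nth c n)))) k) = embed_fps \<iota> c"
proof (rule puiseux_eqI)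
  fix r
  obtain \<sigma> \<zeta> where \<sigma>: "over_base \<iota> \<sigma>" "\<zeta> ^ k = 1" "\<zeta> \<noteq> 0" "comm_ring_map \<sigma>"
    and nth': "\<forall>F r. puiseux_nth (\<tau> F) r =
      (if of_nat k * r \<in> \<int> then \<sigma> (F $$ \<lfloor>of_nat k * r\<rfloor>) * \<zeta> powi \<lfloor>of_nat k * r\<rfloor> else 0)"
    by (rule conjsE[OF assms])
  note nth = nth'[rule_format]
  have to_ac: "\<sigma> (to_ac x) = \<iota> x" for x using \<sigma>(1) over_base_def[OF emb] by blast
  have zero: "\<sigma> 0 = 0" by (rule comm_ring_map.zero[OF \<sigma>(4)])
  let ?F = "fls_compose_power (fps_to_fls (Abs_fps (\<lambda>n. to_ac (fps_nth c n)))) k"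
  show "puiseux_nth (\<tau> ?F) r = puiseux_nth (embed_fps \<iota> c) r"
  proof (cases "r \<in> \<int>")
    case True
    then obtain i where r: "r = of_int i" by (elim Ints_cases)
    have kr: "of_nat k * r = of_int (int k * i)" by (simp add: r)
    have "\<zeta> powi (int k * i) = 1" using \<sigma>(2) by (simp add: power_int_mult)
    then have "puiseux_nth (\<tau> ?F) r = \<sigma> (if i < 0 then 0 else to_ac (fps_nth c (nat i)))"
      unfolding nth kr floor_of_int using k by (simp add: fls_nth_compose_power)
    then show ?thesis by (simp add: puiseux_nth_embed_fps r to_ac zero)
  next
    case False
    have "?F $$ j = 0" if "of_nat k * r = of_int j" for j
    proof -
      have "\<not> int k dvd j"
      proof
        assume "int k dvd j"
        then obtain i where "j = int k * i" by (elim dvdE)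
        then have "r = of_int i" using that k by simp
        with False show False by simp
      qed
      then show ?thesis using k by (simp add: fls_nth_compose_power)
    qed
    then have "puiseux_nth (\<tau> ?F) r = 0"
      unfolding nth by (auto simp: zero elim!: Ints_cases)
    then show ?thesis using False by (simp add: puiseux_nth_embed_fps)
  qed
qed

lemma embedded_factorization:
  assumes \<tau>: "\<tau> \<in> conjs"
  shows "fps_poly_embed \<iota> g = (\<Prod>\<gamma>\<in>#image_mset \<tau> A. [:- \<gamma>, 1:])"
proof -
  interpret \<tau>: comm_ring_map \<tau> by (rule conjs_hom) fact
  have "fps_poly_embed \<iota> g = map_poly \<tau> (map_poly
      (\<lambda>c. fls_compose_power (fps_to_fls (Abs_fps (\<lambda>n. to_ac (fps_nth c n)))) k) g)"
    by (rule poly_eqI)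
      (simp add: fps_poly_embed_map emb.coeff_map \<tau>.coeff_map coeff_map_poly conj_compose_power[OF \<tau>]
        fps_zero_def[symmetric])
  then show ?thesis
    by (simp add: split \<tau>.map_poly_prod_mset \<tau>.map_poly_linear image_mset.compositionality o_def)
qed

lemma count_conj_image: "\<tau> \<in> conjs \<Longrightarrow> count (image_mset \<tau> A) x = order x (fps_poly_embed \<iota> g)"
  by (simp only: embedded_factorization order_prod_linear_mset)

text \<open>
  Both sides are the multiset of roots of \<open>g\<close> in the field of Puiseux series, with multiplicities.
\<close>

lemma conj_image_mset: "\<tau> \<in> conjs \<Longrightarrow> \<tau>' \<in> conjs \<Longrightarrow> image_mset \<tau> A = image_mset \<tau>' A"
  by (rule multiset_eqI) (simp only: count_conj_image)

lemma expansions_eq: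
  assumes "\<tau> \<in> conjs"
  shows "\<Gamma> = \<tau> ` set_mset A"
  unfolding puiseux_expansions_def embedded_factorization[OF assms]
  by (auto simp: poly_prod_mset prod_mset_zero_iff)

lemma expansion_integral:
  assumes "\<gamma> \<in> \<Gamma>"
  shows "vge \<gamma> 0"
proof (rule root_integral)
  show "lead_coeff (fps_poly_embed \<iota> g) = 1"
    unfolding fps_poly_embed_map by (rule emb.map_poly_monic[OF monic])
  show "vge (coeff (fps_poly_embed \<iota> g) i) 0" for i
    by (simp add: fps_poly_embed_map emb.coeff_map vge_embed_fps)
  show "poly (fps_poly_embed \<iota> g) \<gamma> = 0" using assms by (simp add: puiseux_expansions_def)
qed

text \<open>
  The Galois descent of a single series. Varying \<open>\<sigma>\<close> with \<open>\<zeta> = 1\<close> shows that the coefficients come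
  from the base field, and varying \<open>\<zeta>\<close> shows that only integral exponents occur.
\<close>

lemma conj_fixed:
  assumes fixed: "\<And>\<tau>. \<tau> \<in> conjs \<Longrightarrow> \<tau> F = x" and nz: "puiseux_nth x r \<noteq> 0"
  shows "r \<in> \<int> \<and> puiseux_nth x r \<in> range \<iota>"
proof -
  have nth: "puiseux_nth x r = (if of_nat k * r \<in> \<int> then \<sigma> (F $$ \<lfloor>of_nat k * r\<rfloor>) * \<zeta> powi \<lfloor>of_nat k * r\<rfloor> else 0)"
    if "over_base \<iota> \<sigma>" "\<zeta> ^ k = 1" for \<sigma> \<zeta>
  proof -
    have "comm_ring_map \<sigma>" using that over_base_def[OF emb] by blast
    then have "\<sigma> 0 = 0" by (rule comm_ring_map.zero)
    moreover have "conjugation k \<sigma> \<zeta> F = x" using that by (intro fixed) (auto simp: conjs_def)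
    ultimately show ?thesis using puiseux_nth_conjugation[OF k] by metis
  qed
  obtain \<sigma>0 where \<sigma>0: "over_base \<iota> \<sigma>0" using over_base_exists[OF emb] by blast
  have "of_nat k * r \<in> \<int>" using nz nth[OF \<sigma>0, of 1] by (auto split: if_splits)
  then obtain n where n: "of_nat k * r = of_int n" by (elim Ints_cases)
  have nth': "puiseux_nth x r = \<sigma> (F $$ n) * \<zeta> powi n" if "over_base \<iota> \<sigma>" "\<zeta> ^ k = 1" for \<sigma> \<zeta>
    using nth[OF that] by (simp add: n)
  have x: "puiseux_nth x r = \<sigma>0 (F $$ n)" using nth'[OF \<sigma>0, of 1] by simp
  have "int k dvd n"
  proof (rule root_of_unity_exponent[OF k])
    show "\<zeta> powi n = 1" if "\<zeta> ^ k = 1" for \<zeta> :: 'l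
      using nth'[OF \<sigma>0 that] nz by (simp add: x)
  qed (rule char)
  then obtain i where "n = int k * i" by (elim dvdE)
  then have "r = of_int i" using n k by simp
  have "F $$ n \<in> range to_ac"
  proof (rule ccontr)
    assume "F $$ n \<notin> range to_ac"
    then have "\<exists>\<sigma>1 \<sigma>2. over_base \<iota> \<sigma>1 \<and> over_base \<iota> \<sigma>2 \<and> \<sigma>1 (F $$ n) \<noteq> \<sigma>2 (F $$ n)"
      by (rule over_base_separates[OF emb]) (rule char)
    then obtain \<sigma>1 \<sigma>2 where "over_base \<iota> \<sigma>1" "over_base \<iota> \<sigma>2" "\<sigma>1 (F $$ n) \<noteq> \<sigma>2 (F $$ n)"
      by blast
    then show False using nth'[of \<sigma>1 1] nth'[of \<sigma>2 1] by simp
  qed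
  then have "puiseux_nth x r \<in> range \<iota>" using \<sigma>0 over_base_def[OF emb] by (auto simp: x)
  with \<open>r = of_int i\<close> show ?thesis by simp
qed

lemma descent:
  assumes fixed: "\<And>\<tau>. \<tau> \<in> conjs \<Longrightarrow> map_poly \<tau> P = Q" and int: "\<And>i. vge (coeff Q i) 0"
  shows "\<exists>q. Q = fps_poly_embed \<iota> q"
proof -
  have ex: "\<exists>c. coeff Q i = embed_fps \<iota> c" for i
  proof -
    have fx: "\<tau> (coeff P i) = coeff Q i" if "\<tau> \<in> conjs" for \<tau>
      using fixed[OF that] comm_ring_map.coeff_map[OF conjs_hom[OF that]] by metis
    have fx': "puiseux_nth (coeff Q i) r \<noteq> 0 \<Longrightarrow> r \<in> \<int> \<and> puiseux_nth (coeff Q i) r \<in> range \<iota>" for r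
      by (rule conj_fixed[of "coeff P i"]) (rule fx)
    have "\<exists>y. puiseux_nth (coeff Q i) r = \<iota> y" for r
      using fx'[of r] \<iota>.zero by (cases "puiseux_nth (coeff Q i) r = 0") (auto intro: exI[of _ 0])
    then obtain y where y: "\<And>r. puiseux_nth (coeff Q i) r = \<iota> (y r)" by metis
    have "coeff Q i = embed_fps \<iota> (Abs_fps (\<lambda>n. y (of_nat n)))"
    proof (rule puiseux_eqI)
      fix r
      show "puiseux_nth (coeff Q i) r = puiseux_nth (embed_fps \<iota> (Abs_fps (\<lambda>n. y (of_nat n)))) r"
      proof (cases "r \<in> \<int> \<and> r \<ge> 0")
        case True
        then obtain j where "r = of_int j" "j \<ge> 0" by (auto elim!: Ints_cases)
        then have "of_nat (nat \<lfloor>r\<rfloor>) = r" by simp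
        with True show ?thesis by (simp add: puiseux_nth_embed_fps y)
      next
        case False
        then have "puiseux_nth (coeff Q i) r = 0"
          using fx'[of r] vgeD[OF int, of r] by fastforce
        moreover have "puiseux_nth (embed_fps \<iota> (Abs_fps (\<lambda>n. y (of_nat n)))) r = 0"
          unfolding puiseux_nth_embed_fps using False by (rule if_not_P)
        ultimately show ?thesis by simp
      qed
    qed
    then show ?thesis by blast
  qed
  then obtain c where c: "\<And>i. coeff Q i = embed_fps \<iota> (c i)" by metis
  have "Q = fps_poly_embed \<iota> (\<Sum>i\<le>degree Q. monom (c i) i)"
  proof (rule poly_eqI)
    fix i
    show "coeff Q i = coeff (fps_poly_embed \<iota> (\<Sum>i\<le>degree Q. monom (c i) i)) i"
      by (simp add: fps_poly_embed_map emb.coeff_map coeff_sum_monom c[symmetric] emb.zero coeff_eq_0)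
  qed
  then show ?thesis by blast
qed

text \<open>
  The only use of irreducibility. If the images of \<open>B\<close> do not depend on the conjugation, then neither
  do those of the complement of \<open>B\<close>. The two products of linear factors descend to power series over
  the base field, and their product is \<open>g\<close>, so one of them is a unit and has no roots.
\<close>

lemma conj_invariant_submultiset:
  assumes sub: "B \<subseteq># A"
    and inv: "\<And>\<tau> \<tau>'. \<tau> \<in> conjs \<Longrightarrow> \<tau>' \<in> conjs \<Longrightarrow> image_mset \<tau> B = image_mset \<tau>' B"
  shows "B = {#} \<or> B = A"
proof -
  obtain \<tau>0 where \<tau>0: "\<tau>0 \<in> conjs" using conjs_nonempty by blast
  have factor: "\<exists>q. (\<Prod>x\<in>#image_mset \<tau>0 C. [:- x, 1:]) = fps_poly_embed \<iota> q"
    if C: "C \<subseteq># A" and invC: "\<And>\<tau>. \<tau> \<in> conjs \<Longrightarrow> image_mset \<tau> C = image_mset \<tau>0 C" for C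
  proof (rule descent)
    fix \<tau> assume \<tau>: "\<tau> \<in> conjs"
    interpret \<tau>: comm_ring_map \<tau> by (rule conjs_hom) fact
    have "map_poly \<tau> (\<Prod>f\<in>#C. [:- f, 1:]) = (\<Prod>x\<in>#image_mset \<tau> C. [:- x, 1:])"
      by (simp add: \<tau>.map_poly_prod_mset \<tau>.map_poly_linear image_mset.compositionality o_def)
    then show "map_poly \<tau> (\<Prod>f\<in>#C. [:- f, 1:]) = (\<Prod>x\<in>#image_mset \<tau>0 C. [:- x, 1:])"
      by (simp only: invC[OF \<tau>])
  next
    fix i
    show "vge (coeff (\<Prod>x\<in>#image_mset \<tau>0 C. [:- x, 1:]) i) 0"
    proof (rule coeff_prod_linear_closed[where C = "\<lambda>x. vge x 0"])
      show "vge (x * y) 0" if "vge x 0" "vge y 0" for x y :: "'l puiseux"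
        using vge_mult[OF that] by simp
      fix x assume "x \<in># image_mset \<tau>0 C"
      then have "x \<in> \<Gamma>" using C by (auto simp: expansions_eq[OF \<tau>0] dest: mset_subset_eqD)
      then show "vge (- x) 0" by (intro vge_uminus expansion_integral)
    qed (simp_all add: vge_1 vge_add)
  qed
  obtain p where p: "(\<Prod>x\<in>#image_mset \<tau>0 B. [:- x, 1:]) = fps_poly_embed \<iota> p"
    using factor[OF sub inv[OF _ \<tau>0]] by blast
  have "image_mset \<tau> (A - B) = image_mset \<tau>0 (A - B)" if "\<tau> \<in> conjs" for \<tau>
    using sub inv[OF that \<tau>0] conj_image_mset[OF that \<tau>0] by (simp add: image_mset_Diff)
  then obtain q where q: "(\<Prod>x\<in>#image_mset \<tau>0 (A - B). [:- x, 1:]) = fps_poly_embed \<iota> q"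
    using factor[of "A - B"] by auto
  have "image_mset \<tau>0 A = image_mset \<tau>0 B + image_mset \<tau>0 (A - B)"
    using sub by (simp add: image_mset_Diff image_mset_subseteq_mono)
  then have "fps_poly_embed \<iota> g = fps_poly_embed \<iota> p * fps_poly_embed \<iota> q"
    by (simp only: embedded_factorization[OF \<tau>0] image_mset_union prod_mset_Un p q)
  then have "fps_poly_embed \<iota> g = fps_poly_embed \<iota> (p * q)"
    by (simp add: fps_poly_embed_map emb.map_poly_mult)
  then have "g = p * q"
    using inj_map_poly[OF emb.comm_ring_map_axioms inj_embed_fps[OF emb]]
    by (simp add: fps_poly_embed_map inj_eq)
  have unit: "C = {#}" if "is_unit r" "(\<Prod>x\<in>#image_mset \<tau>0 C. [:- x, 1:]) = fps_poly_embed \<iota> r" for r C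
  proof -
    obtain s where "1 = r * s" using \<open>is_unit r\<close> by (elim dvdE)
    then have "1 = fps_poly_embed \<iota> r * fps_poly_embed \<iota> s"
      by (metis fps_poly_embed_map emb.map_poly_mult emb.one map_poly_1')
    then have "is_unit (fps_poly_embed \<iota> r)" by (rule dvdI)
    then have "degree (fps_poly_embed \<iota> r) = 0" by (metis is_unit_iff_degree not_is_unit_0)
    then show ?thesis using degree_prod_linear_mset[of "image_mset \<tau>0 C"] that(2) by simp
  qed
  have "is_unit p \<or> is_unit q" using irred \<open>g = p * q\<close> by (simp add: irreducible_def)
  then show ?thesis
  proof
    assume "is_unit q"
    then have "A - B = {#}" using unit q by blast
    then have "A \<subseteq># B" by (simp add: Diff_eq_empty_iff_mset)
    then show ?thesis using sub by (simp add: subset_mset.antisym)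
  qed (use unit p in blast)
qed

lemma expansions_nonempty: "\<Gamma> \<noteq> {}"
proof
  assume *: "\<Gamma> = {}"
  obtain \<tau> where \<tau>: "\<tau> \<in> conjs" using conjs_nonempty by blast
  have "A = {#}" using * by (simp add: expansions_eq[OF \<tau>])
  then have "fps_poly_embed \<iota> g = fps_poly_embed \<iota> 1"
    by (simp add: embedded_factorization[OF \<tau>]) (simp add: fps_poly_embed_map emb.one)
  then have "g = 1"
    using inj_map_poly[OF emb.comm_ring_map_axioms inj_embed_fps[OF emb]]
    by (simp add: fps_poly_embed_map inj_eq)
  with irred show False by simp
qed

text \<open>
  The set of distinct roots is invariant under conjugation and not empty, so it contains every root
  with its full multiplicity. This replaces the usual argument with the derivative.
\<close>

lemma roots_simple: "A = mset_set (set_mset A)"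
proof -
  let ?B = "mset_set (set_mset A)"
  have "image_mset \<tau> ?B = mset_set \<Gamma>" if "\<tau> \<in> conjs" for \<tau>
    using conjs_inj[OF that] by (simp add: image_mset_mset_set inj_on_subset expansions_eq[OF that])
  then have "?B = {#} \<or> ?B = A"
    by (intro conj_invariant_submultiset) (auto simp: mset_set_set_mset_msubset)
  moreover have "set_mset A \<noteq> {}"
  proof
    assume "set_mset A = {}"
    moreover obtain \<tau> where "\<tau> \<in> conjs" using conjs_nonempty by blast
    ultimately show False using expansions_nonempty by (simp add: expansions_eq)
  qed
  then have "?B \<noteq> {#}" by (simp add: mset_set_empty_iff)
  ultimately show ?thesis by simp
qed

lemma finite_expansions: "finite \<Gamma>"
  using conjs_nonempty expansions_eq by auto

lemma card_expansions: "card \<Gamma> = degree g"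
proof -
  obtain \<tau> where \<tau>: "\<tau> \<in> conjs" using conjs_nonempty by blast
  have "degree g = degree (fps_poly_embed \<iota> g)"
    unfolding fps_poly_embed_map by (rule sym, rule emb.map_poly_monic[OF monic])
  also have "\<dots> = size A"
    by (simp only: embedded_factorization[OF \<tau>] degree_prod_linear_mset size_image_mset)
  also have "\<dots> = card (set_mset A)" by (subst roots_simple) simp
  also have "\<dots> = card \<Gamma>"
    by (simp add: expansions_eq[OF \<tau>] card_image inj_on_subset[OF conjs_inj[OF \<tau>]])
  finally show ?thesis by simp
qed

text \<open>
  The expansions of \<open>g\<close> are indistinguishable by invariants that a conjugation does not change. Here
  \<open>w\<close> expresses the invariant \<open>v\<close> of a conjugate in terms of the root alone.
\<close>

lemma constant_on_expansions:
  assumes v: "\<And>\<tau> f. \<tau> \<in> conjs \<Longrightarrow> f \<in># A \<Longrightarrow> v (\<tau> f) = w f" and "\<gamma> \<in> \<Gamma>" "\<gamma>' \<in> \<Gamma>"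
  shows "v \<gamma> = v \<gamma>'"
proof -
  define B where "B = filter_mset (\<lambda>f. w f = v \<gamma>) A"
  obtain \<tau> where \<tau>: "\<tau> \<in> conjs" using conjs_nonempty by blast
  have img: "image_mset \<tau> B = filter_mset (\<lambda>x. v x = v \<gamma>) (image_mset \<tau> A)" if "\<tau> \<in> conjs" for \<tau>
    unfolding B_def filter_mset_image_mset
    by (rule arg_cong[where f = "image_mset \<tau>"], rule filter_mset_cong) (use v that in auto)
  have "B = {#} \<or> B = A"
  proof (rule conj_invariant_submultiset)
    show "image_mset \<tau>1 B = image_mset \<tau>2 B" if "\<tau>1 \<in> conjs" "\<tau>2 \<in> conjs" for \<tau>1 \<tau>2
      by (simp only: img that conj_image_mset[OF that])
  qed (simp add: B_def)
  moreover obtain f where "f \<in># A" "\<gamma> = \<tau> f" using \<open>\<gamma> \<in> \<Gamma>\<close> by (auto simp: expansions_eq[OF \<tau>])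
  then have "f \<in># B" using v[OF \<tau>] by (simp add: B_def)
  ultimately have "B = A" by auto
  obtain f' where "f' \<in># A" "\<gamma>' = \<tau> f'" using \<open>\<gamma>' \<in> \<Gamma>\<close> by (auto simp: expansions_eq[OF \<tau>])
  then have "f' \<in># B" by (simp only: \<open>B = A\<close>)
  then have "w f' = v \<gamma>" by (simp add: B_def)
  then show ?thesis using v[OF \<tau> \<open>f' \<in># A\<close>] \<open>\<gamma>' = \<tau> f'\<close> by simp
qed

lemma expansion_exponents: "\<gamma> \<in> \<Gamma> \<Longrightarrow> puiseux_nth \<gamma> r \<noteq> 0 \<Longrightarrow> of_nat k * r \<in> \<int>"
proof -
  assume *: "\<gamma> \<in> \<Gamma>" "puiseux_nth \<gamma> r \<noteq> 0"
  obtain \<tau> where \<tau>: "\<tau> \<in> conjs" using conjs_nonempty by blast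
  then obtain f where "\<gamma> = \<tau> f" using * by (auto simp: expansions_eq)
  then show ?thesis using *(2) puiseux_nth_conj_eq_0_iff[OF \<tau>] by blast
qed

lemma expansion_support:
  assumes "\<gamma> \<in> \<Gamma>" "\<gamma>' \<in> \<Gamma>"
  shows "puiseux_nth \<gamma> r = 0 \<longleftrightarrow> puiseux_nth \<gamma>' r = 0"
proof (rule constant_on_expansions[where v = "\<lambda>x. puiseux_nth x r = 0" and
      w = "\<lambda>f. of_nat k * r \<notin> \<int> \<or> f $$ \<lfloor>of_nat k * r\<rfloor> = 0", OF _ assms])
qed (rule puiseux_nth_conj_eq_0_iff)

definition fls_trunc :: "rat \<Rightarrow> 'k alg_closure fls \<Rightarrow> 'k alg_closure fls" where
  "fls_trunc t F = Abs_fls (\<lambda>n. if of_int n < of_nat k * t then F $$ n else 0)"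

lemma conj_trunc:
  assumes "\<tau> \<in> conjs"
  shows "\<tau> (fls_trunc t F) = trunc_less t (\<tau> F)"
proof (rule puiseux_eqI)
  fix r
  obtain \<sigma> \<zeta> where "over_base \<iota> \<sigma>" "\<zeta> ^ k = 1" "\<zeta> \<noteq> 0" "comm_ring_map \<sigma>"
      "\<tau> = conjugation k \<sigma> \<zeta>"
    and nth': "\<forall>F r. puiseux_nth (\<tau> F) r =
      (if of_nat k * r \<in> \<int> then \<sigma> (F $$ \<lfloor>of_nat k * r\<rfloor>) * \<zeta> powi \<lfloor>of_nat k * r\<rfloor> else 0)"
    by (rule conjsE[OF assms])
  note nth = nth'[rule_format]
  have zero: "\<sigma> 0 = 0" by (rule comm_ring_map.zero) fact
  have T: "fls_trunc t F $$ n = (if of_int n < of_nat k * t then F $$ n else 0)" for n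
    unfolding fls_trunc_def by (rule nth_Abs_fls_lower_bound[of "fls_subdegree F"]) simp
  show "puiseux_nth (\<tau> (fls_trunc t F)) r = puiseux_nth (trunc_less t (\<tau> F)) r"
  proof (cases "of_nat k * r \<in> \<int>")
    case True
    then obtain n where n: "of_nat k * r = of_int n" by (elim Ints_cases)
    have "of_int n < of_nat k * t \<longleftrightarrow> r < t" using k by (simp flip: n)
    then show ?thesis unfolding nth puiseux_nth_trunc_less n by (simp add: T zero)
  qed (simp add: nth puiseux_nth_trunc_less)
qed

lemma conj_trunc_image: "\<tau> \<in> conjs \<Longrightarrow> \<tau> ` fls_trunc t ` S = trunc_less t ` \<tau> ` S"
  by (simp add: image_image conj_trunc)

text \<open>
  Homogeneity of the tree of truncations: each node at level \<open>t\<close> has the same number of descendants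
  at level \<open>s\<close>.
\<close>

lemma class_size_constant:
  assumes "\<gamma> \<in> \<Gamma>" "\<gamma>' \<in> \<Gamma>"
  shows "card (trunc_less s ` {x \<in> \<Gamma>. trunc_less t x = trunc_less t \<gamma>}) =
    card (trunc_less s ` {x \<in> \<Gamma>. trunc_less t x = trunc_less t \<gamma>'})"
proof (rule constant_on_expansions[where v = "\<lambda>\<gamma>. card (trunc_less s ` {x \<in> \<Gamma>. trunc_less t x = trunc_less t \<gamma>})"
      and w = "\<lambda>f. card (fls_trunc s ` {x \<in> set_mset A. fls_trunc t x = fls_trunc t f})", OF _ assms])
  fix \<tau> f assume \<tau>: "\<tau> \<in> conjs" "f \<in># A"
  have inj: "inj_on \<tau> S" for S using conjs_inj[OF \<tau>(1)] by (rule inj_on_subset) simp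
  have "{x \<in> \<Gamma>. trunc_less t x = trunc_less t (\<tau> f)} = \<tau> ` {x \<in> set_mset A. fls_trunc t x = fls_trunc t f}"
    using conjs_inj[OF \<tau>(1)] by (auto simp: expansions_eq[OF \<tau>(1)] inj_eq simp flip: conj_trunc[OF \<tau>(1)])
  then show "card (trunc_less s ` {x \<in> \<Gamma>. trunc_less t x = trunc_less t (\<tau> f)}) =
    card (fls_trunc s ` {x \<in> set_mset A. fls_trunc t x = fls_trunc t f})"
    by (simp add: card_image[OF inj] flip: conj_trunc_image[OF \<tau>(1)])
qed

lemma conj_trunc_poly:
  assumes \<tau>: "\<tau> \<in> conjs"
  shows "map_poly \<tau> (\<Prod>f\<in>fls_trunc t ` set_mset A. [:- f, 1:]) = (\<Prod>\<rho>\<in>trunc_less t ` \<Gamma>. [:- \<rho>, 1:])"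
proof -
  interpret \<tau>: comm_ring_map \<tau> by (rule conjs_hom) fact
  have inj: "inj_on \<tau> S" for S using conjs_inj[OF \<tau>] by (rule inj_on_subset) simp
  have "trunc_less t ` \<Gamma> = \<tau> ` fls_trunc t ` set_mset A"
    by (simp add: expansions_eq[OF \<tau>] conj_trunc_image[OF \<tau>])
  then have "(\<Prod>\<rho>\<in>trunc_less t ` \<Gamma>. [:- \<rho>, 1:]) = (\<Prod>f\<in>fls_trunc t ` set_mset A. [:- \<tau> f, 1:])"
    by (simp only: prod.reindex[OF inj] o_def)
  then show ?thesis
    by (simp only: \<tau>.map_poly_prod \<tau>.map_poly_linear)
qed

lemma pord_trunc_poly_constant:
  assumes "\<gamma> \<in> \<Gamma>" "\<gamma>' \<in> \<Gamma>"
  shows "pord (poly (\<Prod>\<rho>\<in>trunc_less t ` \<Gamma>. [:- \<rho>, 1:]) \<gamma>) =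
    pord (poly (\<Prod>\<rho>\<in>trunc_less t ` \<Gamma>. [:- \<rho>, 1:]) \<gamma>')"
proof -
  let ?P = "\<Prod>f\<in>fls_trunc t ` set_mset A. [:- f, 1:]"
  show ?thesis
  proof (rule constant_on_expansions[where v = "\<lambda>\<gamma>. pord (poly (\<Prod>\<rho>\<in>trunc_less t ` \<Gamma>. [:- \<rho>, 1:]) \<gamma>)"
      and w = "\<lambda>f. LEAST r. \<not> (of_nat k * r \<notin> \<int> \<or> poly ?P f $$ \<lfloor>of_nat k * r\<rfloor> = 0)", OF _ assms])
    fix \<tau> f assume \<tau>: "\<tau> \<in> conjs" "f \<in># A"
    have "poly (\<Prod>\<rho>\<in>trunc_less t ` \<Gamma>. [:- \<rho>, 1:]) (\<tau> f) = \<tau> (poly ?P f)"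
      using comm_ring_map.poly_map[OF conjs_hom[OF \<tau>(1)]] by (simp only: flip: conj_trunc_poly[OF \<tau>(1)])
    then show "pord (poly (\<Prod>\<rho>\<in>trunc_less t ` \<Gamma>. [:- \<rho>, 1:]) (\<tau> f)) =
      (LEAST r. \<not> (of_nat k * r \<notin> \<int> \<or> poly ?P f $$ \<lfloor>of_nat k * r\<rfloor> = 0))"
      by (simp only: pord_def puiseux_nth_conj_eq_0_iff[OF \<tau>(1)])
  qed
qed

end

section \<open>An upper bound by divided differences\<close>

text \<open>
  By Lagrange interpolation, the sum is the coefficient of degree \<open>deg q\<close> of the interpolation
  polynomial of \<open>q\<close> at \<open>deg q + 1\<close> points, which is \<open>q\<close> itself.
\<close>

lemma divided_difference_monic:
  fixes q :: "'a::field poly"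
  assumes S: "finite S" "card S = Suc (degree q)" and q: "lead_coeff q = 1"
  shows "(\<Sum>x\<in>S. poly q x / (\<Prod>y\<in>S - {x}. x - y)) = 1"
proof -
  define c where "c x = poly q x / (\<Prod>y\<in>S - {x}. x - y)" for x
  define b where "b x = (\<Prod>y\<in>S - {x}. [:- y, 1:])" for x
  have deg: "degree (b x) = degree q" and lc: "coeff (b x) (degree q) = 1" if "x \<in> S" for x
  proof -
    have "lead_coeff (b x) = 1" by (simp add: b_def lead_coeff_prod)
    moreover show "degree (b x) = degree q"
      using that S by (simp add: b_def degree_prod_eq_sum_degree)
    ultimately show "coeff (b x) (degree q) = 1" by simp
  qed
  have eval: "poly (b x) y = (if y = x then (\<Prod>y\<in>S - {x}. x - y) else 0)" if "x \<in> S" "y \<in> S" for x y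
    using that S by (auto simp: b_def poly_prod intro!: prod_zero bexI[of _ y])
  define L where "L = (\<Sum>x\<in>S. smult (c x) (b x))"
  have "poly L y = poly q y" if "y \<in> S" for y
  proof -
    have "poly L y = (\<Sum>x\<in>S. if x = y then c x * (\<Prod>y\<in>S - {x}. x - y) else 0)"
      unfolding L_def by (simp add: poly_sum eval that cong: sum.cong if_cong) (rule sum.cong, auto)
    also have "\<dots> = c y * (\<Prod>z\<in>S - {y}. y - z)" using that S by simp
    also have "\<dots> = poly q y" using S by (simp add: c_def)
    finally show ?thesis .
  qed
  then have roots: "S \<subseteq> {x. poly (L - q) x = 0}" by auto
  have "degree L \<le> degree q"
    unfolding L_def using deg by (intro degree_sum_le S(1)) (metis degree_smult_le)
  then have "degree (L - q) \<le> degree q" by (intro degree_diff_le) auto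
  have "L - q = 0"
  proof (rule ccontr)
    assume nz: "L - q \<noteq> 0"
    have "card S \<le> card {x. poly (L - q) x = 0}"
      by (rule card_mono[OF poly_roots_finite[OF nz] roots])
    also have "\<dots> \<le> degree (L - q)" by (rule card_poly_roots_bound[OF nz])
    finally show False using S(2) \<open>degree (L - q) \<le> degree q\<close> by simp
  qed
  then have "coeff L (degree q) = 1" using q by simp
  then show ?thesis using lc by (simp add: L_def coeff_sum c_def)
qed

text \<open>
  If \<open>q\<close> had a larger value at every point of \<open>S\<close>, all terms of the divided difference would have
  positive order, but their sum \<open>1\<close> has order zero.
\<close>

lemma monic_value_bound:
  fixes q :: "'l::field puiseux poly"
  assumes S: "finite S" "card S = Suc (degree q)" and q: "lead_coeff q = 1"
  shows "\<exists>x\<in>S. puiseux_val (poly q x) \<le> Fin (\<Sum>y\<in>S - {x}. pord (x - y))"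
proof (rule ccontr)
  assume contr: "\<not> ?thesis"
  have "puiseux_nth (poly q x / (\<Prod>y\<in>S - {x}. x - y)) 0 = 0" if x: "x \<in> S" for x
  proof (cases "poly q x = 0")
    case False
    let ?d = "\<Prod>y\<in>S - {x}. x - y"
    have d: "?d \<noteq> 0" using S(1) by auto
    have pd: "pord ?d = (\<Sum>y\<in>S - {x}. pord (x - y))" by (rule pord_prod) auto
    have "pord (poly q x) = pord (poly q x / ?d) + pord ?d"
      using pord_mult[of "poly q x / ?d" ?d] d False by simp
    moreover have "pord ?d < pord (poly q x)"
      using contr x False by (auto simp: puiseux_val_pord pd not_le)
    ultimately have "0 < pord (poly q x / ?d)" by simp
    then show ?thesis using vge_pord[of "poly q x / ?d"] d False by (intro vgeD) auto
  qed simp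
  then have "puiseux_nth (\<Sum>x\<in>S. poly q x / (\<Prod>y\<in>S - {x}. x - y)) 0 = 0"
    by (simp add: puiseux_nth_sum)
  then show False by (simp add: divided_difference_monic[OF S q] puiseux_nth_1)
qed

section \<open>The tree of truncated expansions\<close>

lemma trunc_less_neq_iff: "trunc_less s x \<noteq> trunc_less s y \<longleftrightarrow> x \<noteq> y \<and> pord (x - y) < s"
proof (cases "x = y")
  case False
  then have "s \<le> pord (x - y) \<longleftrightarrow> vge (x - y) s" by (intro pord_ge_iff) simp
  then show ?thesis using False by (auto simp: trunc_less_eq_iff)
qed simp

lemma trunc_less_trunc_less: "t \<le> s \<Longrightarrow> trunc_less t (trunc_less s x) = trunc_less t x"
  by (rule puiseux_eqI) (simp add: puiseux_nth_trunc_less)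

lemma puiseux_nth_eq_below_pord: "x \<noteq> y \<Longrightarrow> r < pord (x - y) \<Longrightarrow> puiseux_nth x r = puiseux_nth y r"
  using vgeD[OF vge_pord[of "x - y"]] by simp

lemma puiseux_nth_neq_at_pord: "x \<noteq> y \<Longrightarrow> puiseux_nth x (pord (x - y)) \<noteq> puiseux_nth y (pord (x - y))"
  using puiseux_nth_pord[of "x - y"] by simp

lemma pord_diff_trunc_other:
  assumes "trunc_less t x \<noteq> trunc_less t y"
  shows "pord (x - trunc_less t y) = pord (x - y)"
proof (rule pord_eqI)
  have *: "x \<noteq> y" "pord (x - y) < t" using assms by (simp_all add: trunc_less_neq_iff)
  then show "puiseux_nth (x - trunc_less t y) (pord (x - y)) \<noteq> 0"
    using puiseux_nth_neq_at_pord[of x y] by (simp add: puiseux_nth_trunc_less)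
  show "vge (x - trunc_less t y) (pord (x - y))"
    using * puiseux_nth_eq_below_pord[of x y] by (auto simp: vge_def puiseux_nth_trunc_less)
qed

lemma pord_diff_trunc_same:
  assumes "trunc_less t x = trunc_less t y" "puiseux_nth x t \<noteq> 0"
  shows "pord (x - trunc_less t y) = t"
  unfolding assms(1)[symmetric] using assms(2)
  by (intro pord_eqI) (auto simp: vge_def puiseux_nth_trunc_less)

text \<open>
  The properties of the set of expansions that the analysis of the algorithm depends on. A node of
  the tree at level \<open>t\<close> is a truncation below \<open>t\<close>, and the polynomials \<open>\<Prod>(Y - \<rho>)\<close> over all nodes of a
  level are the factors from which the algorithm builds its result. The parameter \<open>rational\<close> is an
  abstract form of membership in \<open>K[X][Y]\<close>.
\<close>

locale expansion_tree =
  fixes \<Gamma> :: "'l::field puiseux set" and k :: nat and rational :: "'l puiseux poly \<Rightarrow> bool"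
  assumes fin: "finite \<Gamma>" and k: "k > 0"
    and integral: "\<gamma> \<in> \<Gamma> \<Longrightarrow> vge \<gamma> 0"
    and exponents: "\<gamma> \<in> \<Gamma> \<Longrightarrow> puiseux_nth \<gamma> r \<noteq> 0 \<Longrightarrow> of_nat k * r \<in> \<int>"
    and support: "\<gamma> \<in> \<Gamma> \<Longrightarrow> \<gamma>' \<in> \<Gamma> \<Longrightarrow> puiseux_nth \<gamma> r = 0 \<longleftrightarrow> puiseux_nth \<gamma>' r = 0"
    and class_size: "\<gamma> \<in> \<Gamma> \<Longrightarrow> \<gamma>' \<in> \<Gamma> \<Longrightarrow>
      card (trunc_less s ` {x \<in> \<Gamma>. trunc_less t x = trunc_less t \<gamma>}) =
      card (trunc_less s ` {x \<in> \<Gamma>. trunc_less t x = trunc_less t \<gamma>'})"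
    and pord_node: "\<gamma> \<in> \<Gamma> \<Longrightarrow> \<gamma>' \<in> \<Gamma> \<Longrightarrow>
      pord (poly (\<Prod>\<rho>\<in>trunc_less t ` \<Gamma>. [:- \<rho>, 1:]) \<gamma>) =
      pord (poly (\<Prod>\<rho>\<in>trunc_less t ` \<Gamma>. [:- \<rho>, 1:]) \<gamma>')"
    and rational_1: "rational 1"
    and rational_mult: "rational p \<Longrightarrow> rational q \<Longrightarrow> rational (p * q)"
    and rational_node: "rational (\<Prod>\<rho>\<in>trunc_less t ` \<Gamma>. [:- \<rho>, 1:])"
begin

text \<open>
  The exponent computed in the first step of the algorithm is the largest order of contact \<open>t\<close> between
  expansions that are distinct below \<open>s\<close>. At this exponent two expansions have different
  coefficients, so one of the coefficients is not zero, and then none is, because all expansions have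
  the same support.
\<close>

lemma top_exponent:
  assumes "1 < card (trunc_less s ` \<Gamma>)"
  obtains t where "t < s" "max_extended_char_exponent (trunc_less s ` \<Gamma>) = t"
    "\<And>\<gamma> \<gamma>'. \<gamma> \<in> \<Gamma> \<Longrightarrow> \<gamma>' \<in> \<Gamma> \<Longrightarrow> trunc_less s \<gamma> \<noteq> trunc_less s \<gamma>' \<Longrightarrow> pord (\<gamma> - \<gamma>') \<le> t"
    "\<exists>\<gamma>1\<in>\<Gamma>. \<exists>\<gamma>2\<in>\<Gamma>. trunc_less s \<gamma>1 \<noteq> trunc_less s \<gamma>2 \<and> trunc_less t \<gamma>1 = trunc_less t \<gamma>2"
    "\<And>\<gamma>. \<gamma> \<in> \<Gamma> \<Longrightarrow> puiseux_nth \<gamma> t \<noteq> 0"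
proof -
  define D where "D = {(\<gamma>, \<gamma>') \<in> \<Gamma> \<times> \<Gamma>. trunc_less s \<gamma> \<noteq> trunc_less s \<gamma>'}"
  define t where "t = Max ((\<lambda>(\<gamma>, \<gamma>'). pord (\<gamma> - \<gamma>')) ` D)"
  have "D \<subseteq> \<Gamma> \<times> \<Gamma>" unfolding D_def by blast
  then have finD: "finite D" by (rule finite_subset) (rule finite_cartesian_product[OF fin fin])
  have "\<exists>\<gamma>\<in>\<Gamma>. \<exists>\<gamma>'\<in>\<Gamma>. trunc_less s \<gamma> \<noteq> trunc_less s \<gamma>'"
  proof (rule ccontr)
    assume "\<not> ?thesis"
    then have "\<forall>x\<in>trunc_less s ` \<Gamma>. \<forall>y\<in>trunc_less s ` \<Gamma>. x = y" by blast
    then have "card (trunc_less s ` \<Gamma>) \<le> Suc 0"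
      using card_le_Suc0_iff_eq[OF finite_imageI[OF fin]] by blast
    with assms show False by simp
  qed
  then have "D \<noteq> {}" unfolding D_def by blast
  have le: "pord (\<gamma> - \<gamma>') \<le> t" if "\<gamma> \<in> \<Gamma>" "\<gamma>' \<in> \<Gamma>" "trunc_less s \<gamma> \<noteq> trunc_less s \<gamma>'" for \<gamma> \<gamma>'
    unfolding t_def using that finD by (intro Max_ge) (auto simp: D_def)
  have "t \<in> (\<lambda>(\<gamma>, \<gamma>'). pord (\<gamma> - \<gamma>')) ` D"
    unfolding t_def using finD \<open>D \<noteq> {}\<close> by (intro Max_in) auto
  then obtain \<gamma>1 \<gamma>2 where 12: "\<gamma>1 \<in> \<Gamma>" "\<gamma>2 \<in> \<Gamma>" "trunc_less s \<gamma>1 \<noteq> trunc_less s \<gamma>2" "t = pord (\<gamma>1 - \<gamma>2)"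
    by (auto simp: D_def)
  have ne: "\<gamma>1 \<noteq> \<gamma>2" and "t < s" using 12(3,4) by (simp_all add: trunc_less_neq_iff)
  have "t \<ge> 0"
    using ne 12 pord_ge_iff[of "\<gamma>1 - \<gamma>2" 0] vge_diff[OF integral integral] by simp
  have same: "trunc_less t \<gamma>1 = trunc_less t \<gamma>2"
    using trunc_less_neq_iff[of t \<gamma>1 \<gamma>2] 12(4) by auto
  have "max_extended_char_exponent (trunc_less s ` \<Gamma>) = t"
    unfolding max_extended_char_exponent_def
  proof (rule Least_equality)
    have "inj_on (trunc_le t) (trunc_less s ` \<Gamma>)"
    proof (rule inj_onI, rule ccontr)
      fix x y assume *: "x \<in> trunc_less s ` \<Gamma>" "y \<in> trunc_less s ` \<Gamma>" "trunc_le t x = trunc_le t y" "x \<noteq> y"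
      then obtain \<gamma> \<gamma>' where g: "\<gamma> \<in> \<Gamma>" "\<gamma>' \<in> \<Gamma>" "x = trunc_less s \<gamma>" "y = trunc_less s \<gamma>'" by blast
      let ?v = "pord (\<gamma> - \<gamma>')"
      have neq: "trunc_less s \<gamma> \<noteq> trunc_less s \<gamma>'" using *(4) g(3,4) by simp
      then have v: "\<gamma> \<noteq> \<gamma>'" "?v < s" by (simp_all add: trunc_less_neq_iff)
      have "?v \<le> t" by (rule le[OF g(1,2) neq])
      then have "puiseux_nth x ?v = puiseux_nth y ?v" using *(3) by (simp add: trunc_le_eq_iff)
      then show False using v puiseux_nth_neq_at_pord[of \<gamma> \<gamma>'] by (simp add: g puiseux_nth_trunc_less)
    qed
    then show "0 \<le> t \<and> inj_on (trunc_le t) (trunc_less s ` \<Gamma>)" using \<open>t \<ge> 0\<close> by simp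
    fix y assume y: "0 \<le> y \<and> inj_on (trunc_le y) (trunc_less s ` \<Gamma>)"
    show "t \<le> y"
    proof (rule ccontr)
      assume "\<not> t \<le> y"
      then have "trunc_le y (trunc_less s \<gamma>1) = trunc_le y (trunc_less s \<gamma>2)"
        using puiseux_nth_eq_below_pord[OF ne] by (auto simp: trunc_le_eq_iff puiseux_nth_trunc_less 12(4))
      then have "trunc_less s \<gamma>1 = trunc_less s \<gamma>2"
        using y 12(1,2) by (meson imageI inj_onD)
      with 12(3) show False by simp
    qed
  qed
  moreover have "puiseux_nth \<gamma> t \<noteq> 0" if "\<gamma> \<in> \<Gamma>" for \<gamma>
    using puiseux_nth_neq_at_pord[OF ne] support[OF that 12(1)] support[OF that 12(2)]
    by (auto simp: 12(4))
  ultimately show ?thesis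
    by (intro that[of t] \<open>t < s\<close> le bexI[of _ \<gamma>1] bexI[of _ \<gamma>2] conjI 12(1-3) same)
qed

text \<open>
  Let \<open>x0\<close> be the element of \<open>S\<close> whose truncation is closest to \<open>\<gamma>\<close>. By the ultrametric inequality every
  other truncation is at least as close to \<open>x0\<close> as to \<open>\<gamma>\<close>, so the sum without \<open>x0\<close> is bounded by the sum
  at \<open>x0\<close>. The remaining term is at most \<open>t\<close>, as truncations below \<open>t\<close> lose the term of \<open>\<gamma>\<close> at \<open>t\<close>.
\<close>

lemma sum_pord_trunc_le:
  assumes \<gamma>: "\<gamma> \<in> \<Gamma>" "puiseux_nth \<gamma> t \<noteq> 0"
    and S: "S \<subseteq> \<Gamma>" "S \<noteq> {}" "inj_on (trunc_less t) S"
    and sum: "\<And>x. x \<in> S \<Longrightarrow> (\<Sum>y\<in>S - {x}. pord (x - y)) \<le> w"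
  shows "(\<Sum>\<rho>\<in>trunc_less t ` S. pord (\<gamma> - \<rho>)) \<le> t + w"
proof -
  have finS: "finite S" using S(1) fin by (rule finite_subset)
  define f where "f x = pord (\<gamma> - trunc_less t x)" for x
  have nth: "puiseux_nth (\<gamma> - trunc_less t x) t \<noteq> 0" for x
    using \<gamma>(2) by (simp add: puiseux_nth_trunc_less)
  then have nz: "\<gamma> - trunc_less t x \<noteq> 0" for x
    using puiseux_nth_0 by metis
  have ft: "f x \<le> t" for x
    using vgeD[OF vge_pord[OF nz[of x]], of t] nth[of x] by (force simp: f_def not_le[symmetric])
  have "Max (f ` S) \<in> f ` S" using finS S(2) by (intro Max_in) auto
  then obtain x0 where x0: "x0 \<in> S" "f x0 = Max (f ` S)" by auto
  have max: "f y \<le> f x0" if "y \<in> S" for y using x0(2) that finS by simp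
  have "f y \<le> pord (x0 - y)" if y: "y \<in> S - {x0}" for y
  proof -
    have "vge (\<gamma> - trunc_less t y) (f y)" using vge_pord[OF nz[of y]] by (simp add: f_def)
    moreover have "vge (\<gamma> - trunc_less t x0) (f y)"
      using vge_mono[OF vge_pord[OF nz[of x0]]] max[of y] y by (simp add: f_def)
    ultimately have "vge ((\<gamma> - trunc_less t y) - (\<gamma> - trunc_less t x0)) (f y)" by (rule vge_diff)
    then have "vge (x0 - y) (f y)"
      using ft[of y] by (auto simp: vge_def puiseux_nth_trunc_less)
    moreover have "x0 - y \<noteq> 0" using y by auto
    ultimately show ?thesis by (simp add: pord_ge_iff)
  qed
  then have "(\<Sum>y\<in>S - {x0}. f y) \<le> (\<Sum>y\<in>S - {x0}. pord (x0 - y))" by (rule sum_mono)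
  also have "\<dots> \<le> w" by (rule sum[OF x0(1)])
  finally have "(\<Sum>y\<in>S - {x0}. f y) \<le> w" .
  moreover have "(\<Sum>y\<in>S. f y) = f x0 + (\<Sum>y\<in>S - {x0}. f y)"
    by (rule sum.remove[OF finS x0(1)])
  moreover have "(\<Sum>\<rho>\<in>trunc_less t ` S. pord (\<gamma> - \<rho>)) = (\<Sum>y\<in>S. f y)"
    by (simp add: sum.reindex[OF S(3)] f_def)
  ultimately show ?thesis using ft[of x0] by linarith
qed

text \<open>
  The set that certifies optimality is built along the recursion of the algorithm: \<open>u\<close> elements are
  taken from every class at level \<open>t\<close>, and one more from each class that meets the set \<open>S'\<close> found for the
  remainder. Homogeneity ensures that the classes are large enough. Elements of the class of \<open>x\<close> are at
  order \<open>t\<close> from \<open>x\<close>, which is also the order of the difference of \<open>x\<close> and its own node; for the other classes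
  the order depends only on the node. So the sum at \<open>x\<close> is \<open>u wp\<close>, plus the sum over the nodes of \<open>S'\<close>,
  minus one \<open>t\<close> because \<open>x\<close> itself is left out, and the preceding lemma applies.
\<close>

lemma spread_extension:
  assumes "t < s"
    and sep: "\<And>\<gamma> \<gamma>'. \<gamma> \<in> \<Gamma> \<Longrightarrow> \<gamma>' \<in> \<Gamma> \<Longrightarrow> trunc_less s \<gamma> \<noteq> trunc_less s \<gamma>' \<Longrightarrow> pord (\<gamma> - \<gamma>') \<le> t"
    and supp: "\<And>\<gamma>. \<gamma> \<in> \<Gamma> \<Longrightarrow> puiseux_nth \<gamma> t \<noteq> 0"
    and wp: "\<And>\<gamma>. \<gamma> \<in> \<Gamma> \<Longrightarrow> (\<Sum>\<rho>\<in>trunc_less t ` \<Gamma>. pord (\<gamma> - \<rho>)) = wp"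
    and S': "S' \<subseteq> \<Gamma>" "S' \<noteq> {}" "inj_on (trunc_less t) S'"
    and sum': "\<And>x. x \<in> S' \<Longrightarrow> (\<Sum>y\<in>S' - {x}. pord (x - y)) \<le> wq"
    and u: "u * card (trunc_less t ` \<Gamma>) < card (trunc_less s ` \<Gamma>)"
  shows "\<exists>S\<subseteq>\<Gamma>. card S = u * card (trunc_less t ` \<Gamma>) + card S' \<and> inj_on (trunc_less s) S \<and>
    (\<forall>x\<in>S. (\<Sum>y\<in>S - {x}. pord (x - y)) \<le> of_nat u * wp + wq)"
proof -
  define R where "R = trunc_less t ` \<Gamma>"
  define R' where "R' = trunc_less t ` S'"
  define F where "F \<rho> = {x \<in> \<Gamma>. trunc_less t x = \<rho>}" for \<rho>
  define c where "c \<rho> = u + (if \<rho> \<in> R' then 1 else 0)" for \<rho>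
  have finR: "finite R" using fin by (simp add: R_def)
  have finF: "finite (F \<rho>)" for \<rho> using fin by (simp add: F_def)
  have R'R: "R' \<subseteq> R" using S'(1) by (auto simp: R_def R'_def)
  have coarse: "trunc_less s x = trunc_less s y \<Longrightarrow> trunc_less t x = trunc_less t y" for x y
    using trunc_less_trunc_less[of t s] \<open>t < s\<close> by (metis less_imp_le)
  obtain \<gamma>0 where \<gamma>0: "\<gamma>0 \<in> \<Gamma>" using S' by blast
  define n where "n = card (trunc_less s ` F (trunc_less t \<gamma>0))"
  have n: "card (trunc_less s ` F \<rho>) = n" if "\<rho> \<in> R" for \<rho>
    using that class_size[OF _ \<gamma>0] by (auto simp: R_def F_def n_def)
  have "card (trunc_less s ` \<Gamma>) = card (\<Union>\<rho>\<in>R. trunc_less s ` F \<rho>)"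
    by (rule arg_cong[where f = card]) (auto simp: R_def F_def)
  also have "\<dots> = (\<Sum>\<rho>\<in>R. card (trunc_less s ` F \<rho>))"
    by (rule card_UN_disjoint) (use finR finF coarse in \<open>auto simp: F_def\<close>)
  also have "\<dots> = card R * n" using n by simp
  finally have "u * card R < n * card R" using u by (simp add: R_def mult.commute)
  then have "u < n" by simp
  have "\<exists>B\<subseteq>F \<rho>. inj_on (trunc_less s) B \<and> card B = c \<rho>" if "\<rho> \<in> R" for \<rho>
  proof -
    have "c \<rho> \<le> card (trunc_less s ` F \<rho>)" using n[OF that] \<open>u < n\<close> by (simp add: c_def)
    then obtain T where T: "T \<subseteq> trunc_less s ` F \<rho>" "card T = c \<rho>" using obtain_subset_with_card_n by metis
    then obtain B where "B \<subseteq> F \<rho>" "inj_on (trunc_less s) B" "T = trunc_less s ` B"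
      unfolding subset_image_inj by blast
    then show ?thesis using T(2) by (auto simp: card_image)
  qed
  then obtain B where B: "\<And>\<rho>. \<rho> \<in> R \<Longrightarrow> B \<rho> \<subseteq> F \<rho>" "\<And>\<rho>. \<rho> \<in> R \<Longrightarrow> inj_on (trunc_less s) (B \<rho>)"
    "\<And>\<rho>. \<rho> \<in> R \<Longrightarrow> card (B \<rho>) = c \<rho>" by metis
  have inB: "x \<in> \<Gamma>" "trunc_less t x = \<rho>" if "x \<in> B \<rho>" "\<rho> \<in> R" for x \<rho>
    using B(1)[OF that(2)] that(1) by (auto simp: F_def)
  have finB: "finite (B \<rho>)" if "\<rho> \<in> R" for \<rho> using B(1)[OF that] finF by (rule finite_subset)
  have disj: "B \<rho> \<inter> B \<rho>' = {}" if "\<rho> \<in> R" "\<rho>' \<in> R" "\<rho> \<noteq> \<rho>'" for \<rho> \<rho>'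
    using that inB(2) by blast
  define S where "S = (\<Union>\<rho>\<in>R. B \<rho>)"
  have sum_c: "(\<Sum>\<rho>\<in>R. of_nat (c \<rho>) * h \<rho>) = of_nat u * (\<Sum>\<rho>\<in>R. h \<rho>) + (\<Sum>\<rho>\<in>R'. h \<rho>)" for h :: "_ \<Rightarrow> rat"
  proof -
    have "(\<Sum>\<rho>\<in>R. of_nat (c \<rho>) * h \<rho>) = (\<Sum>\<rho>\<in>R. of_nat u * h \<rho> + (if \<rho> \<in> R' then h \<rho> else 0))"
      by (rule sum.cong) (auto simp: c_def algebra_simps)
    also have "\<dots> = of_nat u * (\<Sum>\<rho>\<in>R. h \<rho>) + (\<Sum>\<rho>\<in>R \<inter> R'. h \<rho>)"
      by (simp add: sum.distrib sum_distrib_left sum.inter_restrict[OF finR])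
    also have "R \<inter> R' = R'" using R'R by blast
    finally show ?thesis .
  qed
  have "card S = (\<Sum>\<rho>\<in>R. card (B \<rho>))"
    unfolding S_def by (rule card_UN_disjoint) (use finR finB disj in auto)
  also have "\<dots> = (\<Sum>\<rho>\<in>R. c \<rho>)" using B(3) by simp
  finally have "(of_nat (card S) :: rat) = of_nat (u * card R + card R')"
    using sum_c[of "\<lambda>_. 1"] by simp
  then have cardS: "card S = u * card R + card S'"
    unfolding of_nat_eq_iff R'_def by (simp add: card_image[OF S'(3)])
  have injS: "inj_on (trunc_less s) S"
  proof (rule inj_onI)
    fix x y assume "x \<in> S" "y \<in> S" and eq: "trunc_less s x = trunc_less s y"
    then obtain \<rho> \<rho>' where *: "\<rho> \<in> R" "x \<in> B \<rho>" "\<rho>' \<in> R" "y \<in> B \<rho>'" by (auto simp: S_def)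
    then have "\<rho> = \<rho>'" using coarse[OF eq] inB(2) by metis
    then show "x = y" using B(2) * eq by (auto dest: inj_onD)
  qed
  have "(\<Sum>y\<in>S - {x}. pord (x - y)) \<le> of_nat u * wp + wq" if xS: "x \<in> S" for x
  proof -
    obtain \<rho>0 where \<rho>0: "\<rho>0 \<in> R" "x \<in> B \<rho>0" using xS by (auto simp: S_def)
    have x: "x \<in> \<Gamma>" "trunc_less t x = \<rho>0" using inB \<rho>0 by auto
    have "S - {x} = (\<Union>\<rho>\<in>R. B \<rho> - {x})" by (auto simp: S_def)
    then have "(\<Sum>y\<in>S - {x}. pord (x - y)) = (\<Sum>\<rho>\<in>R. \<Sum>y\<in>B \<rho> - {x}. pord (x - y))"
      by (simp only:) (rule sum.UNION_disjoint, use finR finB disj in \<open>blast+\<close>)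
    also have "\<dots> \<le> (\<Sum>\<rho>\<in>R. of_nat (c \<rho>) * pord (x - \<rho>) - (if \<rho> = \<rho>0 then t else 0))"
    proof (rule sum_mono)
      fix \<rho> assume \<rho>: "\<rho> \<in> R"
      show "(\<Sum>y\<in>B \<rho> - {x}. pord (x - y)) \<le> of_nat (c \<rho>) * pord (x - \<rho>) - (if \<rho> = \<rho>0 then t else 0)"
      proof (cases "\<rho> = \<rho>0")
        case False
        then have "x \<notin> B \<rho>" using inB(2)[OF _ \<rho>] x(2) by blast
        moreover have "pord (x - y) = pord (x - \<rho>)" if "y \<in> B \<rho>" for y
          using pord_diff_trunc_other[of t x y] inB(2)[OF that \<rho>] x(2) False by simp
        ultimately show ?thesis using False B(3)[OF \<rho>] by simp
      next
        case True
        have "(\<Sum>y\<in>B \<rho> - {x}. pord (x - y)) \<le> of_nat (card (B \<rho> - {x})) * t"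
        proof (rule sum_bounded_above)
          fix y assume y: "y \<in> B \<rho> - {x}"
          have "trunc_less s x \<noteq> trunc_less s y"
            using B(2)[OF \<rho>] \<rho>0(2) True y by (auto dest: inj_onD)
          moreover have "y \<in> \<Gamma>" using inB(1)[OF _ \<rho>] y by simp
          ultimately show "pord (x - y) \<le> t" using sep[OF x(1)] by simp
        qed
        moreover have "of_nat (c \<rho>) = of_nat (card (B \<rho> - {x})) + (1 :: rat)"
          using card_Suc_Diff1[OF finB[OF \<rho>], of x] \<rho>0(2) True B(3)[OF \<rho>]
          by (metis of_nat_Suc add.commute)
        moreover have "pord (x - \<rho>) = t"
          using pord_diff_trunc_same[OF refl supp[OF x(1)]] x(2) True by simp
        ultimately show ?thesis using True by (simp add: distrib_right)
      qed
    qed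
    also have "\<dots> = of_nat u * wp + (\<Sum>\<rho>\<in>R'. pord (x - \<rho>)) - t"
      using \<rho>0(1) finR wp[OF x(1)] by (simp add: sum_subtractf sum_c) (simp add: R_def)
    also have "\<dots> \<le> of_nat u * wp + wq"
      using sum_pord_trunc_le[OF x(1) supp[OF x(1)] S' sum'] by (simp add: R'_def)
    finally show ?thesis .
  qed
  then show ?thesis
    using cardS injS inB(1) by (intro exI[of _ S]) (auto simp: S_def R_def)
qed

text \<open>
  The set \<open>S\<close> certifies that the common order \<open>w\<close> of the values of \<open>p\<close> is largest possible, by means of
  \<open>monic_value_bound\<close>. Injectivity of the truncation on \<open>S\<close> lets the next recursion step refine \<open>S\<close>.
\<close>

definition optimal :: "rat \<Rightarrow> nat \<Rightarrow> 'l puiseux poly \<Rightarrow> bool" where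
  "optimal s d p \<longleftrightarrow> rational p \<and> lead_coeff p = 1 \<and> degree p = d \<and>
     (\<exists>w S. (\<forall>\<gamma>\<in>\<Gamma>. poly p \<gamma> \<noteq> 0 \<and> pord (poly p \<gamma>) = w) \<and>
        S \<subseteq> \<Gamma> \<and> card S = Suc d \<and> inj_on (trunc_less s) S \<and>
        (\<forall>x\<in>S. (\<Sum>y\<in>S - {x}. pord (x - y)) \<le> w))"

text \<open>
  Induction on the number of nodes at level \<open>s\<close>. It decreases in the recursive call because the maximal
  contact is attained, so two nodes merge at level \<open>t\<close>. The remainder is smaller than the number of
  nodes at level \<open>t\<close>, as the induction hypothesis demands.
\<close>

lemma algorithm_optimal:
  assumes "0 < d" "d < card (trunc_less s ` \<Gamma>)"
  shows "IntegralBasisElement_dom (trunc_less s ` \<Gamma>, d) \<and>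
    optimal s d (IntegralBasisElement (trunc_less s ` \<Gamma>) d)"
  using assms
proof (induction "card (trunc_less s ` \<Gamma>)" arbitrary: s d rule: less_induct)
  case less
  then have "1 < card (trunc_less s ` \<Gamma>)" by linarith
  then obtain t where t: "t < s" "max_extended_char_exponent (trunc_less s ` \<Gamma>) = t"
    and sep: "\<And>\<gamma> \<gamma>'. \<gamma> \<in> \<Gamma> \<Longrightarrow> \<gamma>' \<in> \<Gamma> \<Longrightarrow> trunc_less s \<gamma> \<noteq> trunc_less s \<gamma>' \<Longrightarrow> pord (\<gamma> - \<gamma>') \<le> t"
    and merge: "\<exists>\<gamma>1\<in>\<Gamma>. \<exists>\<gamma>2\<in>\<Gamma>. trunc_less s \<gamma>1 \<noteq> trunc_less s \<gamma>2 \<and> trunc_less t \<gamma>1 = trunc_less t \<gamma>2"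
    and supp: "\<And>\<gamma>. \<gamma> \<in> \<Gamma> \<Longrightarrow> puiseux_nth \<gamma> t \<noteq> 0"
    by (rule top_exponent) blast
  define R where "R = trunc_less t ` \<Gamma>"
  have R: "trunc_less t ` trunc_less s ` \<Gamma> = R"
    using t(1) by (simp add: R_def image_image trunc_less_trunc_less)
  have finR: "finite R" using fin by (simp add: R_def)
  obtain \<gamma>0 where \<gamma>0: "\<gamma>0 \<in> \<Gamma>" using merge by blast
  then have m': "card R > 0" using fin by (auto simp: R_def card_gt_0_iff)
  have "card R < card (trunc_less s ` \<Gamma>)"
  proof -
    have "card R \<noteq> card (trunc_less s ` \<Gamma>)"
    proof
      assume "card R = card (trunc_less s ` \<Gamma>)"
      then have "inj_on (trunc_less t) (trunc_less s ` \<Gamma>)"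
        using fin by (intro eq_card_imp_inj_on) (simp_all add: R)
      then show False using merge t(1) trunc_less_trunc_less[of t s] by (metis imageI inj_onD less_imp_le)
    qed
    then show ?thesis using card_image_le[of "trunc_less s ` \<Gamma>" "trunc_less t"] fin by (simp add: R)
  qed
  define u where "u = d div card R"
  define d' where "d' = d - u * card R"
  have d': "d' = d mod card R" by (simp add: d'_def u_def minus_div_mult_eq_mod)
  have dm: "d = u * card R + d'" by (simp add: d' u_def)
  define q where "q = (if d' > 0 then IntegralBasisElement R d' else 1)"
  have q: "(0 < d' \<longrightarrow> IntegralBasisElement_dom (R, d')) \<and> optimal t d' q"
  proof (cases "d' > 0")
    case True
    have "d' < card R" using m' by (simp add: d')
    then show ?thesis
      using less.hyps[of t d'] \<open>card R < card (trunc_less s ` \<Gamma>)\<close> True by (simp add: R_def q_def)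
  next
    case False
    \<comment> \<open>For remainder zero the algorithm takes \<open>q = 1\<close>, whose optimality is certified by a single point.\<close>
    then have "optimal t d' q"
      using \<gamma>0 by (auto simp: optimal_def q_def rational_1 pord_1 intro!: exI[of _ "{\<gamma>0}"])
    then show ?thesis using False by simp
  qed
  have dom: "IntegralBasisElement_dom (trunc_less s ` \<Gamma>, d)"
    by (rule IntegralBasisElement.domintros) (use q in \<open>auto simp: t(2) R d'_def u_def\<close>)
  define P where "P = (\<Prod>\<rho>\<in>R. [:- \<rho>, 1:])"
  have IBE: "IntegralBasisElement (trunc_less s ` \<Gamma>) d = P ^ u * q"
    using IntegralBasisElement.psimps[OF dom]
    by (simp add: Let_def t(2) R q_def d'_def u_def P_def)
  have "lead_coeff P = 1" by (simp add: P_def lead_coeff_prod)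
  then have P: "lead_coeff P = 1" "degree P = card R" "P \<noteq> 0"
    by (auto simp: P_def degree_prod_eq_sum_degree)
  have "rational P" unfolding P_def R_def by (rule rational_node)
  then have ratP: "rational (P ^ u)" for u by (induction u) (simp_all add: rational_1 rational_mult)
  have Pval: "poly P \<gamma> \<noteq> 0 \<and> pord (poly P \<gamma>) = (\<Sum>\<rho>\<in>R. pord (\<gamma> - \<rho>))" if "\<gamma> \<in> \<Gamma>" for \<gamma>
  proof -
    have "\<gamma> - \<rho> \<noteq> 0" if "\<rho> \<in> R" for \<rho>
    proof
      assume "\<gamma> - \<rho> = 0"
      then have "puiseux_nth \<gamma> t = puiseux_nth \<rho> t" by simp
      then show False using supp[OF \<open>\<gamma> \<in> \<Gamma>\<close>] that by (auto simp: R_def puiseux_nth_trunc_less)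
    qed
    moreover have "poly P \<gamma> = (\<Prod>\<rho>\<in>R. \<gamma> - \<rho>)" by (simp add: P_def poly_prod)
    ultimately show ?thesis using finR by (simp add: pord_prod)
  qed
  define wp where "wp = (\<Sum>\<rho>\<in>R. pord (\<gamma>0 - \<rho>))"
  have wp: "(\<Sum>\<rho>\<in>R. pord (\<gamma> - \<rho>)) = wp" if "\<gamma> \<in> \<Gamma>" for \<gamma>
    using pord_node[OF that \<gamma>0, of t] Pval[OF that] Pval[OF \<gamma>0] by (simp add: wp_def P_def R_def)
  obtain wq S' where wq: "\<forall>\<gamma>\<in>\<Gamma>. poly q \<gamma> \<noteq> 0 \<and> pord (poly q \<gamma>) = wq"
    and S': "S' \<subseteq> \<Gamma>" "card S' = Suc d'" "inj_on (trunc_less t) S'"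
      "\<forall>x\<in>S'. (\<Sum>y\<in>S' - {x}. pord (x - y)) \<le> wq"
    using q unfolding optimal_def by blast
  have "S' \<noteq> {}" using S'(2) by auto
  have "u * card R < card (trunc_less s ` \<Gamma>)" using less.prems(2) dm by linarith
  then have "\<exists>S\<subseteq>\<Gamma>. card S = u * card (trunc_less t ` \<Gamma>) + card S' \<and> inj_on (trunc_less s) S \<and>
    (\<forall>x\<in>S. (\<Sum>y\<in>S - {x}. pord (x - y)) \<le> of_nat u * wp + wq)"
    using S'(4) wp by (intro spread_extension[OF t(1) sep supp _ S'(1) \<open>S' \<noteq> {}\<close> S'(3)]) (auto simp: R_def)
  then obtain S where S: "S \<subseteq> \<Gamma>" "card S = Suc d" "inj_on (trunc_less s) S"
    "\<forall>x\<in>S. (\<Sum>y\<in>S - {x}. pord (x - y)) \<le> of_nat u * wp + wq"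
    using S'(2) dm by (auto simp: R_def)
  have qd: "rational q" "lead_coeff q = 1" "degree q = d'" using q by (auto simp: optimal_def)
  have "optimal s d (P ^ u * q)"
    unfolding optimal_def
  proof (intro conjI exI[of _ "of_nat u * wp + wq"] exI[of _ S] S ballI)
    show "rational (P ^ u * q)" using ratP qd by (intro rational_mult)
    show "lead_coeff (P ^ u * q) = 1" using P qd by (simp add: lead_coeff_mult lead_coeff_power)
    have "q \<noteq> 0" using qd by auto
    then show "degree (P ^ u * q) = d" using P qd dm by (simp add: degree_mult_eq degree_power_eq)
    fix \<gamma> assume \<gamma>: "\<gamma> \<in> \<Gamma>"
    show "poly (P ^ u * q) \<gamma> \<noteq> 0" using Pval[OF \<gamma>] wq \<gamma> by simp
    show "pord (poly (P ^ u * q) \<gamma>) = of_nat u * wp + wq"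
      using Pval[OF \<gamma>] wq \<gamma> wp[OF \<gamma>] by (simp add: pord_mult pord_power)
  qed
  then show ?case using dom IBE by simp
qed

text \<open>
  As all expansions have the same support and the same class sizes, they share one regularity index \<open>e\<close>,
  the maximal order of contact. Exponents are multiples of \<open>1 / k\<close>, so truncation up to \<open>e\<close> is truncation
  below \<open>e + 1 / k\<close>, and the singular parts form a level of the tree.
\<close>

lemma singular_part_trunc:
  assumes "1 < card \<Gamma>"
  obtains s where "inj_on (trunc_less s) \<Gamma>" "\<And>\<gamma>. \<gamma> \<in> \<Gamma> \<Longrightarrow> singular_part \<Gamma> \<gamma> = trunc_less s \<gamma>"
proof -
  \<comment> \<open>A level beyond all orders of contact, where the nodes correspond to the expansions.\<close>
  define s0 where "s0 = 1 + Max ((\<lambda>(\<gamma>, \<gamma>'). pord (\<gamma> - \<gamma>')) ` (\<Gamma> \<times> \<Gamma>))"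
  have "pord (\<gamma> - \<gamma>') < s0" if "\<gamma> \<in> \<Gamma>" "\<gamma>' \<in> \<Gamma>" for \<gamma> \<gamma>'
  proof -
    have "pord (\<gamma> - \<gamma>') \<le> Max ((\<lambda>(\<gamma>, \<gamma>'). pord (\<gamma> - \<gamma>')) ` (\<Gamma> \<times> \<Gamma>))"
      using that fin by (intro Max_ge) auto
    then show ?thesis by (simp add: s0_def)
  qed
  then have inj0: "inj_on (trunc_less s0) \<Gamma>"
    by (intro inj_onI) (metis trunc_less_neq_iff)
  then have "1 < card (trunc_less s0 ` \<Gamma>)" using assms by (simp add: card_image)
  then obtain e where e: "e < s0"
    and sep: "\<And>\<gamma> \<gamma>'. \<gamma> \<in> \<Gamma> \<Longrightarrow> \<gamma>' \<in> \<Gamma> \<Longrightarrow> trunc_less s0 \<gamma> \<noteq> trunc_less s0 \<gamma>' \<Longrightarrow> pord (\<gamma> - \<gamma>') \<le> e"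
    and merge: "\<exists>\<gamma>1\<in>\<Gamma>. \<exists>\<gamma>2\<in>\<Gamma>. trunc_less s0 \<gamma>1 \<noteq> trunc_less s0 \<gamma>2 \<and> trunc_less e \<gamma>1 = trunc_less e \<gamma>2"
    and supp: "\<And>\<gamma>. \<gamma> \<in> \<Gamma> \<Longrightarrow> puiseux_nth \<gamma> e \<noteq> 0"
    by (rule top_exponent) blast
  have sep': "pord (\<gamma> - \<gamma>') \<le> e" if "\<gamma> \<in> \<Gamma>" "\<gamma>' \<in> \<Gamma>" "\<gamma> \<noteq> \<gamma>'" for \<gamma> \<gamma>'
    using sep that inj0 by (meson inj_onD)
  have index: "regularity_index \<Gamma> \<gamma> = e" if \<gamma>: "\<gamma> \<in> \<Gamma>" for \<gamma>
    unfolding regularity_index_def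
  proof (rule Least_equality)
    have "trunc_le e \<gamma>' \<noteq> trunc_le e \<gamma>" if "\<gamma>' \<in> \<Gamma>" "\<gamma>' \<noteq> \<gamma>" for \<gamma>'
      using sep'[OF that(1) \<gamma> that(2)] puiseux_nth_neq_at_pord[OF that(2)] by (auto simp: trunc_le_eq_iff)
    then show "puiseux_nth \<gamma> e \<noteq> 0 \<and> (\<forall>\<gamma>'\<in>\<Gamma>. \<gamma>' \<noteq> \<gamma> \<longrightarrow> trunc_le e \<gamma>' \<noteq> trunc_le e \<gamma>)"
      using supp[OF \<gamma>] by blast
    fix y assume y: "puiseux_nth \<gamma> y \<noteq> 0 \<and> (\<forall>\<gamma>'\<in>\<Gamma>. \<gamma>' \<noteq> \<gamma> \<longrightarrow> trunc_le y \<gamma>' \<noteq> trunc_le y \<gamma>)"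
    show "e \<le> y"
    proof (rule ccontr)
      assume "\<not> e \<le> y"
      obtain \<gamma>1 \<gamma>2 where 12: "\<gamma>1 \<in> \<Gamma>" "\<gamma>2 \<in> \<Gamma>" "trunc_less s0 \<gamma>1 \<noteq> trunc_less s0 \<gamma>2"
        "trunc_less e \<gamma>1 = trunc_less e \<gamma>2" using merge by blast
      let ?C = "\<lambda>\<gamma>. {x \<in> \<Gamma>. trunc_less e x = trunc_less e \<gamma>}"
      have "card {trunc_less s0 \<gamma>1, trunc_less s0 \<gamma>2} \<le> card (trunc_less s0 ` ?C \<gamma>1)"
        by (rule card_mono) (use fin 12 in auto)
      also have "\<dots> = card (trunc_less s0 ` ?C \<gamma>)" by (rule class_size[OF 12(1) \<gamma>])
      also have "\<dots> \<le> card (?C \<gamma>)" by (rule card_image_le) (use fin in simp)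
      finally have "2 \<le> card (?C \<gamma>)" using 12(3) by simp
      moreover have "?C \<gamma> \<subseteq> {\<gamma>} \<Longrightarrow> card (?C \<gamma>) \<le> card {\<gamma>}" by (rule card_mono) auto
      ultimately have "\<not> ?C \<gamma> \<subseteq> {\<gamma>}" by force
      then obtain x where x: "x \<in> \<Gamma>" "trunc_less e x = trunc_less e \<gamma>" "x \<noteq> \<gamma>" by blast
      then have "trunc_le y x = trunc_le y \<gamma>"
        using \<open>\<not> e \<le> y\<close> by (auto simp: trunc_le_eq_iff trunc_less_eq_iff vge_def)
      with y x show False by blast
    qed
  qed
  define s where "s = e + 1 / of_nat k"
  have "singular_part \<Gamma> \<gamma> = trunc_less s \<gamma>" if \<gamma>: "\<gamma> \<in> \<Gamma>" for \<gamma>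
  proof (rule puiseux_eqI)
    fix r
    have "r \<le> e" if r: "r < s" "puiseux_nth \<gamma> r \<noteq> 0"
    proof -
      obtain i where i: "of_nat k * r = of_int i"
        using exponents[OF \<gamma> r(2)] by (elim Ints_cases)
      obtain j where j: "of_nat k * e = of_int j"
        using exponents[OF \<gamma> supp[OF \<gamma>]] by (elim Ints_cases)
      have "of_nat k * r < of_nat k * s"
        using k by (intro mult_strict_left_mono r(1)) simp
      also have "of_nat k * s = of_nat k * e + 1"
        using k by (simp add: s_def distrib_left)
      finally have "i \<le> j" unfolding i j by linarith
      then have "of_nat k * r \<le> of_nat k * e" unfolding i j by simp
      then show ?thesis using k by simp
    qed
    moreover have "e < s" using k by (simp add: s_def)
    ultimately show "puiseux_nth (singular_part \<Gamma> \<gamma>) r = puiseux_nth (trunc_less s \<gamma>) r"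
      by (auto simp: singular_part_def index[OF \<gamma>] puiseux_nth_trunc_le puiseux_nth_trunc_less)
  qed
  moreover have "inj_on (trunc_less s) \<Gamma>"
  proof (rule inj_onI, rule ccontr)
    fix x y assume *: "x \<in> \<Gamma>" "y \<in> \<Gamma>" "trunc_less s x = trunc_less s y" "x \<noteq> y"
    have "e < s" using k by (simp add: s_def)
    have "\<not> pord (x - y) < s" using *(3,4) trunc_less_neq_iff[of s x y] by simp
    with \<open>e < s\<close> show False using sep'[OF *(1,2,4)] by simp
  qed
  ultimately show ?thesis using that by blast
qed

end

section \<open>Rationality of the node polynomials\<close>

definition puiseux_finite :: "'a::comm_ring_1 puiseux \<Rightarrow> bool" where
  "puiseux_finite x \<longleftrightarrow> (\<exists>N. \<forall>r>N. puiseux_nth x r = 0)"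

lemma puiseux_finite_0: "puiseux_finite 0"
  by (simp add: puiseux_finite_def)

lemma puiseux_finite_1: "puiseux_finite 1"
  unfolding puiseux_finite_def by (rule exI[of _ 0]) (simp add: puiseux_nth_1)

lemma puiseux_finite_add:
  assumes "puiseux_finite x" "puiseux_finite y"
  shows "puiseux_finite (x + y)"
proof -
  obtain N M where "\<forall>r>N. puiseux_nth x r = 0" "\<forall>r>M. puiseux_nth y r = 0"
    using assms by (auto simp: puiseux_finite_def)
  then show ?thesis unfolding puiseux_finite_def by (intro exI[of _ "max N M"]) simp
qed

lemma puiseux_finite_mult:
  assumes "puiseux_finite x" "puiseux_finite y"
  shows "puiseux_finite (x * y)"
proof -
  obtain N M where NM: "\<forall>r>N. puiseux_nth x r = 0" "\<forall>r>M. puiseux_nth y r = 0"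
    using assms by (auto simp: puiseux_finite_def)
  have "puiseux_nth (x * y) r = 0" if "r > N + M" for r
  proof -
    have "puiseux_nth x s = 0 \<or> puiseux_nth y (r - s) = 0" for s
      using NM that by (cases "s > N") auto
    then have "{s. puiseux_nth x s \<noteq> 0 \<and> puiseux_nth y (r - s) \<noteq> 0} = {}" by auto
    then show ?thesis by (simp only: puiseux_nth_mult sum.empty)
  qed
  then show ?thesis unfolding puiseux_finite_def by blast
qed

lemma fps_eventually_0_imp_poly:
  fixes c :: "'a::comm_ring_1 fps"
  assumes "\<And>n. n > N \<Longrightarrow> fps_nth c n = 0"
  shows "\<exists>p. fps_of_poly p = c"
proof (rule exI[of _ "\<Sum>i\<le>N. monom (fps_nth c i) i"], rule fps_ext)
  fix n
  show "fps_nth (fps_of_poly (\<Sum>i\<le>N. monom (fps_nth c i) i)) n = fps_nth c n"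
    using assms[of n] by (auto simp: coeff_sum_monom not_le)
qed

text \<open>
  Conjugations permute the nodes of a level, so the coefficients descend to power series over the base
  field. They are finite sums of terms because the nodes are.
\<close>

lemma (in puiseux_conjugates) trunc_poly_rational:
  "\<exists>p. (\<Prod>\<rho>\<in>trunc_less t ` \<Gamma>. [:- \<rho>, 1:]) = poly_poly_embed \<iota> p"
proof -
  define Q where "Q = (\<Prod>\<rho>\<in>trunc_less t ` \<Gamma>. [:- \<rho>, 1:])"
  have Q: "Q = (\<Prod>\<rho>\<in>#mset_set (trunc_less t ` \<Gamma>). [:- \<rho>, 1:])"
    by (simp add: Q_def prod_unfold_prod_mset)
  have mem: "\<rho> \<in> trunc_less t ` \<Gamma>" if "\<rho> \<in># mset_set (trunc_less t ` \<Gamma>)" for \<rho>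
    using that finite_expansions by simp
  have int: "vge (coeff Q i) 0" for i
    unfolding Q
  proof (rule coeff_prod_linear_closed[where C = "\<lambda>x. vge x 0"])
    show "vge (x * y) 0" if "vge x 0" "vge y 0" for x y :: "'l puiseux"
      using vge_mult[OF that] by simp
    fix \<rho> assume "\<rho> \<in># mset_set (trunc_less t ` \<Gamma>)"
    then obtain \<gamma> where "\<gamma> \<in> \<Gamma>" "\<rho> = trunc_less t \<gamma>" using mem by blast
    then show "vge (- \<rho>) 0"
      using expansion_integral[of \<gamma>] by (simp add: vge_def puiseux_nth_trunc_less)
  qed (simp_all add: vge_1 vge_add)
  have fin: "puiseux_finite (coeff Q i)" for i
    unfolding Q
  proof (rule coeff_prod_linear_closed[where C = puiseux_finite])
    fix \<rho> assume "\<rho> \<in># mset_set (trunc_less t ` \<Gamma>)"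
    then obtain \<gamma> where "\<rho> = trunc_less t \<gamma>" using mem by blast
    then show "puiseux_finite (- \<rho>)"
      unfolding puiseux_finite_def by (intro exI[of _ t]) (simp add: puiseux_nth_trunc_less)
  qed (simp_all add: puiseux_finite_0 puiseux_finite_1 puiseux_finite_add puiseux_finite_mult)
  have "\<exists>q. Q = fps_poly_embed \<iota> q"
    using conj_trunc_poly int by (intro descent) (simp_all add: Q_def)
  then obtain q where q: "Q = fps_poly_embed \<iota> q" by blast
  have "\<exists>p. fps_of_poly p = coeff q i" for i
  proof -
    obtain N where N: "\<And>r. r > N \<Longrightarrow> puiseux_nth (coeff Q i) r = 0"
      using fin[of i] by (auto simp: puiseux_finite_def)
    have "fps_nth (coeff q i) n = 0" if "n > nat \<lceil>N\<rceil>" for n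
    proof -
      have "N < of_nat n" using that by linarith
      then have "puiseux_nth (coeff Q i) (of_nat n) = 0" by (rule N)
      then have "\<iota> (fps_nth (coeff q i) n) = \<iota> 0"
        by (simp add: q fps_poly_embed_map emb.coeff_map puiseux_nth_embed_fps \<iota>.zero)
      then show ?thesis using comm_ring_map_inj[OF emb] by (simp add: inj_eq)
    qed
    then show ?thesis by (rule fps_eventually_0_imp_poly)
  qed
  then obtain p where p: "\<And>i. fps_of_poly (p i) = coeff q i" by metis
  have "map_poly fps_of_poly (\<Sum>i\<le>degree q. monom (p i) i) = q"
    by (rule poly_eqI) (simp add: coeff_map_poly coeff_sum_monom p coeff_eq_0)
  then have "Q = poly_poly_embed \<iota> (\<Sum>i\<le>degree q. monom (p i) i)"
    by (simp add: q poly_poly_embed_def)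
  then show ?thesis unfolding Q_def by blast
qed

lemma poly_poly_embed_map: "poly_poly_embed \<iota> = map_poly (\<lambda>c. embed_fps \<iota> (fps_of_poly c))"
  if "comm_ring_map \<iota>"
proof (rule ext, rule poly_eqI)
  interpret comm_ring_map "embed_fps \<iota>" by (rule comm_ring_map_embed_fps) fact
  fix q i
  show "coeff (poly_poly_embed \<iota> q) i = coeff (map_poly (\<lambda>c. embed_fps \<iota> (fps_of_poly c)) q) i"
    by (simp add: poly_poly_embed_def fps_poly_embed_map coeff_map coeff_map_poly zero)
qed

lemma comm_ring_map_embed_poly:
  assumes "comm_ring_map \<iota>"
  shows "comm_ring_map (\<lambda>c. embed_fps \<iota> (fps_of_poly c))"
  by (rule comm_ring_map_comp[OF _ comm_ring_map_embed_fps[OF assms]])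
    (unfold_locales, simp_all add: fps_of_poly_add fps_of_poly_mult)

lemma monic_of_degree_embed:
  assumes \<iota>: "comm_ring_map \<iota>"
  shows "monic_of_degree (poly_poly_embed \<iota> p) d \<longleftrightarrow> monic_of_degree p d"
proof -
  interpret H: comm_ring_map "\<lambda>c. embed_fps \<iota> (fps_of_poly c)"
    by (rule comm_ring_map_embed_poly[OF \<iota>])
  have inj: "embed_fps \<iota> (fps_of_poly c) = embed_fps \<iota> (fps_of_poly c') \<longleftrightarrow> c = c'" for c c'
    using inj_embed_fps[OF \<iota>] by (simp add: inj_eq)
  have deg: "degree (poly_poly_embed \<iota> p) = degree p"
    unfolding poly_poly_embed_map[OF \<iota>] by (rule degree_map_poly) (use inj[of _ 0] H.zero in auto)
  have "lead_coeff (poly_poly_embed \<iota> p) = 1 \<longleftrightarrow> lead_coeff p = 1"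
    unfolding deg unfolding poly_poly_embed_map[OF \<iota>] H.coeff_map using inj[of _ 1] H.one by simp
  then show ?thesis by (simp add: monic_of_degree_def deg)
qed

section \<open>Optimality of the computed elements\<close>

theorem theorem59:
  fixes \<iota> :: "'k::field_char_0 \<Rightarrow> 'l::alg_closed_field"
    and g :: "'k fps poly"
    and \<Delta> :: "'l puiseux set"
    and m d :: nat
  assumes "field_embedding \<iota>"
    and "weierstrass_poly g"
    and "irreducible g"
    and "degree g = m"
    and "\<Delta> = singular_part (puiseux_expansions \<iota> g) ` puiseux_expansions \<iota> g"
    and "1 \<le> d" and "d \<le> m - 1"
  shows "IntegralBasisElement_dom (\<Delta>, d) \<and>
    (\<exists>p_d :: 'k poly poly.
       IntegralBasisElement \<Delta> d = poly_poly_embed \<iota> p_d \<and>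
       monic_of_degree p_d d \<and>
       (\<forall>q :: 'k poly poly. monic_of_degree q d \<longrightarrow>
          val_at \<iota> g (poly_poly_embed \<iota> q) \<le> val_at \<iota> g (poly_poly_embed \<iota> p_d)))"
proof -
  define \<Gamma> where "\<Gamma> = puiseux_expansions \<iota> g"
  have \<iota>: "comm_ring_map \<iota>" by (rule comm_ring_map_embedding) fact
  have monic: "lead_coeff g = 1" using assms(2) by (simp add: weierstrass_poly_def)
  define e :: "'k fps \<Rightarrow> 'k alg_closure fls" where "e c = fps_to_fls (Abs_fps (\<lambda>n. to_ac (fps_nth c n)))" for c
  interpret e: comm_ring_map e
    by unfold_locales
      (auto simp: e_def fls_times_fps_to_fls[symmetric] fps_to_fls_plus[symmetric] fps_eq_iff fps_mult_nth to_ac_sum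
        simp del: fps_to_fls_plus simp flip: fps_one_to_fls)
  obtain k A where k: "k > 0" and "map_poly (\<lambda>c. fls_compose_power c k) (map_poly e g) = (\<Prod>f\<in>#A. [:- f, 1:])"
    using puiseux_splitting[of "map_poly e g"] e.map_poly_monic[OF monic] by blast
  moreover have "map_poly (\<lambda>c. fls_compose_power c k) (map_poly e g) = map_poly (\<lambda>c. fls_compose_power (e c) k) g"
    by (rule poly_eqI) (simp add: coeff_map_poly e.zero)
  ultimately have "puiseux_conjugates \<iota> g k A"
    unfolding puiseux_conjugates_def using \<iota> monic assms(3) by (simp add: e_def)
  then interpret pc: puiseux_conjugates \<iota> g k A .
  interpret H: comm_ring_map "\<lambda>c. embed_fps \<iota> (fps_of_poly c)"
    by (rule comm_ring_map_embed_poly[OF \<iota>])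
  interpret tree: expansion_tree \<Gamma> k "\<lambda>Q. \<exists>p. Q = poly_poly_embed \<iota> p"
  proof
    show "\<exists>p. 1 = poly_poly_embed \<iota> p"
      unfolding poly_poly_embed_map[OF \<iota>] by (metis map_poly_1' H.one)
    fix P Q :: "'l puiseux poly"
    assume "\<exists>p. P = poly_poly_embed \<iota> p" "\<exists>p. Q = poly_poly_embed \<iota> p"
    then show "\<exists>p. P * Q = poly_poly_embed \<iota> p"
      unfolding poly_poly_embed_map[OF \<iota>] by (metis H.map_poly_mult)
  qed (unfold \<Gamma>_def, (fact pc.finite_expansions k pc.expansion_integral pc.expansion_exponents
      pc.expansion_support pc.class_size_constant pc.pord_trunc_poly_constant pc.trunc_poly_rational)+)
  have card: "card \<Gamma> = m" using pc.card_expansions assms(4) by (simp add: \<Gamma>_def)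
  then have "1 < card \<Gamma>" using assms(6,7) by linarith
  then obtain s where s: "inj_on (trunc_less s) \<Gamma>" "\<And>\<gamma>. \<gamma> \<in> \<Gamma> \<Longrightarrow> singular_part \<Gamma> \<gamma> = trunc_less s \<gamma>"
    by (rule tree.singular_part_trunc) blast
  have \<Delta>: "\<Delta> = trunc_less s ` \<Gamma>" using assms(5) s(2) by (simp add: \<Gamma>_def)
  have "d < card (trunc_less s ` \<Gamma>)" using card assms(6,7) by (simp add: card_image[OF s(1)])
  then have dom: "IntegralBasisElement_dom (\<Delta>, d)"
    and opt: "tree.optimal s d (IntegralBasisElement \<Delta> d)"
    using tree.algorithm_optimal[of d s] assms(6) by (simp_all add: \<Delta>)
  obtain p where p: "IntegralBasisElement \<Delta> d = poly_poly_embed \<iota> p"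
    using opt by (auto simp: tree.optimal_def)
  have "monic_of_degree (poly_poly_embed \<iota> p) d"
    using opt unfolding tree.optimal_def monic_of_degree_def p by blast
  then have monic_p: "monic_of_degree p d" by (simp only: monic_of_degree_embed[OF \<iota>])
  obtain w S where w: "\<forall>\<gamma>\<in>\<Gamma>. poly (poly_poly_embed \<iota> p) \<gamma> \<noteq> 0 \<and> pord (poly (poly_poly_embed \<iota> p) \<gamma>) = w"
    and S: "S \<subseteq> \<Gamma>" "card S = Suc d" "\<forall>x\<in>S. (\<Sum>y\<in>S - {x}. pord (x - y)) \<le> w"
    using opt unfolding tree.optimal_def p by blast
  have "\<Gamma> \<noteq> {}" using \<open>1 < card \<Gamma>\<close> by auto
  have "(\<lambda>\<gamma>. puiseux_val (poly (poly_poly_embed \<iota> p) \<gamma>)) ` \<Gamma> = {Fin w}"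
    using w \<open>\<Gamma> \<noteq> {}\<close> by (auto simp: puiseux_val_pord)
  then have val_p: "val_at \<iota> g (poly_poly_embed \<iota> p) = Fin w"
    by (simp add: val_at_def \<Gamma>_def)
  have "val_at \<iota> g (poly_poly_embed \<iota> q) \<le> Fin w" if "monic_of_degree q d" for q
  proof -
    have "monic_of_degree (poly_poly_embed \<iota> q) d" using that by (simp only: monic_of_degree_embed[OF \<iota>])
    then obtain x where x: "x \<in> S"
      "puiseux_val (poly (poly_poly_embed \<iota> q) x) \<le> Fin (\<Sum>y\<in>S - {x}. pord (x - y))"
      using monic_value_bound[of S "poly_poly_embed \<iota> q"] S finite_subset[OF S(1) tree.fin]
      by (auto simp: monic_of_degree_def)
    have "val_at \<iota> g (poly_poly_embed \<iota> q) \<le> puiseux_val (poly (poly_poly_embed \<iota> q) x)"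
      unfolding val_at_def using x(1) S(1) tree.fin by (intro Min_le) (auto simp: \<Gamma>_def)
    also note x(2)
    also have "Fin (\<Sum>y\<in>S - {x}. pord (x - y)) \<le> Fin w" using S(3) x(1) by simp
    finally show ?thesis .
  qed
  then show ?thesis using dom p monic_p val_p by auto
qed

end
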